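(* Let $K$ and $L$ be two convex bodies in $\mathbb{R}^4$, each having countably many diameters. Assume that there exists $\zeta\in S^3$ such that $K$ has a diameter $d_K(\zeta)$ parallel to $\zeta$ and such that for every $w\in S^3$ with $\zeta\in w^\perp$ the projections $K|w^\perp$ and $L|w^\perp$ are directly congruent. Assume also that for every such $w$ the projections $K|w^\perp$, $L|w^\perp$ have no $(\zeta,\pi)$-symmetry and no $(u,\pi)$-symmetry for any $u\in \zeta^\perp\cap w^\perp\cap S^3$. Then $K=L+b$ or $K=\mathcal{O}L+b$ for some $b\in\mathbb{R}^4$, where $\mathcal{O}=\mathcal{O}_\zeta\in O(4)$ is the orthogonal transformation with $\mathcal{O}|_{\zeta^\perp}=-I$ and $\mathcal{O}(\zeta)=\zeta$. If, in addition, the projections $K|\zeta^\perp$ and $L|\zeta^\perp$ are directly congruent and do not have rigid motion symmetries, then $K=L+b$ for some $b\in\mathbb{R}^4$.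
   Context: A convex body in $\mathbb{R}^n$ is a compact convex set equal to the closure of its non-empty interior. $w^\perp$ is the hyperplane through the origin orthogonal to $w\in S^{n-1}$, and $K|H$ is the orthogonal projection of $K$ onto the subspace $H$. The support function is $h_K(x)=\max\{x\cdot y: y\in K\}$ and the width function is $\omega_K(x)=h_K(x)+h_K(-x)$, $x\in S^{n-1}$. A segment $[z,y]\subset K$ is a diameter of the convex body $K$ if $|z-y|=\max_{\theta\in S^{n-1}}\omega_K(\theta)$. $K$ has at most one diameter parallel to a given direction $\zeta\in S^{n-1}$; if it exists it is denoted $d_K(\zeta)$. $K$ has countably many diameters if $\omega_K$ attains its maximum on a countable subset of $S^{n-1}$. For a subspace $H$ of dimension $k$, sets $A,B\subset H$ are directly congruent if there is a rotation $\varphi\in SO(k,H)$ of $H$ such that $\varphi(A)$ is a translate of $B$. A set $D\subset H$ has a rigid motion symmetry if $\varphi(D)=D+a$ for some $a\in H$ and some non-identity orthogonal transformation $\varphi\in O(k,H)$ of $H$. If $\dim H=3$ and $\xi\in H\cap S^{n-1}$, then $D\subset H$ has a $(\xi,\pi)$-symmetry if $\varphi(D)=D+a$ for some $a\in H$, where $\varphi\in SO(3,H)$ is the rotation by the angle $\pi$ with $\varphi(\xi)=\xi$. *)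

theory Defs
  imports "HOL-Analysis.Analysis"
begin

definition convex_body :: "'a::euclidean_space set \<Rightarrow> bool" where
  "convex_body K \<longleftrightarrow>
     compact K \<and> convex K \<and> interior K \<noteq> {} \<and> K = closure (interior K)"

text \<open>For a convex body the suprema in the next three definitions are attained, i.e. they
  are maxima.\<close>

definition support_fun :: "'a::euclidean_space set \<Rightarrow> 'a \<Rightarrow> real" where
  "support_fun K x = (SUP y\<in>K. x \<bullet> y)"

definition width_fun :: "'a::euclidean_space set \<Rightarrow> 'a \<Rightarrow> real" where
  "width_fun K x = support_fun K x + support_fun K (- x)"

definition max_width :: "'a::euclidean_space set \<Rightarrow> real" where
  "max_width K = (SUP \<theta>\<in>sphere 0 1. width_fun K \<theta>)"

definition diameter_segment :: "'a::euclidean_space set \<Rightarrow> 'a \<Rightarrow> 'a \<Rightarrow> bool" where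
  "diameter_segment K z y \<longleftrightarrow> closed_segment z y \<subseteq> K \<and> norm (z - y) = max_width K"

definition has_diameter_parallel :: "'a::euclidean_space set \<Rightarrow> 'a \<Rightarrow> bool" where
  "has_diameter_parallel K \<zeta> \<longleftrightarrow>
     (\<exists>z y. diameter_segment K z y \<and> (\<exists>t. z - y = t *\<^sub>R \<zeta>))"

definition countably_many_diameters :: "'a::euclidean_space set \<Rightarrow> bool" where
  "countably_many_diameters K \<longleftrightarrow>
     countable {\<theta> \<in> sphere 0 1. width_fun K \<theta> = max_width K}"

definition orth_projection :: "'a::euclidean_space set \<Rightarrow> 'a set \<Rightarrow> 'a set" where
  "orth_projection H K = {p \<in> H. \<exists>x\<in>K. x - p \<in> H\<^sup>\<bottom>}"

text \<open>Every orthogonal transformation of a subspace \<open>H\<close> has exactly one extension to an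
  orthogonal transformation of the whole space that fixes the orthogonal complement of \<open>H\<close>
  pointwise, and the extension has the same determinant. The groups \<open>O(k,H)\<close> and \<open>SO(k,H)\<close>,
  for \<open>k = dim H\<close>, are represented by these extensions.\<close>

definition orthogonal_group_on :: "(real^'n) set \<Rightarrow> (real^'n \<Rightarrow> real^'n) set" where
  "orthogonal_group_on H =
     {\<phi>. orthogonal_transformation \<phi> \<and> \<phi> ` H = H \<and> (\<forall>x\<in>H\<^sup>\<bottom>. \<phi> x = x)}"

definition special_orthogonal_group_on :: "(real^'n) set \<Rightarrow> (real^'n \<Rightarrow> real^'n) set" where
  "special_orthogonal_group_on H = {\<phi> \<in> orthogonal_group_on H. det (matrix \<phi>) = 1}"

definition directly_congruent_on ::
  "(real^'n) set \<Rightarrow> (real^'n) set \<Rightarrow> (real^'n) set \<Rightarrow> bool" where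
  "directly_congruent_on H A B \<longleftrightarrow>
     (\<exists>\<phi>\<in>special_orthogonal_group_on H. \<exists>a\<in>H. \<phi> ` A = (\<lambda>x. x + a) ` B)"

definition rigid_motion_symmetric_on :: "(real^'n) set \<Rightarrow> (real^'n) set \<Rightarrow> bool" where
  "rigid_motion_symmetric_on H D \<longleftrightarrow>
     (\<exists>\<phi>\<in>orthogonal_group_on H. (\<exists>x\<in>H. \<phi> x \<noteq> x) \<and> (\<exists>a\<in>H. \<phi> ` D = (\<lambda>x. x + a) ` D))"

text \<open>Intended for \<open>dim H = 3\<close> and a unit vector \<open>\<xi>\<close> in \<open>H\<close>: the rotation by the angle \<open>\<pi>\<close>
  about \<open>\<xi>\<close> acts as \<open>-I\<close> on the plane in \<open>H\<close> orthogonal to \<open>\<xi>\<close>.\<close>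

definition pi_symmetric_on :: "(real^'n) set \<Rightarrow> real^'n \<Rightarrow> (real^'n) set \<Rightarrow> bool" where
  "pi_symmetric_on H \<xi> D \<longleftrightarrow>
     (\<exists>\<phi>\<in>special_orthogonal_group_on H.
        \<phi> \<xi> = \<xi> \<and> (\<forall>x\<in>H \<inter> {\<xi>}\<^sup>\<bottom>. \<phi> x = - x) \<and> (\<exists>a\<in>H. \<phi> ` D = (\<lambda>x. x + a) ` D))"

end

(* Centre the zeta-diameters of K and L at the origin and write the support functions as
   f(x, s) and g(x, s), with x in the hyperplane orthogonal to zeta and s the coordinate along zeta.
   For w off countably many great circles the projections have only the diameter parallel to zeta,
   so the congruence maps zeta to zeta or to -zeta and involves no translation. On the great circle
   orthogonal to w it is then either a rotation, with f(rot x, s) = g(x, s), or a reflection in a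
   line, with f(flip x, -s) = g(x, s). Both alternatives are closed in w and cover the sphere by
   density; they exclude each other since composing the two would give a (u, pi)-symmetry. So one
   of them holds everywhere.

   Reflections cannot occur everywhere: their axes would form a line field up to finite ambiguity,
   contradicting the hairy ball theorem. If rotations occur everywhere, the injectivity of the Funk
   transform on even functions shows that f and g have the same even part and the same squared odd
   part. These are invariant under the rotations, so an angle other than 0 and pi would make them
   constant on some great circle, which gives a (zeta, pi)-symmetry. Hence the sphere is the
   disjoint union of the closed sets where the angle is 0 and pi, and one of them is everything. *)

theory Submission
  imports Defs
begin

section \<open>Rotations and reflections of great circles\<close>

text \<open>A congruence fixes its angle or axis only up to the rotations that preserve
  \<open>f\<close> on that great circle, and this group may jump with \<open>w\<close>; so neither
  angle nor axis can simply be followed continuously. Two devices help. The axes \<open>w\<close>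
  that admit some angle form the projection of a compact set, hence a closed set, and nothing has to
  be chosen. Where a single value is needed, the groups have orders dividing one common
  \<open>M\<close>: none of them is the full circle, and by compactness arbitrarily small
  invariances would produce a full circle in the limit. So \<open>M\<close> times the angle is well
  defined, which gives a continuous section for the flips and finitely many candidate angles for the
  rotations.

  The Funk transform sees only even functions, so of the odd part only the square is recovered; the
  lost sign is what leaves both 0 and pi possible. Countability of the diameters enters because each
  unwanted diameter direction rules out just one great circle of axes. The coordinate along \<zeta>
  is inert under rotations of a circle, so the rotation lemmas treat it as an index of arbitrary
  type.\<close>

definition rot :: "real^3 \<Rightarrow> real \<Rightarrow> real^3 \<Rightarrow> real^3" where
  "rot w a x = cos a *\<^sub>R x + sin a *\<^sub>R cross3 w x"

definition flip :: "real^3 \<Rightarrow> real^3 \<Rightarrow> real^3" where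
  "flip u x = (2 * (u \<bullet> x)) *\<^sub>R u - x"

text \<open>Angles stay real numbers, so for a unit \<open>w\<close> this is a subgroup of the reals
  containing the multiples of 2 pi. In the applications the index is the coordinate along \<zeta>,
  or a pair that lets several functions share one group.\<close>

definition rot_invariances :: "(real^3 \<Rightarrow> 'i \<Rightarrow> real) \<Rightarrow> real^3 \<Rightarrow> real set" where
  "rot_invariances q w = {a. \<forall>x i. x \<bullet> w = 0 \<longrightarrow> q (rot w a x) i = q x i}"

lemma cross_cross_unit:
  assumes "norm w = 1" "x \<bullet> w = 0"
  shows "cross3 w (cross3 w x) = - x"
  using assms by (simp add: Lagrange inner_commute norm_eq_1)

lemma norm_cross_unit:
  assumes "norm w = 1" "x \<bullet> w = 0"
  shows "norm (cross3 w x) = norm x"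
  using norm_cross_dot[of w x] assms by (simp add: inner_commute)

lemma rot_orthogonal: "x \<bullet> w = 0 \<Longrightarrow> rot w a x \<bullet> w = 0"
  by (simp add: rot_def inner_add_left dot_cross_self)

lemma cross_orthogonal [simp]: "cross3 w x \<bullet> w = 0" "w \<bullet> cross3 w x = 0" "cross3 w x \<bullet> x = 0" "x \<bullet> cross3 w x = 0"
  by (simp_all add: dot_cross_self)

lemma rot_scaleR: "rot w a (c *\<^sub>R x) = c *\<^sub>R rot w a x"
  by (simp add: rot_def cross_mult_right scaleR_add_right mult.commute)

lemma rot_rot:
  assumes "norm w = 1" "x \<bullet> w = 0"
  shows "rot w a (rot w b x) = rot w (a + b) x"
proof -
  have "rot w a (rot w b x) =
      (cos a * cos b - sin a * sin b) *\<^sub>R x + (sin a * cos b + cos a * sin b) *\<^sub>R cross3 w x"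
    using cross_cross_unit[OF assms]
    by (simp add: rot_def cross_add_right cross_mult_right scaleR_add_right scaleR_add_left scaleR_diff_left scaleR_diff_right mult.commute)
  then show ?thesis by (simp add: rot_def cos_add sin_add)
qed

lemma rot_0 [simp]: "rot w 0 x = x"
  and rot_pi [simp]: "rot w pi x = - x"
  by (simp_all add: rot_def)

lemma rot_periodic: "rot w (a + 2 * pi * of_int k) x = rot w a x"
proof -
  have "cos (a + 2 * pi * of_int k) = cos a" "sin (a + 2 * pi * of_int k) = sin a"
    using cos.plus_of_int[of a k] sin.plus_of_int[of a k] by (simp_all add: mult.commute)
  then show ?thesis by (simp add: rot_def)
qed

lemma rot_inner:
  assumes "norm w = 1" "x \<bullet> w = 0"
  shows "rot w a x \<bullet> rot w b x = cos (a - b) * (norm x)\<^sup>2"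
proof -
  have "cross3 w x \<bullet> cross3 w x = (norm x)\<^sup>2"
    using norm_cross_unit[OF assms] by (metis power2_norm_eq_inner)
  then show ?thesis
    by (simp add: rot_def inner_add_left inner_add_right cos_diff power2_norm_eq_inner) (simp add: algebra_simps)
qed

lemma norm_rot:
  assumes "norm w = 1" "x \<bullet> w = 0"
  shows "norm (rot w a x) = norm x"
  using rot_inner[OF assms, of a a] by (simp add: norm_eq_sqrt_inner)

lemma plane_expand:
  assumes "norm w = 1" "norm x = 1" "x \<bullet> w = 0" "y \<bullet> w = 0"
  shows "y = (y \<bullet> x) *\<^sub>R x + (y \<bullet> cross3 w x) *\<^sub>R cross3 w x"
proof -
  \<comment> \<open>Since \<open>x\<close> and \<open>y\<close> are orthogonal to \<open>w\<close>,
    their cross product is parallel to \<open>w\<close>; crossing it with \<open>x\<close> splits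
    \<open>y\<close> into its two components.\<close>
  have 1: "cross3 w (cross3 x y) = 0"
    using assms by (simp add: Lagrange inner_commute)
  have "cross3 (cross3 w x) (cross3 w y) = (w \<bullet> cross3 x y) *\<^sub>R w"
    by (simp add: cross3_def inner_vec_def sum_3 vec_eq_iff forall_3 algebra_simps)
  have ww: "w \<bullet> w = 1" "x \<bullet> x = 1" using assms by (simp_all add: norm_eq_1)
  have t: "y \<bullet> cross3 w x = cross3 x y \<bullet> w" 
    by (simp add: cross3_def inner_vec_def sum_3 algebra_simps)
  have "cross3 x y = (cross3 x y \<bullet> w) *\<^sub>R w"
    using Lagrange[of w w "cross3 x y"] ww 1 by (simp add: inner_commute)
  then have "cross3 (cross3 x y) x = (y \<bullet> cross3 w x) *\<^sub>R cross3 w x"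
    using t by (metis cross_mult_left)
  moreover have "cross3 (cross3 x y) x = y - (y \<bullet> x) *\<^sub>R x"
    using ww by (metis (no_types) Lagrange cross_skew cross_minus_right minus_diff_eq scaleR_one inner_commute)
  ultimately show ?thesis by (metis add.commute diff_add_cancel)
qed

lemma rot_transitive:
  assumes "norm w = 1" "x \<bullet> w = 0" "y \<bullet> w = 0" "norm x = norm y"
  obtains a where "0 \<le> a" "a < 2 * pi" "y = rot w a x"
proof (cases "x = 0")
  case True
  then show ?thesis using assms that[of 0] by auto
next
  case False
  define r where "r = norm x"
  have r: "r > 0" using False by (simp add: r_def)
  define x' y' where "x' = x /\<^sub>R r" and "y' = y /\<^sub>R r"
  have n: "norm x' = 1" "norm y' = 1" "x' \<bullet> w = 0" "y' \<bullet> w = 0"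
    using r assms by (auto simp: x'_def y'_def r_def)
  have e: "y' = (y' \<bullet> x') *\<^sub>R x' + (y' \<bullet> cross3 w x') *\<^sub>R cross3 w x'"
    using plane_expand[OF assms(1) n(1,3,4)] .
  have "y' \<bullet> y' = (y' \<bullet> x') * (y' \<bullet> x') + (y' \<bullet> cross3 w x') * (y' \<bullet> cross3 w x')"
    by (subst (2) e) (simp add: inner_add_right)
  then have "(y' \<bullet> x')\<^sup>2 + (y' \<bullet> cross3 w x')\<^sup>2 = 1"
    using n by (simp add: norm_eq_1 power2_eq_square)
  then obtain a where a: "0 \<le> a" "a < 2 * pi" "y' \<bullet> x' = cos a" "y' \<bullet> cross3 w x' = sin a"
    using sincos_total_2pi by metis
  have "y' = rot w a x'" using e a by (simp add: rot_def)
  then have "r *\<^sub>R y' = rot w a (r *\<^sub>R x')" by (simp add: rot_scaleR)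
  then have "y = rot w a x" using r by (simp add: x'_def y'_def)
  then show ?thesis using that a by auto
qed

text \<open>In the polar angle about \<open>w\<close> measured from \<open>u\<close>, the flip with
  axis at angle \<open>b\<close> sends \<open>a\<close> to \<open>2 * b - a\<close>; all later
  compositions of flips and rotations reduce to this.\<close>

lemma flip_rot:
  assumes "norm w = 1" "norm u = 1" "u \<bullet> w = 0"
  shows "flip (rot w b u) (rot w a u) = rot w (2 * b - a) u"
proof -
  have "flip (rot w b u) (rot w a u) =
     (2 * cos (b - a) * cos b - cos a) *\<^sub>R u + (2 * cos (b - a) * sin b - sin a) *\<^sub>R cross3 w u"
    using assms by (simp add: flip_def rot_inner) (simp add: rot_def algebra_simps)
  moreover have "2 * cos (b - a) * cos b - cos a = cos (2 * b - a)"
    using cos_times_cos[of "b - a" b] by (simp add: algebra_simps)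
  moreover have "2 * cos (b - a) * sin b - sin a = sin (2 * b - a)"
    using sin_times_cos[of b "b - a"] by (simp add: algebra_simps)
  ultimately show ?thesis by (simp add: rot_def)
qed

lemma flip_scaleR: "flip u (c *\<^sub>R x) = c *\<^sub>R flip u x"
  by (simp add: flip_def algebra_simps)

lemma flip_orthogonal: "u \<bullet> w = 0 \<Longrightarrow> x \<bullet> w = 0 \<Longrightarrow> flip u x \<bullet> w = 0"
  by (simp add: flip_def inner_diff_left)

lemma plane_polar:
  assumes "norm w = 1" "norm u = 1" "u \<bullet> w = 0" "x \<bullet> w = 0"
  obtains a where "x = norm x *\<^sub>R rot w a u"
proof -
  obtain a where "x = rot w a (norm x *\<^sub>R u)"
    using rot_transitive[of w "norm x *\<^sub>R u" x] assms by auto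
  then show ?thesis using that by (metis rot_scaleR)
qed

lemma exists_orthogonal_unit:
  fixes w :: "real^3"
  obtains u where "norm u = 1" "u \<bullet> w = 0"
proof -
  obtain u where "u \<noteq> 0" "orthogonal w u"
    using orthogonal_to_vector_exists[of w] by auto
  then show ?thesis using that[of "u /\<^sub>R norm u"]
    by (auto simp: orthogonal_def inner_commute)
qed

lemma flip_flip_rot:
  assumes "norm w = 1" "norm u = 1" "u \<bullet> w = 0" "x \<bullet> w = 0"
  shows "flip (rot w b u) (flip (rot w c u) x) = rot w (2 * (b - c)) x"
proof -
  obtain a where a: "x = norm x *\<^sub>R rot w a u" using plane_polar[OF assms] .
  have "flip (rot w b u) (flip (rot w c u) (rot w a u)) = rot w (2 * (b - c)) (rot w a u)"
    using assms by (simp add: flip_rot rot_rot algebra_simps)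
  then show ?thesis by (subst a, subst (2) a) (simp add: flip_scaleR rot_scaleR)
qed

text \<open>On polar angles both sides send \<open>c\<close> to \<open>- a - c\<close>: a turn
  followed by a reflection is a reflection whose axis is turned back by half the angle.\<close>

lemma flip_rot_half:
  assumes "norm w = 1" "norm u = 1" "u \<bullet> w = 0" "x \<bullet> w = 0"
  shows "flip u (rot w a x) = flip (rot w (- a / 2) u) x"
proof -
  obtain c where c: "x = norm x *\<^sub>R rot w c u" using plane_polar[OF assms] .
  have "flip u (rot w a (rot w c u)) = flip (rot w (- a / 2) u) (rot w c u)"
    using assms flip_rot[OF assms(1-3), of 0 "a + c"] by (simp add: flip_rot rot_rot algebra_simps)
  then show ?thesis by (subst c, subst (2) c) (simp add: flip_scaleR rot_scaleR)
qed

lemma flip_invol: "norm u = 1 \<Longrightarrow> flip u (flip u x) = x"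
  by (simp add: flip_def inner_diff_right norm_eq_1 algebra_simps)

section \<open>The group of rotations preserving a function on a great circle\<close>

lemma rot_invariances_add:
  assumes "norm w = 1" "a \<in> rot_invariances q w" "b \<in> rot_invariances q w"
  shows "a + b \<in> rot_invariances q w"
  unfolding rot_invariances_def
proof clarify
  fix x i assume x: "x \<bullet> w = 0"
  have "q (rot w (a + b) x) i = q (rot w a (rot w b x)) i" using x assms by (simp add: rot_rot)
  also have "\<dots> = q x i" using x assms rot_orthogonal by (simp add: rot_invariances_def)
  finally show "q (rot w (a + b) x) i = q x i" .
qed

lemma rot_invariances_minus:
  assumes "norm w = 1" "a \<in> rot_invariances q w"
  shows "- a \<in> rot_invariances q w"
  unfolding rot_invariances_def
proof clarify
  fix x i assume x: "x \<bullet> w = 0"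
  have "q (rot w a (rot w (- a) x)) i = q (rot w (- a) x) i"
    using x assms rot_orthogonal by (simp add: rot_invariances_def)
  then show "q (rot w (- a) x) i = q x i" using x assms by (simp add: rot_rot)
qed

lemma rot_invariances_of_nat:
  assumes "norm w = 1" "a \<in> rot_invariances q w"
  shows "of_nat n * a \<in> rot_invariances q w"
proof (induction n)
  case 0 then show ?case by (simp add: rot_invariances_def)
next
  case (Suc n) then show ?case
    using rot_invariances_add[OF assms(1) assms(2) Suc] by (simp add: algebra_simps)
qed

lemma rot_invariances_of_int:
  assumes "norm w = 1" "a \<in> rot_invariances q w"
  shows "of_int n * a \<in> rot_invariances q w"
proof (cases n)
  case (nonneg m) then show ?thesis using rot_invariances_of_nat[OF assms] by simp
next
  case (neg m) then show ?thesis
    using rot_invariances_minus[OF assms(1) rot_invariances_of_nat[OF assms, of "Suc m"]] 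
    by (metis of_int_minus of_int_of_nat_eq mult_minus_left)
qed

lemma rot_invariances_2pi: "2 * pi * of_int k \<in> rot_invariances q w"
  using rot_periodic[of w 0 k] by (simp add: rot_invariances_def)

lemma bounded_bilinear_cross: "bounded_bilinear cross3"
  using bilinear_cross by (simp add: bilinear_conv_bounded_bilinear)

lemmas tendsto_cross [tendsto_intros] = bounded_bilinear.tendsto[OF bounded_bilinear_cross]
lemmas continuous_on_cross3 [continuous_intros] = bounded_bilinear.continuous_on[OF bounded_bilinear_cross]

lemmas tendsto_trig_compose [tendsto_intros] =
  isCont_tendsto_compose[OF isCont_cos] isCont_tendsto_compose[OF isCont_sin]

lemma continuous_on_trig_compose [continuous_intros]:
  fixes a :: "'a::topological_space \<Rightarrow> real"
  assumes "continuous_on S a"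
  shows "continuous_on S (\<lambda>t. cos (a t))" "continuous_on S (\<lambda>t. sin (a t))"
  using assms unfolding continuous_on_def by (auto intro: tendsto_trig_compose)

lemma tendsto_rot [tendsto_intros]:
  assumes "(w \<longlongrightarrow> w0) F" "(a \<longlongrightarrow> a0) F" "(x \<longlongrightarrow> x0) F"
  shows "((\<lambda>t. rot (w t) (a t) (x t)) \<longlongrightarrow> rot w0 a0 x0) F"
  unfolding rot_def by (intro tendsto_intros assms)

lemma continuous_on_rot [continuous_intros]:
  assumes "continuous_on S w" "continuous_on S a" "continuous_on S x"
  shows "continuous_on S (\<lambda>t. rot (w t) (a t) (x t))"
  unfolding rot_def by (intro continuous_intros assms)

lemma continuous_on_flip [continuous_intros]:
  assumes "continuous_on S u" "continuous_on S x"
  shows "continuous_on S (\<lambda>t. flip (u t) (x t))"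
  unfolding flip_def by (intro continuous_intros assms)

text \<open>Written as \<open>cross3 w v\<close>, a point of the plane orthogonal to
  \<open>w\<close> can be carried continuously to the plane of a nearby axis by changing
  \<open>w\<close> and keeping \<open>v\<close>.\<close>

lemma cross_surj:
  assumes "norm w = 1" "x \<bullet> w = 0"
  obtains v where "x = cross3 w v"
  using that[of "- cross3 w x"] cross_cross_unit[OF assms] by simp

text \<open>Very small positive invariances have multiples near every prescribed angle. By
  compactness their axes accumulate, and at the limit axis every angle \<theta> \<ge> 0 would be an
  invariance, against \<open>nontriv\<close>.\<close>

lemma rot_invariances_lower_bound:
  fixes q :: "real^3 \<Rightarrow> 'i \<Rightarrow> real"
  assumes cont: "\<And>i. continuous_on UNIV (\<lambda>x. q x i)"
    and nontriv: "\<And>w. norm w = 1 \<Longrightarrow> \<exists>\<theta>\<ge>0. \<theta> \<notin> rot_invariances q w"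
  shows "\<exists>d>0. \<forall>w a. norm w = 1 \<longrightarrow> a \<in> rot_invariances q w \<longrightarrow> 0 < a \<longrightarrow> d \<le> a"
proof (rule ccontr)
  assume neg: "\<not> ?thesis"
  have "\<exists>w a. norm w = 1 \<and> a \<in> rot_invariances q w \<and> 0 < a \<and> a < inverse (real (Suc n))" for n
  proof -
    have "inverse (real (Suc n)) > 0" by simp
    then show ?thesis using neg by (meson not_le)
  qed
  then obtain W A where WA: "\<And>n. norm (W n) = 1" "\<And>n. A n \<in> rot_invariances q (W n)"
    "\<And>n. 0 < A n" "\<And>n. A n < inverse (real (Suc n))" by metis
  have "compact (sphere (0::real^3) 1)" by simp
  then obtain w r where w: "w \<in> sphere 0 1" "strict_mono r" "(W \<circ> r) \<longlonglongrightarrow> w"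
    unfolding compact_def using WA(1) by (metis mem_sphere_0)
  then have nw: "norm w = 1" by simp
  then obtain \<theta> where th: "\<theta> \<ge> 0" "\<theta> \<notin> rot_invariances q w" using nontriv by blast
  then obtain x i where xi: "x \<bullet> w = 0" "q (rot w \<theta> x) i \<noteq> q x i"
    by (auto simp: rot_invariances_def)
  obtain v where v: "x = cross3 w v" using cross_surj[OF nw xi(1)] .
  define K where "K n = nat \<lfloor>\<theta> / A n\<rfloor>" for n
  have K: "\<theta> - inverse (real (Suc n)) \<le> real (K n) * A n \<and> real (K n) * A n \<le> \<theta> + 0" for n
  proof -
    have K: "real (K n) = of_int \<lfloor>\<theta> / A n\<rfloor>"
      using th WA(3)[of n] by (simp add: K_def)
    then have "real (K n) \<le> \<theta> / A n" "\<theta> / A n < real (K n) + 1" by linarith+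
    then have "real (K n) * A n \<le> \<theta>" "\<theta> < real (K n) * A n + A n"
      using WA(3)[of n] by (simp_all add: field_simps)
    then show ?thesis using WA(4)[of n] by simp
  qed
  have lim: "(\<lambda>n. real (K n) * A n) \<longlonglongrightarrow> \<theta>"
  proof (rule tendsto_sandwich)
    show "(\<lambda>n. \<theta> - inverse (real (Suc n))) \<longlonglongrightarrow> \<theta>"
      using tendsto_diff[OF tendsto_const LIMSEQ_inverse_real_of_nat] by simp
    show "(\<lambda>n. \<theta> + 0) \<longlonglongrightarrow> \<theta>" by simp
  qed (use K in auto)
  have lim': "(\<lambda>n. real (K (r n)) * A (r n)) \<longlonglongrightarrow> \<theta>"
    using LIMSEQ_subseq_LIMSEQ[OF lim w(2)] by (simp add: o_def)
  have wl: "(\<lambda>n. W (r n)) \<longlonglongrightarrow> w" using w(3) by (simp add: o_def)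
  have iso: "isCont (\<lambda>x. q x i) y" for y
    using cont by (simp add: continuous_on_eq_continuous_at)
  have 1: "(\<lambda>n. q (rot (W (r n)) (real (K (r n)) * A (r n)) (cross3 (W (r n)) v)) i)
       \<longlonglongrightarrow> q (rot w \<theta> (cross3 w v)) i"
    by (rule isCont_tendsto_compose[OF iso]) (intro tendsto_intros wl lim')
  have 2: "(\<lambda>n. q (cross3 (W (r n)) v) i) \<longlonglongrightarrow> q (cross3 w v) i"
    by (rule isCont_tendsto_compose[OF iso]) (intro tendsto_intros wl)
  have "q (rot (W n) (real (K n) * A n) (cross3 (W n) v)) i = q (cross3 (W n) v) i" for n
    using rot_invariances_of_nat[OF WA(1,2), of "K n"] by (simp add: rot_invariances_def)
  then have "q (rot w \<theta> (cross3 w v)) i = q (cross3 w v) i"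
    using LIMSEQ_unique[OF 1] 2 by simp
  then show False using xi v by simp
qed

text \<open>By Dirichlet approximation some multiple of \<open>a\<close>, with factor at most
  \<open>N\<close>, is closer than \<open>d\<close> to a multiple of 2 pi; the difference is an
  invariance, hence 0. One \<open>M\<close> for all axes makes \<open>M\<close> times an angle
  single-valued.\<close>

lemma rot_invariances_torsion:
  fixes q :: "real^3 \<Rightarrow> 'i \<Rightarrow> real"
  assumes cont: "\<And>i. continuous_on UNIV (\<lambda>x. q x i)"
    and nontriv: "\<And>w. norm w = 1 \<Longrightarrow> \<exists>\<theta>\<ge>0. \<theta> \<notin> rot_invariances q w"
  obtains M :: nat where "M > 0"
    "\<And>w a. norm w = 1 \<Longrightarrow> a \<in> rot_invariances q w \<Longrightarrow> \<exists>k::int. of_nat M * a = 2 * pi * of_int k"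
proof -
  obtain d where d: "d > 0" "\<And>w a. norm w = 1 \<Longrightarrow> a \<in> rot_invariances q w \<Longrightarrow> 0 < a \<Longrightarrow> d \<le> a"
    using rot_invariances_lower_bound[OF assms] by auto
  obtain N :: nat where N: "2 * pi / d < real N" using reals_Archimedean2 by blast
  have "0 < 2 * pi / d" using d by simp
  then have "0 < real N" using N by linarith
  then have N0: "N > 0" by simp
  show ?thesis
  \<comment> \<open>The factorial is a common multiple of all factors \<open>k\<close> up to
    \<open>N\<close>.\<close>
  proof (rule that[of "fact N"])
    fix w :: "real^3" and a assume w: "norm w = 1" and a: "a \<in> rot_invariances q w"
    obtain h k where hk: "0 < k" "k \<le> int N" "\<bar>of_int k * (a / (2 * pi)) - of_int h\<bar> < 1 / N"
      using Dirichlet_approx[OF N0] by metis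
    define b where "b = of_int k * a - 2 * pi * of_int h"
    have b: "b \<in> rot_invariances q w"
      using rot_invariances_add[OF w rot_invariances_of_int[OF w a, of k] rot_invariances_2pi[of "- h"]]
      by (simp add: b_def)
    have "\<bar>b\<bar> = 2 * pi * \<bar>of_int k * (a / (2 * pi)) - of_int h\<bar>"
    proof -
      have "b = 2 * pi * (of_int k * (a / (2 * pi)) - of_int h)" by (simp add: b_def field_simps)
      then show ?thesis by (simp only: abs_mult) simp
    qed
    also have "\<dots> < 2 * pi * (1 / N)" using hk(3) by (intro mult_strict_left_mono) auto
    also have "\<dots> < d" using N d N0 by (simp add: field_simps)
    finally have "\<bar>b\<bar> < d" .
    then have "b = 0"
      using d(2)[OF w b] d(2)[OF w rot_invariances_minus[OF w b]] by argo
    then have ka: "of_int k * a = 2 * pi * of_int h" by (simp add: b_def)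
    have "nat k dvd fact N" using hk by (intro dvd_fact) auto
    then obtain m where m: "fact N = nat k * m" by blast
    have "real (fact N) * a = real m * (of_int k * a)"
      using hk(1) arg_cong[OF m, of real] by simp
    also have "\<dots> = 2 * pi * of_int (int m * h)" by (simp add: ka)
    finally show "\<exists>k::int. real (fact N) * a = 2 * pi * of_int k" by blast
  qed simp
qed

section \<open>Invariance under one angle for an open set of axes\<close>

text \<open>Moving \<open>x\<close> by \<open>rot w \<alpha>\<close> and back by \<open>rot w' (- \<alpha>)\<close> for varying axes sweeps out a bow tie at
  \<open>x\<close>; a point \<open>z\<close> in its interior is linked in the same way to all points near \<open>x\<close>.\<close>

lemma locally_constant_of_rot_invariance:
  fixes q :: "real^3 \<Rightarrow> real"
  assumes V: "open V" and sin: "sin \<alpha> \<noteq> 0"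
    and inv: "\<And>w x. norm w = 1 \<Longrightarrow> w \<in> V \<Longrightarrow> x \<bullet> w = 0 \<Longrightarrow> q (rot w \<alpha> x) = q x"
    and w: "norm w = 1" "w \<in> V" and x: "norm x = 1" "x \<bullet> w = 0"
  shows "\<forall>\<^sub>F p in nhds x. norm p = 1 \<longrightarrow> q p = q x"
proof -
  \<comment> \<open>If \<open>p\<close> and \<open>y\<close> have inner product
    \<open>cos \<alpha>\<close>, their normalised cross product is the axis of the rotation by
    \<alpha> that takes \<open>p\<close> to \<open>y\<close>.\<close>
  have link: "q y = q p"
    if "norm p = 1" "norm y = 1" "p \<bullet> y = cos \<alpha>" "(1 / sin \<alpha>) *\<^sub>R cross3 p y \<in> V" for p y
  proof -
    let ?w = "(1 / sin \<alpha>) *\<^sub>R cross3 p y"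
    have "(norm (cross3 p y))\<^sup>2 = (sin \<alpha>)\<^sup>2"
      using norm_cross_dot[of p y] that by (simp add: sin_squared_eq)
    then have "norm (cross3 p y) = \<bar>sin \<alpha>\<bar>" by (metis real_sqrt_abs norm_ge_zero abs_of_nonneg)
    then have 1: "norm ?w = 1" using sin by simp
    have 2: "p \<bullet> ?w = 0" by (simp add: dot_cross_self)
    have "cross3 ?w p = (1 / sin \<alpha>) *\<^sub>R (y - cos \<alpha> *\<^sub>R p)"
      using that by (simp add: cross_mult_left cross_skew[of "cross3 p y" p] Lagrange norm_eq_1)
    then have "rot ?w \<alpha> p = y" using sin by (simp add: rot_def)
    then show ?thesis using inv[OF 1 _ 2] that by simp
  qed
  define v where "v = cross3 w x"
  have v: "norm v = 1" "v \<bullet> x = 0" "v \<bullet> w = 0" "x \<bullet> v = 0" "w \<bullet> v = 0"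
    using norm_cross_unit w x by (auto simp: v_def)
  have xv: "cross3 x v = w" "cross3 w v = - x" "cross3 w x = v"
    using w x by (simp_all add: v_def Lagrange norm_eq_1 inner_commute)
  define z where "z t = cos t *\<^sub>R x + sin t *\<^sub>R w" for t
  \<comment> \<open>\<open>Y z p\<close> is a unit vector with inner product
    \<open>cos \<alpha>\<close> with both \<open>z\<close> and \<open>p\<close>: its part in their
    span is forced, the rest goes along \<open>cross3 z p\<close>. The factor
    \<open>sgn (sin \<alpha>)\<close> picks the solution whose axes stay near \<open>w\<close> and
    not near \<open>- w\<close>.\<close>
  define Y where "Y z p = (cos \<alpha> / (1 + p \<bullet> z)) *\<^sub>R (p + z)
     + (sgn (sin \<alpha>) * sqrt (1 - 2 * (cos \<alpha>)\<^sup>2 / (1 + p \<bullet> z)) / norm (cross3 z p)) *\<^sub>R cross3 z p" for z p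
  have Y: "norm (Y z p) = 1" "p \<bullet> Y z p = cos \<alpha>" "z \<bullet> Y z p = cos \<alpha>"
    if "norm z = 1" "norm p = 1" "1 + p \<bullet> z > 0" "1 - 2 * (cos \<alpha>)\<^sup>2 / (1 + p \<bullet> z) > 0" "cross3 z p \<noteq> 0" for z p
  proof -
    have n: "p \<bullet> p = 1" "z \<bullet> z = 1" "z \<bullet> p = p \<bullet> z" "1 + p \<bullet> z \<noteq> 0" using that by (auto simp: norm_eq_1 inner_commute)
    have c: "p \<bullet> cross3 z p = 0" "z \<bullet> cross3 z p = 0" "cross3 z p \<bullet> p = 0" "cross3 z p \<bullet> z = 0"
      by (simp_all add: dot_cross_self)
    show "p \<bullet> Y z p = cos \<alpha>" "z \<bullet> Y z p = cos \<alpha>" 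
      using n by (simp_all add: Y_def inner_add_right c) (simp_all add: add.commute)
    let ?s = "sgn (sin \<alpha>) * sqrt (1 - 2 * (cos \<alpha>)\<^sup>2 / (1 + p \<bullet> z)) / norm (cross3 z p)"
    have "?s\<^sup>2 * (cross3 z p \<bullet> cross3 z p) = (sgn (sin \<alpha>))\<^sup>2 * (1 - 2 * (cos \<alpha>)\<^sup>2 / (1 + p \<bullet> z))"
      using that by (simp add: power_mult_distrib power_divide power2_norm_eq_inner)
    also have "\<dots> = 1 - 2 * (cos \<alpha>)\<^sup>2 / (1 + p \<bullet> z)" using sin by (simp add: sgn_if)
    finally have s: "?s\<^sup>2 * (cross3 z p \<bullet> cross3 z p) = 1 - 2 * (cos \<alpha>)\<^sup>2 / (1 + p \<bullet> z)" .
    have "(p + z) \<bullet> (p + z) = 2 * (1 + p \<bullet> z)" using n by (simp add: inner_add_left inner_add_right)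
    moreover have gen: "(c / D)\<^sup>2 * (2 * D) = 2 * c\<^sup>2 / D" if "D \<noteq> 0" for c D :: real
      using that by (simp add: power2_eq_square)
    ultimately have l: "(cos \<alpha> / (1 + p \<bullet> z))\<^sup>2 * ((p + z) \<bullet> (p + z)) = 2 * (cos \<alpha>)\<^sup>2 / (1 + p \<bullet> z)"
      using gen[OF n(4)] by simp
    have "Y z p \<bullet> Y z p = (cos \<alpha> / (1 + p \<bullet> z))\<^sup>2 * ((p + z) \<bullet> (p + z)) + ?s\<^sup>2 * (cross3 z p \<bullet> cross3 z p)"
    proof -
      have "(a *\<^sub>R (p + z) + b *\<^sub>R cross3 z p) \<bullet> (a *\<^sub>R (p + z) + b *\<^sub>R cross3 z p)
          = a\<^sup>2 * ((p + z) \<bullet> (p + z)) + b\<^sup>2 * (cross3 z p \<bullet> cross3 z p)" for a b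
        by (simp add: inner_add_left inner_add_right c power2_eq_square algebra_simps)
      then show ?thesis unfolding Y_def .
    qed
    also have "\<dots> = 1" unfolding s l by simp
    finally show "norm (Y z p) = 1" by (simp add: norm_eq_1)
  qed
  \<comment> \<open>\<open>Z t\<close> is \<open>Y (z t) x\<close> with the direction of the cross
    product replaced by its constant value \<open>v\<close>. Unlike \<open>Y\<close> it is
    meaningful at t = 0, where it equals \<open>rot w \<alpha> x\<close>.\<close>
  define Z where "Z t = (cos \<alpha> / (1 + cos t)) *\<^sub>R (x + z t) + (sgn (sin \<alpha>) * sqrt (1 - 2 * (cos \<alpha>)\<^sup>2 / (1 + cos t))) *\<^sub>R v" for t
  have Z0: "Z 0 = cos \<alpha> *\<^sub>R x + sin \<alpha> *\<^sub>R v"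
  proof -
    have "sgn (sin \<alpha>) * sqrt (1 - (cos \<alpha>)\<^sup>2) = sin \<alpha>"
      by (metis sin_squared_eq real_sqrt_abs sgn_mult_abs)
    moreover have "x + x = 2 *\<^sub>R x" by (simp add: scaleR_2)
    ultimately show ?thesis by (simp add: Z_def z_def)
  qed
  have zZ: "(z \<longlongrightarrow> x) (at_right 0)" 
  proof -
    have "isCont z 0" unfolding z_def by (intro continuous_intros)
    then show ?thesis by (simp add: isCont_def filterlim_at_split z_def)
  qed
  have ZZ: "(Z \<longlongrightarrow> cos \<alpha> *\<^sub>R x + sin \<alpha> *\<^sub>R v) (at_right 0)"
  proof -
    have "isCont Z 0" unfolding Z_def z_def by (intro continuous_intros) auto
    then show ?thesis using Z0 by (simp add: isCont_def filterlim_at_split)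
  qed
  have "((\<lambda>t. (1 / sin \<alpha>) *\<^sub>R cross3 x (Z t)) \<longlongrightarrow> (1 / sin \<alpha>) *\<^sub>R cross3 x (cos \<alpha> *\<^sub>R x + sin \<alpha> *\<^sub>R v)) (at_right 0)"
       "((\<lambda>t. (1 / sin \<alpha>) *\<^sub>R cross3 (z t) (Z t)) \<longlongrightarrow> (1 / sin \<alpha>) *\<^sub>R cross3 x (cos \<alpha> *\<^sub>R x + sin \<alpha> *\<^sub>R v)) (at_right 0)"
    by (intro tendsto_intros zZ ZZ)+
  moreover have "(1 / sin \<alpha>) *\<^sub>R cross3 x (cos \<alpha> *\<^sub>R x + sin \<alpha> *\<^sub>R v) = w"
    using sin by (simp add: cross_add_right cross_mult_right xv)
  ultimately have "((\<lambda>t. (1 / sin \<alpha>) *\<^sub>R cross3 x (Z t)) \<longlongrightarrow> w) (at_right 0)"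
       "((\<lambda>t. (1 / sin \<alpha>) *\<^sub>R cross3 (z t) (Z t)) \<longlongrightarrow> w) (at_right 0)" by simp_all
  then have e1: "\<forall>\<^sub>F t in at_right 0. (1 / sin \<alpha>) *\<^sub>R cross3 x (Z t) \<in> V"
     "\<forall>\<^sub>F t in at_right 0. (1 / sin \<alpha>) *\<^sub>R cross3 (z t) (Z t) \<in> V"
    using V w(2) by (auto intro: topological_tendstoD)
  have "isCont (\<lambda>t. 1 - 2 * (cos \<alpha>)\<^sup>2 / (1 + cos t)) 0" by (intro continuous_intros) auto
  then have "((\<lambda>t. 1 - 2 * (cos \<alpha>)\<^sup>2 / (1 + cos t)) \<longlongrightarrow> (sin \<alpha>)\<^sup>2) (at_right 0)"
    by (simp add: isCont_def filterlim_at_split sin_squared_eq)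
  then have e2: "\<forall>\<^sub>F t in at_right 0. 1 - 2 * (cos \<alpha>)\<^sup>2 / (1 + cos t) > 0"
    using sin by (intro order_tendstoD(1)) auto
  have e3: "\<forall>\<^sub>F t in at_right 0. t \<in> {0<..<pi}"
    by (rule eventually_at_right_real) simp
  have "\<forall>\<^sub>F t in at_right 0. (1 / sin \<alpha>) *\<^sub>R cross3 x (Z t) \<in> V \<and> (1 / sin \<alpha>) *\<^sub>R cross3 (z t) (Z t) \<in> V
      \<and> 1 - 2 * (cos \<alpha>)\<^sup>2 / (1 + cos t) > 0 \<and> t \<in> {0<..<pi}"
    using e1 e2 e3 by eventually_elim auto
  \<comment> \<open>A fixed positive \<open>t\<close> keeps \<open>z t\<close> apart from
    \<open>x\<close>, so that \<open>Y (z t)\<close> is continuous at \<open>x\<close>.\<close>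
  from eventually_happens'[OF _ this]
  obtain t where t: "(1 / sin \<alpha>) *\<^sub>R cross3 x (Z t) \<in> V" "(1 / sin \<alpha>) *\<^sub>R cross3 (z t) (Z t) \<in> V"
      "1 - 2 * (cos \<alpha>)\<^sup>2 / (1 + cos t) > 0" "0 < t" "t < pi"
    by auto
  have st: "sin t > 0" using t sin_gt_zero by blast
  have zt: "norm (z t) = 1" "x \<bullet> z t = cos t" "cross3 (z t) x = sin t *\<^sub>R v"
  proof -
    have n: "x \<bullet> x = 1" "w \<bullet> w = 1" "w \<bullet> x = 0" using w x by (simp_all add: norm_eq_1 inner_commute)
    have "z t \<bullet> z t = cos t * cos t + sin t * sin t"
      using n x by (simp add: z_def inner_add_left inner_add_right)
    then show "norm (z t) = 1" by (simp add: norm_eq_1 flip: power2_eq_square)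
    show "x \<bullet> z t = cos t" using n x by (simp add: z_def inner_add_right)
    show "cross3 (z t) x = sin t *\<^sub>R v" by (simp add: z_def cross_add_left cross_mult_left xv)
  qed
  have nv: "norm (sin t *\<^sub>R v) > 0" using st v by simp
  have Yx: "Y (z t) x = Z t"
  proof -
    have "norm (sin t *\<^sub>R v) = sin t" using st v(1) by simp
    moreover have "(a / sin t) *\<^sub>R (sin t *\<^sub>R v) = a *\<^sub>R v" for a using st by simp
    ultimately show ?thesis by (simp only: Y_def Z_def zt)
  qed
  have pos: "1 + cos t > 0" using cos_monotone_0_pi[of t pi] t(4,5) by simp
  have cY: "isCont (Y (z t)) x"
  proof -
    have "1 + x \<bullet> z t \<noteq> 0" "norm (cross3 (z t) x) \<noteq> 0" using pos nv by (simp_all only: zt)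
    then have "((\<lambda>p. Y (z t) p) \<longlongrightarrow> Y (z t) x) (at x)"
      unfolding Y_def by (intro tendsto_intros)
    then show ?thesis by (simp add: isCont_def)
  qed
  have tY: "(Y (z t) \<longlongrightarrow> Z t) (nhds x)"
    using cY Yx by (simp add: isCont_def tendsto_nhds_iff)
  have c1: "((\<lambda>p. (1 / sin \<alpha>) *\<^sub>R cross3 p (Y (z t) p)) \<longlongrightarrow> (1 / sin \<alpha>) *\<^sub>R cross3 x (Z t)) (nhds x)"
    and c2: "((\<lambda>p. (1 / sin \<alpha>) *\<^sub>R cross3 (z t) (Y (z t) p)) \<longlongrightarrow> (1 / sin \<alpha>) *\<^sub>R cross3 (z t) (Z t)) (nhds x)"
    by (intro tendsto_intros tY filterlim_ident)+
  have c3: "((\<lambda>p. 1 + p \<bullet> z t) \<longlongrightarrow> 1 + x \<bullet> z t) (nhds x)"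
    by (intro tendsto_intros filterlim_ident)
  have c4: "((\<lambda>p. 1 - 2 * (cos \<alpha>)\<^sup>2 / (1 + p \<bullet> z t)) \<longlongrightarrow> 1 - 2 * (cos \<alpha>)\<^sup>2 / (1 + x \<bullet> z t)) (nhds x)"
    using pos zt by (intro tendsto_intros filterlim_ident) auto
  have c5: "((\<lambda>p. norm (cross3 (z t) p)) \<longlongrightarrow> norm (cross3 (z t) x)) (nhds x)"
    by (intro tendsto_intros filterlim_ident)
  have "\<forall>\<^sub>F p in nhds x. norm p = 1 \<longrightarrow> q p = q (z t)"
    using topological_tendstoD[OF c1 V t(1)] topological_tendstoD[OF c2 V t(2)]
      order_tendstoD(1)[OF c3, of 0, unfolded zt, OF pos] order_tendstoD(1)[OF c4, of 0, unfolded zt, OF t(3)]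
      order_tendstoD(1)[OF c5, of 0, unfolded zt, OF nv]
  proof eventually_elim
    case (elim p)
    then have nz: "cross3 (z t) p \<noteq> 0" by auto
    show ?case
    proof
      assume p: "norm p = 1"
      note Yp = Y[OF zt(1) p elim(3,4) nz]
      show "q p = q (z t)"
        using link[OF p Yp(1,2) elim(1)] link[OF zt(1) Yp(1,3) elim(2)] by simp
    qed
  qed
  moreover from this have "q x = q (z t)" using eventually_nhds_x_imp_x x(1) by blast
  ultimately show ?thesis by simp
qed

text \<open>The circle through \<open>x\<close> about \<open>w\<close> is connected and all its
  points are orthogonal to \<open>w\<close>, so local constancy on the sphere at each of them
  spreads along the circle.\<close>

lemma rot_invariant_on_open_axes:
  fixes q :: "real^3 \<Rightarrow> real"
  assumes V: "open V" and sin: "sin \<alpha> \<noteq> 0"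
    and inv: "\<And>w x. norm w = 1 \<Longrightarrow> w \<in> V \<Longrightarrow> x \<bullet> w = 0 \<Longrightarrow> q (rot w \<alpha> x) = q x"
    and w: "norm w = 1" "w \<in> V" and x: "norm x = 1" "x \<bullet> w = 0"
  shows "q (rot w \<theta> x) = q x"
proof -
  have "q (rot w \<theta> x) = q (rot w 0 x)"
  proof (rule connected_local_const[where A = UNIV and f = "\<lambda>\<theta>. q (rot w \<theta> x)"])
    show "\<forall>a\<in>UNIV. \<forall>\<^sub>F b in at a. q (rot w a x) = q (rot w b x)"
    proof
      fix a
      have n: "norm (rot w b x) = 1" "rot w b x \<bullet> w = 0" for b
        using norm_rot rot_orthogonal w x by simp_all
      have lim: "((\<lambda>b. rot w b x) \<longlongrightarrow> rot w a x) (at a)" by (intro tendsto_intros)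
      have "\<forall>\<^sub>F b in at a. norm (rot w b x) = 1 \<longrightarrow> q (rot w b x) = q (rot w a x)"
        by (rule eventually_compose_filterlim[OF locally_constant_of_rot_invariance[OF V sin inv w n] lim])
      then show "\<forall>\<^sub>F b in at a. q (rot w a x) = q (rot w b x)"
        by (rule eventually_mono) (use n in auto)
    qed
  qed auto
  then show ?thesis by simp
qed

section \<open>The Funk transform on the two-sphere\<close>

lemma integral_cos_power_rec:
  "(real n + 2) * integral {0..2*pi} (\<lambda>x. cos x ^ (n + 2)) = (real n + 1) * integral {0..2*pi} (\<lambda>x. cos x ^ n)"
proof -
  \<comment> \<open>The integrand is the derivative of \<open>cos x ^ (n + 1) * sin x\<close>, which
    vanishes at both ends.\<close>
  have "((\<lambda>x. (real n + 2) * cos x ^ (n + 2) - (real n + 1) * cos x ^ n) has_integral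
     (cos (2*pi) ^ (n + 1) * sin (2*pi) - cos 0 ^ (n + 1) * sin 0)) {0..2*pi}"
  proof (rule fundamental_theorem_of_calculus)
    fix x :: real
    have *: "cos x ^ Suc n * cos x - real (Suc n) * cos x ^ n * sin x * sin x
        = (real n + 2) * cos x ^ (n + 2) - (real n + 1) * cos x ^ n"
    proof -
      have "sin x * sin x = 1 - cos x * cos x" by (metis sin_squared_eq power2_eq_square)
      then have "real (Suc n) * cos x ^ n * sin x * sin x = real (Suc n) * cos x ^ n * (1 - cos x * cos x)"
        by (simp only: mult.assoc)
      then show ?thesis by (simp add: algebra_simps)
    qed
    have "((\<lambda>x. cos x ^ Suc n * sin x) has_real_derivative
       (cos x ^ Suc n * cos x - real (Suc n) * cos x ^ n * sin x * sin x)) (at x)"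
      by (rule DERIV_cong[OF DERIV_mult[OF DERIV_power[OF DERIV_cos] DERIV_sin]]) (simp add: algebra_simps)
    then show "((\<lambda>x. cos x ^ (n + 1) * sin x) has_vector_derivative (real n + 2) * cos x ^ (n + 2) - (real n + 1) * cos x ^ n) (at x within {0..2*pi})"
      unfolding * by (simp add: has_real_derivative_iff_has_vector_derivative has_vector_derivative_at_within)
  qed simp
  then have "integral {0..2*pi} (\<lambda>x. (real n + 2) * cos x ^ (n + 2) - (real n + 1) * cos x ^ n) = 0"
    by (simp add: integral_unique)
  moreover have "integral {0..2*pi} (\<lambda>x. (real n + 2) * cos x ^ (n + 2) - (real n + 1) * cos x ^ n)
     = integral {0..2*pi} (\<lambda>x. (real n + 2) * cos x ^ (n + 2)) - integral {0..2*pi} (\<lambda>x. (real n + 1) * cos x ^ n)"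
    by (intro integral_diff integrable_continuous_real continuous_intros)
  ultimately show ?thesis by simp
qed

lemma integral_sin_power_rec:
  "(real n + 2) * integral {0..pi} (\<lambda>x. sin x ^ (n + 2)) = (real n + 1) * integral {0..pi} (\<lambda>x. sin x ^ n)"
proof -
  have "((\<lambda>x. (real n + 2) * sin x ^ (n + 2) - (real n + 1) * sin x ^ n) has_integral
     (- (sin pi ^ (n + 1) * cos pi) - (- (sin 0 ^ (n + 1) * cos 0)))) {0..pi}"
  proof (rule fundamental_theorem_of_calculus)
    fix x :: real
    have *: "sin x ^ Suc n * sin x - real (Suc n) * sin x ^ n * cos x * cos x
        = (real n + 2) * sin x ^ (n + 2) - (real n + 1) * sin x ^ n"
    proof -
      have "cos x * cos x = 1 - sin x * sin x" by (metis cos_squared_eq power2_eq_square)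
      then have "real (Suc n) * sin x ^ n * cos x * cos x = real (Suc n) * sin x ^ n * (1 - sin x * sin x)"
        by (simp only: mult.assoc)
      then show ?thesis by (simp add: algebra_simps)
    qed
    have "((\<lambda>x. - (sin x ^ Suc n * cos x)) has_real_derivative
       (sin x ^ Suc n * sin x - real (Suc n) * sin x ^ n * cos x * cos x)) (at x)"
      by (rule DERIV_cong[OF DERIV_minus[OF DERIV_mult[OF DERIV_power[OF DERIV_sin] DERIV_cos]]]) (simp add: algebra_simps)
    then show "((\<lambda>x. - (sin x ^ (n + 1) * cos x)) has_vector_derivative (real n + 2) * sin x ^ (n + 2) - (real n + 1) * sin x ^ n) (at x within {0..pi})"
      unfolding * by (simp add: has_real_derivative_iff_has_vector_derivative has_vector_derivative_at_within)
  qed simp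
  then have "integral {0..pi} (\<lambda>x. (real n + 2) * sin x ^ (n + 2) - (real n + 1) * sin x ^ n) = 0"
    by (simp add: integral_unique)
  moreover have "integral {0..pi} (\<lambda>x. (real n + 2) * sin x ^ (n + 2) - (real n + 1) * sin x ^ n)
     = integral {0..pi} (\<lambda>x. (real n + 2) * sin x ^ (n + 2)) - integral {0..pi} (\<lambda>x. (real n + 1) * sin x ^ n)"
    by (intro integral_diff integrable_continuous_real continuous_intros)
  ultimately show ?thesis by simp
qed

lemma integral_cos_0_2pi: "integral {0..2*pi} (\<lambda>x. cos x) = 0"
proof -
  have "((\<lambda>x. cos x) has_integral sin (2*pi) - sin 0) {0..2*pi}"
    by (rule fundamental_theorem_of_calculus)
      (auto intro!: derivative_eq_intros simp flip: has_real_derivative_iff_has_vector_derivative)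
  then show ?thesis by (simp add: integral_unique)
qed

lemma integral_sin_0_pi: "integral {0..pi} (\<lambda>x. sin x) = 2"
proof -
  have "((\<lambda>x. sin x) has_integral - cos pi - - cos 0) {0..pi}"
    by (rule fundamental_theorem_of_calculus)
      (auto intro!: derivative_eq_intros simp flip: has_real_derivative_iff_has_vector_derivative)
  then show ?thesis by (simp add: integral_unique)
qed

text \<open>Up to the factor \<open>n + 1\<close> the left side is the n-th moment of a coordinate
  over the unit sphere. The recurrences contribute (n + 2) / (n + 3) and (n + 1) / (n + 2), so the
  product changes by (n + 1) / (n + 3) from \<open>n\<close> to \<open>n + 2\<close>, which the
  leading factor cancels.\<close>

lemma wallis_product:
  "(real n + 1) * (integral {0..pi} (\<lambda>x. sin x ^ (n + 1)) * integral {0..2*pi} (\<lambda>x. cos x ^ n))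
     = 2 * pi * (1 + (- 1) ^ n)"
proof (induction n rule: nat_induct2)
  case 0
  then show ?case by (simp add: integral_sin_0_pi)
next
  case 1
  then show ?case by (simp add: integral_cos_0_2pi)
next
  case (step n)
  define S S' C C' where "S = integral {0..pi} (\<lambda>x. sin x ^ (n + 1))"
    and "S' = integral {0..pi} (\<lambda>x. sin x ^ (n + 1 + 2))"
    and "C = integral {0..2*pi} (\<lambda>x. cos x ^ n)" and "C' = integral {0..2*pi} (\<lambda>x. cos x ^ (n + 2))"
  have "(real n + 3) * S' = (real n + 2) * S" "(real n + 2) * C' = (real n + 1) * C"
    using integral_sin_power_rec[of "n + 1"] integral_cos_power_rec[of n]
    by (simp_all add: S_def S'_def C_def C'_def add.commute)
  then have "(real n + 3) * (S' * C') = (real n + 1) * (S * C)"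
    by (metis (no_types, lifting) mult.assoc mult.commute mult.left_commute)
  then show ?case using step by (simp add: S_def S'_def C_def C'_def add.commute)
qed

text \<open>The surface integral over the unit sphere of \<open>h\<close> applied to one coordinate,
  in spherical coordinates whose polar axis is orthogonal to that coordinate;
  \<open>sin \<psi>\<close> is the area element.\<close>

definition slice_integral :: "(real \<Rightarrow> real) \<Rightarrow> real" where
  "slice_integral h = integral {0..pi} (\<lambda>\<psi>. sin \<psi> * integral {0..2*pi} (\<lambda>\<phi>. h (sin \<psi> * cos \<phi>)))"

lemma continuous_on_slice:
  fixes h :: "real \<Rightarrow> real"
  assumes "continuous_on UNIV h"
  shows "continuous_on S (\<lambda>\<psi>. integral {0..2*pi} (\<lambda>\<phi>. h (sin \<psi> * cos \<phi>)))"
proof -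
  have "continuous_on (S \<times> cbox 0 (2*pi)) (\<lambda>(\<psi>, \<phi>). h (sin \<psi> * cos \<phi>))"
    unfolding split_beta by (rule continuous_on_compose2[OF assms]) (auto intro!: continuous_intros)
  from integral_continuous_on_param[OF this] show ?thesis by simp
qed

lemma slice_integral_add:
  fixes h k :: "real \<Rightarrow> real"
  assumes "continuous_on UNIV h" "continuous_on UNIV k"
  shows "slice_integral (\<lambda>x. h x + k x) = slice_integral h + slice_integral k"
proof -
  have c: "continuous_on S (\<lambda>\<phi>. f (sin \<psi> * cos \<phi>))" if "continuous_on UNIV f" for f :: "real \<Rightarrow> real" and \<psi> and S :: "real set"
    by (rule continuous_on_compose2[OF that]) (auto intro!: continuous_intros)
  have "integral {0..2*pi} (\<lambda>\<phi>. h (sin \<psi> * cos \<phi>) + k (sin \<psi> * cos \<phi>))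
     = integral {0..2*pi} (\<lambda>\<phi>. h (sin \<psi> * cos \<phi>)) + integral {0..2*pi} (\<lambda>\<phi>. k (sin \<psi> * cos \<phi>))" for \<psi>
    by (intro integral_add integrable_continuous_real c assms)
  then show ?thesis unfolding slice_integral_def
    by (simp add: distrib_left)
      (intro integral_add integrable_continuous_real continuous_intros continuous_on_slice assms)
qed

lemma slice_integral_cmult: "slice_integral (\<lambda>x. c * h x) = c * slice_integral h"
  by (simp add: slice_integral_def mult.left_commute[of _ c])

lemma slice_integral_bound:
  assumes h: "continuous_on UNIV h" and le: "\<And>x. x \<in> {-1..1} \<Longrightarrow> \<bar>h x\<bar> \<le> e"
  shows "\<bar>slice_integral h\<bar> \<le> 2 * pi * pi * e"
proof -
  have c: "continuous_on S (\<lambda>\<phi>. h (sin \<psi> * cos \<phi>))" for \<psi> and S :: "real set"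
    by (rule continuous_on_compose2[OF h]) (auto intro!: continuous_intros)
  have e: "e \<ge> 0" using le[of 0] by simp
  have m: "\<bar>sin \<psi> * cos \<phi>\<bar> \<le> 1" for \<psi> \<phi> :: real
    by (simp add: abs_mult mult_le_one)
  have 1: "norm (integral {0..2*pi} (\<lambda>\<phi>. h (sin \<psi> * cos \<phi>))) \<le> e * (2 * pi - 0)" for \<psi>
  proof (rule integral_bound)
    show "norm (h (sin \<psi> * cos \<phi>)) \<le> e" for \<phi>
      using le[of "sin \<psi> * cos \<phi>"] m[of \<psi> \<phi>] by (simp add: abs_le_iff)
  qed (auto intro: c)
  have "norm (slice_integral h) \<le> (e * (2 * pi)) * (pi - 0)"
    unfolding slice_integral_def
  proof (rule integral_bound)
    show "norm (sin \<psi> * integral {0..2*pi} (\<lambda>\<phi>. h (sin \<psi> * cos \<phi>))) \<le> e * (2 * pi)" for \<psi>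
      using mult_mono[OF abs_sin_le_one[of \<psi>] 1[of \<psi>]] e by (simp add: abs_mult)
  qed (auto intro!: continuous_intros continuous_on_slice h)
  then show ?thesis by (simp add: mult_ac)
qed

lemma integral_power_symmetric: "(real n + 1) * integral {-1..1} (\<lambda>x::real. x ^ n) = 1 + (- 1) ^ n"
proof -
  have "((\<lambda>x::real. x ^ n) has_integral 1 ^ Suc n / real (Suc n) - (- 1) ^ Suc n / real (Suc n)) {-1..1}"
  proof (rule fundamental_theorem_of_calculus)
    fix x :: real
    have "((\<lambda>x. x ^ Suc n / real (Suc n)) has_real_derivative x ^ n) (at x within {-1..1})"
      by (rule derivative_eq_intros refl | simp)+
    then show "((\<lambda>x. x ^ Suc n / real (Suc n)) has_vector_derivative x ^ n) (at x within {-1..1})"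
      by (simp add: has_real_derivative_iff_has_vector_derivative)
  qed simp
  then have "integral {-1..1} (\<lambda>x::real. x ^ n) = 1 ^ Suc n / real (Suc n) - (- 1) ^ Suc n / real (Suc n)"
    by (rule integral_unique)
  then show ?thesis by (simp add: divide_simps mult.commute add.commute)
qed

lemma slice_integral_power: "slice_integral (\<lambda>x. x ^ n) = 2 * pi * integral {-1..1} (\<lambda>x. x ^ n)"
proof -
  have "slice_integral (\<lambda>x. x ^ n) = integral {0..pi} (\<lambda>x. sin x ^ (n + 1)) * integral {0..2*pi} (\<lambda>x. cos x ^ n)"
  proof -
    have "sin \<psi> * integral {0..2*pi} (\<lambda>\<phi>. (sin \<psi> * cos \<phi>) ^ n)
        = sin \<psi> ^ (n + 1) * integral {0..2*pi} (\<lambda>x. cos x ^ n)" for \<psi>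
      by (simp add: power_mult_distrib)
    then show ?thesis by (simp add: slice_integral_def del: power_Suc)
  qed
  then have "(real n + 1) * slice_integral (\<lambda>x. x ^ n) = (real n + 1) * (2 * pi * integral {-1..1} (\<lambda>x. x ^ n))"
    using wallis_product[of n] integral_power_symmetric[of n]
    by (metis (no_types, lifting) mult.left_commute)
  then show ?thesis by simp
qed

lemma slice_integral_polynomial:
  "slice_integral (\<lambda>x. \<Sum>i\<le>n. a i * x ^ i) = 2 * pi * integral {-1..1} (\<lambda>x. \<Sum>i\<le>n. a i * x ^ i)"
proof (induction n)
  case 0 then show ?case
    using slice_integral_cmult[of "a 0" "\<lambda>x. x ^ 0"] slice_integral_power[of 0] by simp
next
  case (Suc n)
  have c: "continuous_on S (\<lambda>x. \<Sum>i\<le>n. a i * x ^ i)" "continuous_on S (\<lambda>x. a (Suc n) * x ^ Suc n)" for S :: "real set"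
    by (auto intro!: continuous_intros)
  have "slice_integral (\<lambda>x. \<Sum>i\<le>Suc n. a i * x ^ i)
     = slice_integral (\<lambda>x. \<Sum>i\<le>n. a i * x ^ i) + a (Suc n) * slice_integral (\<lambda>x. x ^ Suc n)"
    using slice_integral_add[OF c[of UNIV]] by (simp add: slice_integral_cmult del: power_Suc)
  also have "\<dots> = 2 * pi * (integral {-1..1} (\<lambda>x. \<Sum>i\<le>n. a i * x ^ i) + integral {-1..1} (\<lambda>x. a (Suc n) * x ^ Suc n))"
    by (simp add: Suc slice_integral_power distrib_left del: power_Suc)
  also have "integral {-1..1} (\<lambda>x. \<Sum>i\<le>n. a i * x ^ i) + integral {-1..1} (\<lambda>x. a (Suc n) * x ^ Suc n)
     = integral {-1..1} (\<lambda>x. \<Sum>i\<le>Suc n. a i * x ^ i)"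
    by (subst integral_add[symmetric]) (auto intro!: integrable_continuous_real continuous_intros)
  finally show ?case .
qed

text \<open>Archimedes' hat-box theorem; by Weierstrass approximation it reduces to powers.\<close>

lemma slice_integral_eq:
  assumes h: "continuous_on UNIV h"
  shows "slice_integral h = 2 * pi * integral {-1..1} h"
proof (rule ccontr)
  assume ne: "slice_integral h \<noteq> 2 * pi * integral {-1..1} h"
  define D where "D = \<bar>slice_integral h - 2 * pi * integral {-1..1} h\<bar>"
  \<comment> \<open>An approximation error \<open>e\<close> costs at most 2 pi^2 \<open>e\<close> in
    the surface integral and 4 pi \<open>e\<close> in the interval term; the extra 1 makes the final
    inequality strict.\<close>
  define e where "e = D / (2 * pi * pi + 4 * pi + 1)"
  have D: "D > 0" using ne by (simp add: D_def)
  have P: "2 * pi * pi + 4 * pi + 1 > 0" using pi_gt_zero by (simp add: add_pos_pos)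
  have e: "e > 0" using D P by (simp add: e_def)
  obtain p where p: "real_polynomial_function p" "\<And>x. x \<in> {-1..1} \<Longrightarrow> \<bar>h x - p x\<bar> < e"
    using Stone_Weierstrass_real_polynomial_function[of "{-1..1}" h e] h e
    by (metis compact_Icc continuous_on_subset subset_UNIV)
  obtain a n where pa: "p = (\<lambda>x. \<Sum>i\<le>n. a i * x ^ i)"
    using p(1) real_polynomial_function_iff_sum by auto
  have cp: "continuous_on S p" for S unfolding pa by (auto intro!: continuous_intros)
  have ch: "continuous_on S h" for S using h continuous_on_subset by blast
  have le: "\<bar>h x - p x\<bar> \<le> e" if "x \<in> {-1..1}" for x using p(2)[OF that] by simp
  have "slice_integral h = slice_integral (\<lambda>x. (h x - p x) + p x)" by simp
  also have "\<dots> = slice_integral (\<lambda>x. h x - p x) + slice_integral p"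
    by (intro slice_integral_add continuous_intros ch cp)
  finally have 1: "slice_integral h = slice_integral (\<lambda>x. h x - p x) + 2 * pi * integral {-1..1} p"
    using slice_integral_polynomial[of a n] unfolding pa by simp
  have 2: "integral {-1..1} (\<lambda>x. h x - p x) = integral {-1..1} h - integral {-1..1} p"
    by (intro integral_diff integrable_continuous_real ch cp)
  have 3: "\<bar>slice_integral (\<lambda>x. h x - p x)\<bar> \<le> 2 * pi * pi * e"
    by (intro slice_integral_bound continuous_intros ch cp le)
  have 4: "norm (integral {-1..1} (\<lambda>x. h x - p x)) \<le> e * (1 - - 1)"
    by (rule integral_bound) (use le in \<open>auto intro!: continuous_intros ch cp\<close>)
  have "D = \<bar>slice_integral (\<lambda>x. h x - p x) - 2 * pi * integral {-1..1} (\<lambda>x. h x - p x)\<bar>"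
    unfolding D_def 1 2 by (simp add: algebra_simps)
  also have "\<dots> \<le> 2 * pi * pi * e + 2 * pi * \<bar>integral {-1..1} (\<lambda>x. h x - p x)\<bar>"
    using 3 abs_triangle_ineq4[of "slice_integral (\<lambda>x. h x - p x)" "2 * pi * integral {-1..1} (\<lambda>x. h x - p x)"]
    by (simp only: abs_mult) simp
  also have "\<dots> \<le> 2 * pi * pi * e + 2 * pi * (e * 2)"
    using 4 by (intro add_left_mono mult_left_mono) auto
  also have "\<dots> < (2 * pi * pi + 4 * pi + 1) * e" using e by (simp add: algebra_simps)
  also have "\<dots> = D" using P by (simp add: e_def)
  finally show False by simp
qed

lemma integral_periodic_shift:
  fixes f :: "real \<Rightarrow> real"
  assumes f: "continuous_on UNIV f" and per: "\<And>x. f (x + 2 * pi) = f x" and c: "0 \<le> c" "c \<le> 2 * pi"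
  shows "integral {0..2*pi} (\<lambda>x. f (x + c)) = integral {0..2*pi} f"
proof -
  have i: "f integrable_on {a..b}" for a b
    by (rule integrable_continuous_real) (use f continuous_on_subset in blast)
  have sh: "integral {a..b} (\<lambda>x. f (x + d)) = integral {a + d..b + d} f" for a b d
    using integral_shift[of a d b f] f continuous_on_subset by (fastforce simp: o_def)
  have "integral {0..2*pi} (\<lambda>x. f (x + c)) = integral {c..2*pi + c} f" using sh[of 0 "2*pi" c] by simp
  also have "\<dots> = integral {c..2*pi} f + integral {2*pi..2*pi + c} f"
    using Henstock_Kurzweil_Integration.integral_combine[where a = c and c = "2*pi" and b = "2*pi + c" and f = f] c i by simp
  also have "integral {2*pi..2*pi + c} f = integral {0..c} f"
    using sh[of 0 c "2*pi"] per by (simp add: add.commute)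
  also have "integral {c..2*pi} f + integral {0..c} f = integral {0..2*pi} f"
    using Henstock_Kurzweil_Integration.integral_combine[where a = 0 and c = c and b = "2*pi" and f = f] c i by simp
  finally show ?thesis .
qed

text \<open>After the substitution t = R u the hypothesis says that \<open>h\<close> has integral 0
  over [-R, R]; differentiating in \<open>R\<close> at 1 gives the claim.\<close>

lemma odd_of_symmetric_integrals:
  fixes h :: "real \<Rightarrow> real"
  assumes h: "continuous_on UNIV h" and z: "\<And>R. 0 \<le> R \<Longrightarrow> R \<le> 1 \<Longrightarrow> integral {-1..1} (\<lambda>u. h (R * u)) = 0"
  shows "h 1 + h (- 1) = 0"
proof -
  have ch: "continuous_on S h" for S using h continuous_on_subset by blast
  \<comment> \<open>The larger interval makes the primitive differentiable from both sides at 1 and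
    at -1.\<close>
  obtain P where P: "\<And>x. x \<in> {-2..2} \<Longrightarrow> (P has_vector_derivative h x) (at x within {-2..2})"
    using antiderivative_continuous[OF ch] by metis
  have P': "(P has_real_derivative h x) (at x)" if "-2 < x" "x < 2" for x
    using P[of x] that by (simp only: at_within_Icc_at has_real_derivative_iff_has_vector_derivative) simp
  have zero: "P R - P (- R) = 0" if R: "0 \<le> R" "R \<le> 1" for R
  proof (cases "R = 0")
    case False
    have "((\<lambda>u. h (R * u)) has_integral P (R * 1) / R - P (R * - 1) / R) {-1..1}"
    proof (rule fundamental_theorem_of_calculus)
      fix u :: real assume u: "u \<in> {-1..1}"
      have "\<bar>R * u\<bar> \<le> 1" unfolding abs_mult using u R by (intro mult_le_one) auto
      then have b: "-2 < R * u" "R * u < 2" by linarith+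
      have "((\<lambda>u. P (R * u)) has_real_derivative (h (R * u) * R)) (at u)"
        by (rule DERIV_chain2[where f = P and g = "\<lambda>u. R * u", OF P'[OF b]]) (auto intro!: derivative_eq_intros)
      then have "((\<lambda>u. P (R * u) / R) has_real_derivative (h (R * u) * R / R)) (at u)"
        by (rule DERIV_cdivide)
      then show "((\<lambda>u. P (R * u) / R) has_vector_derivative h (R * u)) (at u within {-1..1})"
        using False by (simp add: has_real_derivative_iff_has_vector_derivative has_vector_derivative_at_within)
    qed simp
    then have "P (R * 1) / R - P (R * - 1) / R = 0" using z[OF R] by (simp add: integral_unique)
    then show ?thesis using False by (simp add: divide_simps)
  qed simp
  have "((\<lambda>R. P R - P (- R)) has_real_derivative (h 1 - h (- 1) * - 1)) (at 1)"
    by (rule DERIV_diff[OF P' DERIV_chain2[where f = P and g = "\<lambda>R. - R", OF P']]) (auto intro!: derivative_eq_intros)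
  then have 1: "((\<lambda>R. P R - P (- R)) has_vector_derivative (h 1 + h (- 1))) (at 1 within {0..1})"
    by (simp add: has_real_derivative_iff_has_vector_derivative has_vector_derivative_at_within)
  \<comment> \<open>The difference is known to vanish only up to R = 1, so the derivatives are
    compared within [0, 1].\<close>
  have 2: "((\<lambda>R. P R - P (- R)) has_vector_derivative 0) (at 1 within {0..1})"
    by (rule has_vector_derivative_transform[of _ _ _ "\<lambda>_. 0"]) (use zero in auto)
  show ?thesis
    using vector_derivative_unique_within[OF _ 1 2] by (simp add: trivial_limit_within islimpt_Icc)
qed

text \<open>Averaging over the rotations about \<open>x\<close> reduces the injectivity of the Funk transform on even
  functions to functions of the height \<open>u\<close> along \<open>x\<close>.\<close>

theorem Funk_injective:
  fixes q :: "real^3 \<Rightarrow> real"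
  assumes q: "continuous_on UNIV q"
    and z: "\<And>w e. norm w = 1 \<Longrightarrow> norm e = 1 \<Longrightarrow> e \<bullet> w = 0 \<Longrightarrow> integral {0..2*pi} (\<lambda>\<phi>. q (rot w \<phi> e)) = 0"
    and x: "norm x = 1"
  shows "q x + q (- x) = 0"
proof -
  obtain a where a: "norm a = 1" "a \<bullet> x = 0" using exists_orthogonal_unit .
  define E where "E \<theta> = rot x \<theta> a" for \<theta>
  have E: "norm (E \<theta>) = 1" "E \<theta> \<bullet> x = 0" "x \<bullet> E \<theta> = 0" for \<theta>
    using norm_rot[OF x a(2)] rot_orthogonal[OF a(2)] a(1) by (simp_all add: E_def inner_commute)
  have Ecross: "norm (cross3 x (E \<theta>)) = 1" for \<theta> using norm_cross_unit[OF x E(2)] E(1) by simp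
  have xx: "x \<bullet> x = 1" "E \<theta> \<bullet> E \<theta> = 1" "cross3 x (E \<theta>) \<bullet> cross3 x (E \<theta>) = 1" for \<theta>
    using x E(1) Ecross by (simp_all add: norm_eq_1)
  have cq: "continuous_on S (\<lambda>t. q (k t))" if "continuous_on S k" for S :: "'s::topological_space set" and k
    by (rule continuous_on_compose2[OF q that]) auto
  \<comment> \<open>The integral of \<open>q\<close> in the longitude along the latitude circle at
    height \<open>u\<close>, with poles \<open>x\<close> and \<open>- x\<close>; at the poles it is
    2 pi times the value of \<open>q\<close>.\<close>
  define h where "h u = integral {0..2*pi} (\<lambda>\<theta>. q (u *\<^sub>R x + sqrt (1 - u\<^sup>2) *\<^sub>R E \<theta>))" for u
  have ch: "continuous_on UNIV h"
  proof -
    have "continuous_on (UNIV \<times> cbox 0 (2*pi)) (\<lambda>(u, \<theta>). q (u *\<^sub>R x + sqrt (1 - u\<^sup>2) *\<^sub>R E \<theta>))"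
      unfolding split_beta E_def by (intro cq continuous_intros)
    from integral_continuous_on_param[OF this] show ?thesis by (simp add: h_def[abs_def])
  qed
  \<comment> \<open>For fixed \<psi>, \<theta> this is a great circle in \<phi>; for fixed \<psi>,
    \<phi> it is the latitude circle at height \<open>sin \<psi> * cos \<phi>\<close> in \<theta>.
    Integrating \<open>q\<close> in both orders turns the hypothesis into a statement about
    \<open>h\<close>.\<close>
  define X where "X \<psi> \<theta> \<phi> = cos \<phi> *\<^sub>R (sin \<psi> *\<^sub>R x + cos \<psi> *\<^sub>R E \<theta>) + sin \<phi> *\<^sub>R cross3 x (E \<theta>)" for \<psi> \<theta> \<phi>
  have circle: "integral {0..2*pi} (\<lambda>\<phi>. q (X \<psi> \<theta> \<phi>)) = 0" for \<psi> \<theta>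
  proof -
    let ?e = "sin \<psi> *\<^sub>R x + cos \<psi> *\<^sub>R E \<theta>"
    let ?w = "cross3 ?e (cross3 x (E \<theta>))"
    have "?e \<bullet> ?e = sin \<psi> * sin \<psi> + cos \<psi> * cos \<psi>"
      by (simp add: inner_add_left inner_add_right xx E)
    then have ee: "?e \<bullet> ?e = 1" by (simp flip: power2_eq_square)
    then have e: "norm ?e = 1" by (simp add: norm_eq_1)
    have ec: "?e \<bullet> cross3 x (E \<theta>) = 0" "cross3 x (E \<theta>) \<bullet> ?e = 0"
      by (simp_all add: inner_add_left inner_add_right)
    have w: "norm ?w = 1" using norm_cross_unit[OF e ec(2)] Ecross by simp
    have "cross3 ?w ?e = cross3 x (E \<theta>)"
    proof -
      have "cross3 (cross3 e f) e = f" if "e \<bullet> e = 1" "e \<bullet> f = 0" for e f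
        using that by (simp add: cross_skew[of "cross3 e f" e] Lagrange)
      then show ?thesis using ee ec by blast
    qed
    then have "rot ?w \<phi> ?e = X \<psi> \<theta> \<phi>" for \<phi> by (simp add: rot_def X_def)
    then show ?thesis using z[OF w e] by (simp add: dot_cross_self)
  qed
  have lat: "integral {0..2*pi} (\<lambda>\<theta>. q (X \<psi> \<theta> \<phi>)) = h (sin \<psi> * cos \<phi>)" for \<psi> \<phi>
  proof -
    define u where "u = sin \<psi> * cos \<phi>"
    define c where "c = cos \<phi> * cos \<psi>"
    define r where "r = sqrt (1 - u\<^sup>2)"
    have cs: "c\<^sup>2 + (sin \<phi>)\<^sup>2 = 1 - u\<^sup>2"
    proof -
      have "c\<^sup>2 = (cos \<phi>)\<^sup>2 * (1 - (sin \<psi>)\<^sup>2)" unfolding c_def power_mult_distrib cos_squared_eq[of \<psi>] ..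
      moreover have "u\<^sup>2 = (sin \<psi>)\<^sup>2 * (cos \<phi>)\<^sup>2" unfolding u_def power_mult_distrib ..
      ultimately show ?thesis using sin_squared_eq[of \<phi>] by (simp only:) (simp add: right_diff_distrib mult.commute)
    qed
    have "u\<^sup>2 \<le> 1" using cs sum_power2_ge_zero[of c "sin \<phi>"] by linarith
    then have r: "r\<^sup>2 = c\<^sup>2 + (sin \<phi>)\<^sup>2" using cs by (simp add: r_def)
    \<comment> \<open>\<open>X \<psi> \<theta> \<phi>\<close> has longitude \<theta> + \<kappa> with
      \<kappa> independent of \<theta>, and a shift does not affect the integral over a full
      period.\<close>
    obtain \<kappa> where k: "0 \<le> \<kappa>" "\<kappa> \<le> 2 * pi" "c = r * cos \<kappa>" "sin \<phi> = r * sin \<kappa>"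
    proof (cases "r = 0")
      case True
      then have "c = 0" "sin \<phi> = 0" using r by (simp_all add: sum_power2_eq_zero_iff)
      then show ?thesis using that[of 0] True by simp
    next
      case False
      have "(c / r)\<^sup>2 + (sin \<phi> / r)\<^sup>2 = (c\<^sup>2 + (sin \<phi>)\<^sup>2) / r\<^sup>2"
        by (simp add: power_divide add_divide_distrib)
      also have "\<dots> = 1" using False by (simp flip: r)
      finally have "(c / r)\<^sup>2 + (sin \<phi> / r)\<^sup>2 = 1" .
      then obtain t where t: "0 \<le> t" "t < 2 * pi" "c / r = cos t" "sin \<phi> / r = sin t"
        using sincos_total_2pi by metis
      have "c = r * cos t" "sin \<phi> = r * sin t" unfolding t(3,4)[symmetric] using False by simp_all
      then show ?thesis using that[of t] t(1,2) by simp
    qed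
    have "X \<psi> \<theta> \<phi> = u *\<^sub>R x + r *\<^sub>R E (\<theta> + \<kappa>)" for \<theta>
    proof -
      have "E (\<theta> + \<kappa>) = rot x \<kappa> (E \<theta>)" using rot_rot[OF x a(2), of \<kappa> \<theta>] by (simp add: E_def add.commute)
      then have "r *\<^sub>R E (\<theta> + \<kappa>) = c *\<^sub>R E \<theta> + sin \<phi> *\<^sub>R cross3 x (E \<theta>)"
        by (simp add: rot_def k scaleR_add_right)
      then show ?thesis by (simp add: X_def u_def c_def scaleR_add_right mult.commute)
    qed
    then have "integral {0..2*pi} (\<lambda>\<theta>. q (X \<psi> \<theta> \<phi>)) = integral {0..2*pi} (\<lambda>\<theta>. q (u *\<^sub>R x + r *\<^sub>R E (\<theta> + \<kappa>)))"
      by simp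
    also have "\<dots> = integral {0..2*pi} (\<lambda>\<theta>. q (u *\<^sub>R x + r *\<^sub>R E \<theta>))"
    proof (rule integral_periodic_shift[where f = "\<lambda>\<theta>. q (u *\<^sub>R x + r *\<^sub>R E \<theta>)", OF _ _ k(1,2)])
      show "continuous_on UNIV (\<lambda>\<theta>. q (u *\<^sub>R x + r *\<^sub>R E \<theta>))"
        unfolding E_def by (intro cq continuous_intros)
      show "q (u *\<^sub>R x + r *\<^sub>R E (y + 2 * pi)) = q (u *\<^sub>R x + r *\<^sub>R E y)" for y
        using rot_periodic[of x y 1 a] by (simp add: E_def)
    qed
    finally show ?thesis by (simp add: h_def r_def u_def)
  qed
  have hz: "integral {0..2*pi} (\<lambda>\<phi>. h (sin \<psi> * cos \<phi>)) = 0" for \<psi>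
  proof -
    have "continuous_on (cbox (0, 0) (2*pi, 2*pi)) (\<lambda>(\<phi>, \<theta>). q (X \<psi> \<theta> \<phi>))"
      unfolding split_beta X_def E_def by (intro cq continuous_intros)
    from integral_swap_continuous[OF this]
    have "integral {0..2*pi} (\<lambda>\<phi>. integral {0..2*pi} (\<lambda>\<theta>. q (X \<psi> \<theta> \<phi>)))
       = integral {0..2*pi} (\<lambda>\<theta>. integral {0..2*pi} (\<lambda>\<phi>. q (X \<psi> \<theta> \<phi>)))" by simp
    then show ?thesis by (simp add: lat circle)
  qed
  have "h 1 + h (- 1) = 0"
  proof (rule odd_of_symmetric_integrals[OF ch])
    fix R :: real assume R: "0 \<le> R" "R \<le> 1"
    \<comment> \<open>\<open>hz\<close> covers every amplitude in [-1, 1], in particular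
      \<open>R * sin \<psi>\<close>, so the surface integral vanishes slice by slice. The hat-box
      theorem thus replaces the inversion of an Abel integral equation.\<close>
    have "slice_integral (\<lambda>u. h (R * u)) = 0"
    proof -
      have "integral {0..2*pi} (\<lambda>\<phi>. h (R * (sin \<psi> * cos \<phi>))) = 0" for \<psi>
      proof -
        have "\<bar>R * sin \<psi>\<bar> \<le> 1" unfolding abs_mult using R by (intro mult_le_one) auto
        then have "sin (arcsin (R * sin \<psi>)) = R * sin \<psi>" by (simp add: abs_le_iff)
        then show ?thesis using hz[of "arcsin (R * sin \<psi>)"] by (simp add: mult.assoc)
      qed
      then show ?thesis by (simp add: slice_integral_def)
    qed
    moreover have "continuous_on UNIV (\<lambda>u. h (R * u))"
      by (rule continuous_on_compose2[OF ch]) (auto intro!: continuous_intros)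
    ultimately show "integral {-1..1} (\<lambda>u. h (R * u)) = 0"
      using slice_integral_eq[of "\<lambda>u. h (R * u)"] by simp
  qed
  then have "2 * pi * (q x + q (- x)) = 0" by (simp add: h_def algebra_simps)
  then show ?thesis by simp
qed

section \<open>Functions related by reflections of great circles\<close>

text \<open>The values of \<open>k\<close> are integer multiples of 2 pi i, a discrete set. This is
  how changes of a continuous logarithm are compared below.\<close>

lemma exp_eq_1_constant:
  fixes k :: "'a::topological_space \<Rightarrow> complex"
  assumes "connected S" "continuous_on S k" "\<And>x. x \<in> S \<Longrightarrow> exp (k x) = 1" "x \<in> S" "y \<in> S"
  shows "k x = k y"
proof -
  have "k constant_on S"
  proof (rule continuous_discrete_range_constant[OF assms(1,2)])
    fix x assume x: "x \<in> S"
    have "2 * pi \<le> norm (k y - k x)" if y: "y \<in> S" "k y \<noteq> k x" for y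
    proof -
      have "exp (k y - k x) = 1" using assms(3) x y by (simp add: exp_diff)
      then obtain n :: int where n: "Re (k y - k x) = 0" "Im (k y - k x) = of_int (2 * n) * pi"
        by (auto simp: exp_eq_1)
      have "n \<noteq> 0" using n y(2) by (auto simp: complex_eq_iff)
      then have "1 \<le> \<bar>real_of_int n\<bar>" by linarith
      then have "2 * pi \<le> \<bar>Im (k y - k x)\<bar>" unfolding n(2) by (simp add: abs_mult)
      then show ?thesis using abs_Im_le_cmod[of "k y - k x"] by linarith
    qed
    then show "\<exists>e>0. \<forall>y. y \<in> S \<and> k y \<noteq> k x \<longrightarrow> e \<le> norm (k y - k x)"
      by (intro exI[of _ "2 * pi"]) auto
  qed
  then show ?thesis using assms(4,5) by (auto simp: constant_on_def)
qed

definition rot_related :: "(real^3 \<Rightarrow> 'i \<Rightarrow> real) \<Rightarrow> (real^3 \<Rightarrow> 'i \<Rightarrow> real) \<Rightarrow> real^3 \<Rightarrow> real \<Rightarrow> bool" where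
  "rot_related f g w a \<longleftrightarrow> (\<forall>x i. x \<bullet> w = 0 \<longrightarrow> f (rot w a x) i = g x i)"

text \<open>The coordinate \<open>s\<close> changes sign with the flip: a rotation of the
  three-dimensional hyperplane that reverses \<zeta> has determinant -1 on the plane orthogonal to
  \<zeta>, hence is a reflection in a line there.\<close>

definition flip_related :: "(real^3 \<Rightarrow> real \<Rightarrow> real) \<Rightarrow> (real^3 \<Rightarrow> real \<Rightarrow> real) \<Rightarrow> real^3 \<Rightarrow> real^3 \<Rightarrow> bool" where
  "flip_related f g w u \<longleftrightarrow> (\<forall>x s. x \<bullet> w = 0 \<longrightarrow> f (flip u x) (- s) = g x s)"

text \<open>With \<open>v\<close> ranging over the whole space the quantifier no longer depends on
  \<open>w\<close>, so the relation becomes an intersection of closed conditions on \<open>w\<close>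
  and \<open>u\<close>.\<close>

lemma flip_related_iff_cross:
  assumes "norm w = 1"
  shows "flip_related f g w u \<longleftrightarrow> (\<forall>v s. f (flip u (cross3 w v)) (- s) = g (cross3 w v) s)"
  unfolding flip_related_def using cross_surj[OF assms] cross_orthogonal(1) by metis

lemma rot_related_iff_cross:
  assumes "norm w = 1"
  shows "rot_related f g w a \<longleftrightarrow> (\<forall>v i. f (rot w a (cross3 w v)) i = g (cross3 w v) i)"
  unfolding rot_related_def using cross_surj[OF assms] cross_orthogonal(1) by metis

text \<open>Both flips carry \<open>f\<close> to the same \<open>g\<close>, so their composition,
  the rotation by twice the angle between the axes, preserves \<open>f\<close>.\<close>

lemma flip_related_invariance:
  assumes w: "norm w = 1" and u: "norm u = 1" "u \<bullet> w = 0"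
    and a: "flip_related f g w (rot w a u)" and b: "flip_related f g w (rot w b u)"
  shows "2 * (a - b) \<in> rot_invariances f w"
  unfolding rot_invariances_def
proof clarify
  fix x s assume x: "x \<bullet> w = 0"
  let ?y = "flip (rot w b u) x"
  have n: "norm (rot w b u) = 1" "rot w b u \<bullet> w = 0" using norm_rot rot_orthogonal w u by simp_all
  have y: "?y \<bullet> w = 0" using flip_orthogonal n x by blast
  have "f (rot w (2 * (a - b)) x) s = f (flip (rot w a u) ?y) (- (- s))"
    using flip_flip_rot[OF w u x] by simp
  also have "\<dots> = f (flip (rot w b u) ?y) (- (- s))"
    using a b y unfolding flip_related_def by metis
  also have "\<dots> = f x s" using flip_invol[OF n(1)] by simp
  finally show "f (rot w (2 * (a - b)) x) s = f x s" .
qed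

section \<open>Spherical coordinates and the winding of the flip axes\<close>

definition lat_axis :: "real \<times> real \<Rightarrow> real^3" where
  "lat_axis p = sin (fst p) *\<^sub>R rot (axis 3 1) (snd p) (axis 1 1) + cos (fst p) *\<^sub>R axis 3 1"

text \<open>The derivative of \<open>lat_axis\<close> in the colatitude \<open>fst p\<close>. At a
  pole it still turns with the longitude although the axis does not move; this is the source of the
  winding.\<close>

definition lat_tangent :: "real \<times> real \<Rightarrow> real^3" where
  "lat_tangent p = cos (fst p) *\<^sub>R rot (axis 3 1) (snd p) (axis 1 1) - sin (fst p) *\<^sub>R axis 3 1"

lemma axis_3_1: "norm (axis 3 1 :: real^3) = 1" "norm (axis 1 1 :: real^3) = 1" "(axis 1 1 :: real^3) \<bullet> axis 3 1 = 0"
  by (simp_all add: inner_axis_axis)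

lemma lat_frame: "norm (lat_axis p) = 1" "norm (lat_tangent p) = 1" "lat_tangent p \<bullet> lat_axis p = 0"
proof -
  let ?h = "rot (axis 3 1) (snd p) (axis 1 1) :: real^3"
  have h: "?h \<bullet> ?h = 1" "?h \<bullet> axis 3 1 = 0" "axis 3 1 \<bullet> ?h = 0" "(axis 3 1 :: real^3) \<bullet> axis 3 1 = 1"
    using norm_rot[OF axis_3_1(1,3)] rot_orthogonal[OF axis_3_1(3)] axis_3_1
    by (simp_all add: norm_eq_1 inner_commute)
  have "lat_axis p \<bullet> lat_axis p = 1" "lat_tangent p \<bullet> lat_tangent p = 1" "lat_tangent p \<bullet> lat_axis p = 0"
    by (simp_all add: lat_axis_def lat_tangent_def inner_add_left inner_add_right inner_diff_left inner_diff_right h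
        flip: power2_eq_square)
  then show "norm (lat_axis p) = 1" "norm (lat_tangent p) = 1" "lat_tangent p \<bullet> lat_axis p = 0"
    by (simp_all add: norm_eq_1)
qed

text \<open>A hairy ball argument: the flip axes, well defined up to an angle \<open>\<pi> / M\<close>, form a section of
  the \<open>2 M\<close>-th tensor power of the tangent bundle of the sphere. In spherical coordinates its
  angle would wind \<open>- 2 M\<close> times at one pole and \<open>2 M\<close> times at the other.\<close>

lemma not_all_flip_related:
  fixes f g :: "real^3 \<Rightarrow> real \<Rightarrow> real"
  assumes cf: "\<And>s. continuous_on UNIV (\<lambda>x. f x s)" and cg: "\<And>s. continuous_on UNIV (\<lambda>x. g x s)"
    and nontriv: "\<And>w. norm w = 1 \<Longrightarrow> \<exists>\<theta>\<ge>0. \<theta> \<notin> rot_invariances f w"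
    and rel: "\<And>w. norm w = 1 \<Longrightarrow> \<exists>u. norm u = 1 \<and> u \<bullet> w = 0 \<and> flip_related f g w u"
  shows False
proof -
  obtain M :: nat where M: "M > 0"
    "\<And>w a. norm w = 1 \<Longrightarrow> a \<in> rot_invariances f w \<Longrightarrow> \<exists>k::int. of_nat M * a = 2 * pi * of_int k"
    using rot_invariances_torsion[OF cf nontriv] by metis
  define R where "R p t \<longleftrightarrow> flip_related f g (lat_axis p) (rot (lat_axis p) t (lat_tangent p))" for p t
  \<comment> \<open>The factor \<open>2 * M\<close> absorbs the ambiguity: for two flip axes of the
    same point, \<open>2 * M * (t - t')\<close> is a multiple of 2 pi.\<close>
  define e where "e t = exp (\<i> * of_real (2 * M * t))" for t :: real
  have Rex: "\<exists>t. 0 \<le> t \<and> t \<le> 2 * pi \<and> R p t" for p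
  proof -
    obtain u where u: "norm u = 1" "u \<bullet> lat_axis p = 0" "flip_related f g (lat_axis p) u"
      using rel lat_frame by blast
    obtain t where "0 \<le> t" "t < 2 * pi" "u = rot (lat_axis p) t (lat_tangent p)"
      using rot_transitive[OF lat_frame(1,3)] u lat_frame(2) by metis
    then show ?thesis using u unfolding R_def by (intro exI[of _ t]) auto
  qed
  have e_eq: "e t = e t'" if "R p t" "R p t'" for p t t'
  proof -
    have "2 * (t - t') \<in> rot_invariances f (lat_axis p)"
      using flip_related_invariance[OF lat_frame] that unfolding R_def by blast
    then obtain k :: int where "of_nat M * (2 * (t - t')) = 2 * pi * of_int k"
      using M(2) lat_frame(1) by blast
    then have "2 * M * t = 2 * M * t' + 2 * pi * of_int k" by (simp add: algebra_simps)
    then have "\<i> * of_real (2 * M * t) = \<i> * of_real (2 * M * t') + of_real (of_int (2 * k) * pi) * \<i>"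
      by (simp only: of_real_add distrib_left) simp
    then show ?thesis unfolding e_def exp_eq by blast
  qed
  define c where "c p = e (SOME t. R p t)" for p
  have c: "c p = e t" if "R p t" for p t
    unfolding c_def using e_eq[OF someI[of "R p", OF that] that] .
  define K where "K = cbox (0, 0) (pi, 2 * pi :: real)"
  have K: "(a, b) \<in> K \<longleftrightarrow> 0 \<le> a \<and> a \<le> pi \<and> 0 \<le> b \<and> b \<le> 2 * pi" for a b
    by (auto simp: K_def cbox_Pair_eq)
  \<comment> \<open>The chosen \<open>t\<close> may jump, but \<open>c\<close> does not depend on
    the choice; its graph is a continuous image of a compact set of pairs \<open>(p, t)\<close>,
    hence closed.\<close>
  have c_cont: "continuous_on K c"
  proof (rule continuous_from_closed_graph)
    show "compact (sphere (0 :: complex) 1)" by simp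
    show "c \<in> K \<rightarrow> sphere 0 1" by (auto simp: c_def e_def)
    have iso: "continuous_on S (\<lambda>t. f (k t) s)" "continuous_on S (\<lambda>t. g (k t) s)"
      if "continuous_on S k" for S :: "((real \<times> real) \<times> real) set" and k s
      using continuous_on_compose2[OF cf that] continuous_on_compose2[OF cg that] by auto
    have lc: "continuous_on S (\<lambda>z. lat_axis (fst z))" "continuous_on S (\<lambda>z. lat_tangent (fst z))"
      for S :: "((real \<times> real) \<times> real) set"
      unfolding lat_axis_def lat_tangent_def by (intro continuous_intros)+
    have "closed {z. R (fst z) (snd z)}"
      unfolding R_def flip_related_iff_cross[OF lat_frame(1)]
      by (intro closed_Collect_all closed_Collect_eq iso continuous_intros lc)
    moreover have "compact (K \<times> {0..2 * pi})" by (simp add: K_def compact_Times)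
    ultimately have "compact ((K \<times> {0..2 * pi}) \<inter> {z. R (fst z) (snd z)})"
      by (rule compact_Int_closed[rotated])
    then have "compact ((\<lambda>z. (fst z, e (snd z))) ` ((K \<times> {0..2 * pi}) \<inter> {z. R (fst z) (snd z)}))"
      by (rule compact_continuous_image[rotated]) (auto simp: e_def intro!: continuous_intros)
    moreover have "(\<lambda>z. (fst z, e (snd z))) ` ((K \<times> {0..2 * pi}) \<inter> {z. R (fst z) (snd z)}) = (\<lambda>p. (p, c p)) ` K"
    proof (intro equalityI subsetI)
      fix y assume "y \<in> (\<lambda>p. (p, c p)) ` K"
      then obtain p where p: "p \<in> K" "y = (p, c p)" by auto
      obtain t where "0 \<le> t" "t \<le> 2 * pi" "R p t" using Rex by blast
      then show "y \<in> (\<lambda>z. (fst z, e (snd z))) ` ((K \<times> {0..2 * pi}) \<inter> {z. R (fst z) (snd z)})"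
        using p c by (intro image_eqI[of _ _ "(p, t)"]) auto
    qed (use c in auto)
    ultimately show "closed ((\<lambda>p. (p, c p)) ` K)" by (simp add: compact_imp_closed)
  qed
  have "contractible K" unfolding K_def by (intro convex_imp_contractible convex_box)
  moreover have "c p \<noteq> 0" for p by (simp add: c_def e_def)
  ultimately obtain L where L: "continuous_on K L" "\<And>p. p \<in> K \<Longrightarrow> c p = exp (L p)"
    using continuous_logarithm_on_contractible[OF c_cont] by metis
  have cL: "continuous_on S (\<lambda>t. L (k t))" if "continuous_on S k" "k ` S \<subseteq> K" for S :: "real set" and k
    using continuous_on_compose2[OF L(1) that] .
  \<comment> \<open>At a pole one flip axis serves all longitudes, and its angle in the turning
    frame is \<open>t + j * \<phi>\<close>; this determines the change of the logarithm over one
    full turn.\<close>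
  have pole: "L (a, 2 * pi) - L (a, 0) = \<i> * of_real (2 * M * (j * (2 * pi)))"
    if a: "0 \<le> a" "a \<le> pi" and t: "\<And>\<phi>. R (a, \<phi>) (t + j * \<phi>)" for a t j
  proof -
    let ?k = "\<lambda>\<phi>. L (a, \<phi>) - \<i> * of_real (2 * M * (t + j * \<phi>))"
    have "?k 0 = ?k (2 * pi)"
    proof (rule exp_eq_1_constant[where S = "{0..2 * pi}"])
      show "continuous_on {0..2 * pi} ?k"
        by (intro continuous_intros cL) (auto simp: K a)
      show "exp (?k \<phi>) = 1" if "\<phi> \<in> {0..2 * pi}" for \<phi>
        using L(2)[of "(a, \<phi>)"] c[OF t, of \<phi>] that a by (simp add: exp_diff K e_def)
    qed auto
    then show ?thesis by (simp add: algebra_simps)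
  qed
  \<comment> \<open>Longitudes 0 and 2 pi describe the same point and frame, so the change of
    \<open>L\<close> along a latitude is an integer multiple of 2 pi i and cannot vary with the
    colatitude.\<close>
  have "L (0, 2 * pi) - L (0, 0) = L (pi, 2 * pi) - L (pi, 0)"
  proof (rule exp_eq_1_constant[where S = "{0..pi}" and k = "\<lambda>a. L (a, 2 * pi) - L (a, 0)"])
    show "continuous_on {0..pi} (\<lambda>a. L (a, 2 * pi) - L (a, 0))"
      by (intro continuous_intros cL) (auto simp: K)
    fix a assume a: "a \<in> {0..pi}"
    have "lat_axis (a, 2 * pi) = lat_axis (a, 0)" "lat_tangent (a, 2 * pi) = lat_tangent (a, 0)"
      by (simp_all add: lat_axis_def lat_tangent_def rot_def)
    then have "c (a, 2 * pi) = c (a, 0)" by (simp add: c_def R_def)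
    then show "exp (L (a, 2 * pi) - L (a, 0)) = 1"
      using L(2)[of "(a, 2 * pi)"] L(2)[of "(a, 0)"] a by (simp add: exp_diff K)
  qed auto
  moreover have "L (0, 2 * pi) - L (0, 0) = \<i> * of_real (2 * M * (-1 * (2 * pi)))"
  proof -
    obtain t where t: "R (0, 0) t" using Rex by blast
    have "R (0, \<phi>) (t + -1 * \<phi>)" for \<phi>
      using t rot_rot[OF axis_3_1(1,3), of "t - \<phi>" \<phi>] by (simp add: R_def lat_axis_def lat_tangent_def)
    then show ?thesis by (intro pole[of 0 t]) auto
  qed
  moreover have "L (pi, 2 * pi) - L (pi, 0) = \<i> * of_real (2 * M * (1 * (2 * pi)))"
  proof -
    obtain t where t: "R (pi, 0) t" using Rex by blast
    \<comment> \<open>At the south pole the axis is reversed, so the frame turns in the opposite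
      sense about it.\<close>
    have south: "rot (- axis 3 1) a (- x) = - rot (axis 3 1) (- a) x" for a x by (simp add: rot_def)
    have "R (pi, \<phi>) (t + 1 * \<phi>)" for \<phi>
      using t rot_rot[OF axis_3_1(1,3), of "- t - \<phi>" \<phi>] by (simp add: R_def lat_axis_def lat_tangent_def south)
    then show ?thesis by (intro pole[of pi t]) auto
  qed
  ultimately show False using M(1) by (simp add: complex_eq_iff)
qed

section \<open>Functions related by rotations of great circles\<close>

lemma unit_multiple_orthogonal:
  fixes x w :: "real^3"
  assumes "norm w = 1" "x \<bullet> w = 0"
  obtains r y where "norm y = 1" "y \<bullet> w = 0" "x = r *\<^sub>R y"
proof (cases "x = 0")
  case True
  then show ?thesis using that exists_orthogonal_unit[of w] by (metis scaleR_zero_left)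
next
  case False
  then show ?thesis using that[of "x /\<^sub>R norm x" "norm x"] assms by simp
qed

lemma rot_minus: "rot w a (- x) = - rot w a x"
  by (simp add: rot_def)

text \<open>On every great circle \<open>g\<close> is a rotated copy of \<open>f\<close>, so \<Phi>
  composed with either has the same integral there, and \<open>Funk_injective\<close> applies to the
  difference at each radius \<open>r\<close>. The freedom in \<Phi> gives sums as well as sums of
  squares.\<close>

lemma rot_related_even_part:
  fixes f g :: "real^3 \<Rightarrow> 'i \<Rightarrow> real" and \<Phi> :: "real \<Rightarrow> real"
  assumes cf: "\<And>i. continuous_on UNIV (\<lambda>x. f x i)" and cg: "\<And>i. continuous_on UNIV (\<lambda>x. g x i)"
    and c\<Phi>: "continuous_on UNIV \<Phi>"
    and rel: "\<And>w. norm w = 1 \<Longrightarrow> \<exists>a. 0 \<le> a \<and> a \<le> 2 * pi \<and> rot_related f g w a"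
  shows "\<Phi> (f x i) + \<Phi> (f (- x) i) = \<Phi> (g x i) + \<Phi> (g (- x) i)"
proof -
  obtain w where w: "norm w = 1" "w \<bullet> x = 0" using exists_orthogonal_unit .
  obtain r y where y: "norm y = 1" "x = r *\<^sub>R y"
    using unit_multiple_orthogonal[OF w(1), of x] w(2) by (metis inner_commute)
  have cF: "continuous_on S (\<lambda>t. \<Phi> (f (k t) i))" and cG: "continuous_on S (\<lambda>t. \<Phi> (g (k t) i))"
    if "continuous_on S k" for S :: "'s::topological_space set" and k
    using continuous_on_compose2[OF c\<Phi> continuous_on_compose2[OF cf that]]
      continuous_on_compose2[OF c\<Phi> continuous_on_compose2[OF cg that]] by auto
  have "(\<Phi> (f (r *\<^sub>R y) i) - \<Phi> (g (r *\<^sub>R y) i)) + (\<Phi> (f (r *\<^sub>R - y) i) - \<Phi> (g (r *\<^sub>R - y) i)) = 0"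
  proof (rule Funk_injective[where q = "\<lambda>y. \<Phi> (f (r *\<^sub>R y) i) - \<Phi> (g (r *\<^sub>R y) i)", OF _ _ y(1)])
    show "continuous_on UNIV (\<lambda>y. \<Phi> (f (r *\<^sub>R y) i) - \<Phi> (g (r *\<^sub>R y) i))"
      by (intro continuous_intros cF cG)
    fix w e :: "real^3" assume we: "norm w = 1" "norm e = 1" "e \<bullet> w = 0"
    obtain a where a: "0 \<le> a" "a \<le> 2 * pi" "rot_related f g w a" using rel we(1) by blast
    have "g (r *\<^sub>R rot w t e) i = f (r *\<^sub>R rot w (t + a) e) i" for t
    proof -
      have "r *\<^sub>R rot w t e \<bullet> w = 0" using we rot_orthogonal by simp
      then have "g (r *\<^sub>R rot w t e) i = f (rot w a (r *\<^sub>R rot w t e)) i"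
        using a(3) by (simp add: rot_related_def)
      then show ?thesis using we by (simp add: rot_scaleR rot_rot add.commute)
    qed
    then have "integral {0..2*pi} (\<lambda>t. \<Phi> (g (r *\<^sub>R rot w t e) i))
        = integral {0..2*pi} (\<lambda>t. \<Phi> (f (r *\<^sub>R rot w (t + a) e) i))" by simp
    also have "\<dots> = integral {0..2*pi} (\<lambda>t. \<Phi> (f (r *\<^sub>R rot w t e) i))"
    proof (rule integral_periodic_shift[where f = "\<lambda>t. \<Phi> (f (r *\<^sub>R rot w t e) i)", OF _ _ a(1,2)])
      show "continuous_on UNIV (\<lambda>t. \<Phi> (f (r *\<^sub>R rot w t e) i))"
        by (intro cF continuous_intros)
      show "\<Phi> (f (r *\<^sub>R rot w (t + 2 * pi) e) i) = \<Phi> (f (r *\<^sub>R rot w t e) i)" for t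
        using rot_periodic[of w t 1 e] by simp
    qed
    finally show "integral {0..2*pi} (\<lambda>t. \<Phi> (f (r *\<^sub>R rot w t e) i) - \<Phi> (g (r *\<^sub>R rot w t e) i)) = 0"
      by (subst integral_diff) (auto intro!: integrable_continuous_real cF cG continuous_intros)
  qed
  then show ?thesis by (simp add: y(2))
qed

text \<open>A finite Baire argument: either the piece of \<open>S\<close> lies in
  \<open>C t\<close>, or what remains of it outside \<open>C t\<close> is relatively open, nonempty
  and covered by the other sets.\<close>

lemma closed_cover_interior:
  fixes C :: "'b \<Rightarrow> 'a::topological_space set"
  assumes "finite T" "\<And>t. t \<in> T \<Longrightarrow> closed (C t)" "open U" "U \<inter> S \<noteq> {}" "U \<inter> S \<subseteq> (\<Union>t\<in>T. C t)"
  shows "\<exists>t\<in>T. \<exists>V. open V \<and> V \<subseteq> U \<and> V \<inter> S \<noteq> {} \<and> V \<inter> S \<subseteq> C t"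
  using assms
proof (induction T arbitrary: U)
  case empty
  then show ?case by auto
next
  case (insert t T)
  show ?case
  proof (cases "(U - C t) \<inter> S = {}")
    case True
    then show ?thesis using insert.prems by (intro bexI[of _ t] exI[of _ U]) auto
  next
    case False
    have "\<exists>t'\<in>T. \<exists>V. open V \<and> V \<subseteq> U - C t \<and> V \<inter> S \<noteq> {} \<and> V \<inter> S \<subseteq> C t'"
      using insert.prems False by (intro insert.IH) (auto intro: open_Diff)
    then show ?thesis by blast
  qed
qed

lemma closed_rot_related:
  fixes f g :: "real^3 \<Rightarrow> 'i \<Rightarrow> real"
  assumes cf: "\<And>i. continuous_on UNIV (\<lambda>x. f x i)" and cg: "\<And>i. continuous_on UNIV (\<lambda>x. g x i)"
  shows "closed {(w, a). \<forall>v i. f (rot w a (cross3 w v)) i = g (cross3 w v) i}"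
proof -
  have iso: "continuous_on S (\<lambda>t. f (k t) s)" "continuous_on S (\<lambda>t. g (k t) s)"
    if "continuous_on S k" for S :: "((real^3) \<times> real) set" and k s
    using continuous_on_compose2[OF cf that] continuous_on_compose2[OF cg that] by auto
  show ?thesis unfolding split_beta
    by (intro closed_Collect_all closed_Collect_eq iso continuous_intros)
qed

lemma closed_rot_related_axes:
  fixes f g :: "real^3 \<Rightarrow> 'i \<Rightarrow> real"
  assumes cf: "\<And>i. continuous_on UNIV (\<lambda>x. f x i)" and cg: "\<And>i. continuous_on UNIV (\<lambda>x. g x i)"
  shows "closed {w. \<forall>v i. f (rot w a (cross3 w v)) i = g (cross3 w v) i}"
proof -
  have iso: "continuous_on S (\<lambda>t. f (k t) s)" "continuous_on S (\<lambda>t. g (k t) s)"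
    if "continuous_on S k" for S :: "(real^3) set" and k s
    using continuous_on_compose2[OF cf that] continuous_on_compose2[OF cg that] by auto
  show ?thesis
    by (intro closed_Collect_all closed_Collect_eq iso continuous_intros)
qed

text \<open>By the Funk transform \<open>f\<close> and \<open>g\<close> have the same even parts and the same squared odd parts, so
  the latter are invariant under the relating rotations. Where the angle is not a multiple of
  \<open>\<pi>\<close> it takes finitely many values, hence it is constant for an open set of axes, which makes
  these functions locally constant.\<close>

lemma rot_related_0_or_pi:
  fixes f g :: "real^3 \<Rightarrow> 'i \<Rightarrow> real"
  assumes cf: "\<And>i. continuous_on UNIV (\<lambda>x. f x i)" and cg: "\<And>i. continuous_on UNIV (\<lambda>x. g x i)"
    and nosym: "\<And>w. norm w = 1 \<Longrightarrow> pi \<notin> rot_invariances f w"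
    and rel: "\<And>w. norm w = 1 \<Longrightarrow> \<exists>a. 0 \<le> a \<and> a \<le> 2 * pi \<and> rot_related f g w a"
    and w: "norm w = 1"
  shows "rot_related f g w 0 \<or> rot_related f g w pi"
proof (rule ccontr)
  assume neg: "\<not> ?thesis"
  \<comment> \<open>\<open>True\<close> selects the even part and \<open>False\<close> the square of
    the odd part, up to constant factors.\<close>
  define q where "q x = (\<lambda>(b, i). if b then f x i + f (- x) i else (f x i - f (- x) i)\<^sup>2)" for x
  have qg: "q x = (\<lambda>(b, i). if b then g x i + g (- x) i else (g x i - g (- x) i)\<^sup>2)" for x
  proof -
    have 1: "f x i + f (- x) i = g x i + g (- x) i" for i
      using rot_related_even_part[OF cf cg _ rel, where \<Phi> = "\<lambda>t. t"] by auto
    have "(f x i)\<^sup>2 + (f (- x) i)\<^sup>2 = (g x i)\<^sup>2 + (g (- x) i)\<^sup>2" for i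
      by (rule rot_related_even_part[OF cf cg _ rel, where \<Phi> = "\<lambda>t. t\<^sup>2"]) (intro continuous_intros)
    moreover have "(s - t)\<^sup>2 = 2 * (s\<^sup>2 + t\<^sup>2) - (s + t)\<^sup>2" for s t :: real
      by (simp add: power2_eq_square algebra_simps)
    ultimately have "(f x i - f (- x) i)\<^sup>2 = (g x i - g (- x) i)\<^sup>2" for i using 1 by metis
    then show ?thesis using 1 by (auto simp: q_def)
  qed
  have cq: "continuous_on S (\<lambda>x. q x j)" for j and S :: "(real^3) set"
  proof (cases j)
    case (Pair b i)
    have "continuous_on S (\<lambda>x. f x i)" "continuous_on S (\<lambda>x. f (- x) i)"
      by (rule continuous_on_compose2[OF cf], intro continuous_intros, simp)+
    then show ?thesis unfolding q_def Pair by (cases b) (auto intro!: continuous_intros)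
  qed
  have inv: "a \<in> rot_invariances q w" if "norm w = 1" "rot_related f g w a" for w a
    unfolding rot_invariances_def
  proof clarify
    fix x b i assume x: "x \<bullet> w = 0"
    have "f (rot w a x) i = g x i" "f (- rot w a x) i = g (- x) i" for i
      using that(2) x rot_minus[of w a x] by (auto simp: rot_related_def) (metis inner_minus_left neg_equal_0_iff_equal)
    then show "q (rot w a x) (b, i) = q x (b, i)" unfolding qg[of x] by (simp add: q_def)
  qed
  \<comment> \<open>The difference of \<open>f\<close> at antipodal points changes sign under a half
    turn, so it has a zero on the circle of \<open>x\<close>. If its square were constant there,
    \<open>f\<close> would be even on the circle and pi an invariance of \<open>f\<close>.\<close>
  have nontriv: "\<exists>\<theta>\<ge>0. \<theta> \<notin> rot_invariances q w" if w: "norm w = 1" for w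
  proof (rule ccontr)
    assume all: "\<not> ?thesis"
    have "pi \<in> rot_invariances f w"
      unfolding rot_invariances_def
    proof clarify
      fix x i assume x: "x \<bullet> w = 0"
      let ?k = "\<lambda>t. f (rot w t x) i - f (- rot w t x) i"
      have k: "continuous_on {0..pi} ?k"
        by (intro continuous_intros continuous_on_compose2[OF cf]) auto
      have pm: "?k pi = - ?k 0" by simp
      obtain t where t: "0 \<le> t" "?k t = 0"
      proof (cases "?k 0 \<le> 0")
        case True
        then show ?thesis using IVT'[of ?k 0 0 pi] k pm that by auto
      next
        case False
        then show ?thesis using IVT2'[of ?k pi 0 0] k pm that by auto
      qed
      then have "t \<in> rot_invariances q w" using all by auto
      then have "q (rot w t x) (False, i) = q x (False, i)" using x by (simp add: rot_invariances_def)
      then show "f (rot w pi x) i = f x i" using t by (simp add: q_def)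
    qed
    then show False using nosym w by blast
  qed
  obtain M :: nat where M: "M > 0"
    "\<And>w a. norm w = 1 \<Longrightarrow> a \<in> rot_invariances q w \<Longrightarrow> \<exists>k::int. of_nat M * a = 2 * pi * of_int k"
    using rot_invariances_torsion[OF cq nontriv] by metis
  define C where "C a = {w. \<forall>v i. f (rot w a (cross3 w v)) i = g (cross3 w v) i}" for a
  have C: "w \<in> C a \<longleftrightarrow> rot_related f g w a" if "norm w = 1" for w a
    by (simp add: C_def rot_related_iff_cross[OF that])
  have clC: "closed (C a)" for a
    unfolding C_def by (rule closed_rot_related_axes[OF cf cg])
  \<comment> \<open>The angles in [0, 2 pi] whose \<open>M\<close>-fold is a multiple of 2 pi. They
    are finitely many, so one of them serves a whole open set of axes.\<close>
  define T where "T = (\<lambda>k. 2 * pi * real_of_int k / M) ` {0..int M}"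
  have "\<exists>t\<in>T. \<exists>V. open V \<and> V \<subseteq> - C 0 - C pi \<and> V \<inter> sphere 0 1 \<noteq> {} \<and> V \<inter> sphere 0 1 \<subseteq> C t"
  proof (rule closed_cover_interior)
    show "finite T" by (simp add: T_def)
    show "open (- C 0 - C pi)" using clC by (intro open_Diff) auto
    show "(- C 0 - C pi) \<inter> sphere 0 1 \<noteq> {}"
    proof -
      have "w \<in> (- C 0 - C pi) \<inter> sphere 0 1" using neg C[OF w] w by simp
      then show ?thesis by blast
    qed
    show "(- C 0 - C pi) \<inter> sphere 0 1 \<subseteq> (\<Union>t\<in>T. C t)"
    proof
      fix w' assume "w' \<in> (- C 0 - C pi) \<inter> sphere 0 1"
      then have w': "norm w' = 1" by simp
      then obtain a where a: "0 \<le> a" "a \<le> 2 * pi" "rot_related f g w' a" using rel by blast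
      then obtain k :: int where k: "real M * a = 2 * pi * of_int k" using M(2) inv w' by blast
      have "0 \<le> real M * a" "real M * a \<le> 2 * pi * real M" using a mult_left_mono[of a "2 * pi" "real M"] by (auto simp: mult.commute)
      then have "0 \<le> k" "k \<le> int M" unfolding k using pi_gt_zero by (auto simp: zero_le_mult_iff)
      moreover have "a = 2 * pi * of_int k / M" using k M(1) by (simp add: field_simps)
      ultimately have "a \<in> T" by (auto simp: T_def)
      then show "w' \<in> (\<Union>t\<in>T. C t)" using a(3) C[OF w'] by blast
    qed
  qed (use clC in auto)
  then obtain t V where V: "open V" "V \<subseteq> - C 0 - C pi" "V \<inter> sphere 0 1 \<noteq> {}" "V \<inter> sphere 0 1 \<subseteq> C t"
    by blast
  then obtain v where v: "norm v = 1" "v \<in> V" by auto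
  have Vt: "rot_related f g w t" if "norm w = 1" "w \<in> V" for w using V(4) C that by auto
  have "sin t \<noteq> 0"
  proof
    assume s: "sin t = 0"
    then consider "cos t = 1" | "cos t = - 1" using sin_cos_squared_add[of t] by (auto simp: power2_eq_1_iff)
    then have "rot v t = rot v 0 \<or> rot v t = rot v pi" using s by cases (auto simp: rot_def)
    then have "v \<in> C 0 \<or> v \<in> C pi" using Vt[OF v] C[OF v(1)] by (auto simp: rot_related_def)
    then show False using V(2) v(2) by auto
  qed
  \<comment> \<open>One angle with nonzero sine works for all unit axes in \<open>V\<close>, so
    every rotation about \<open>v\<close> preserves \<open>q\<close>, which \<open>nontriv\<close>
    forbids.\<close>
  have "\<theta> \<in> rot_invariances q v" for \<theta>
    unfolding rot_invariances_def mem_Collect_eq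
  proof (intro allI impI)
    fix x j assume "x \<bullet> v = 0"
    then obtain r y where y: "norm y = 1" "y \<bullet> v = 0" "x = r *\<^sub>R y"
      using unit_multiple_orthogonal[OF v(1)] by blast
    have "q (r *\<^sub>R rot v \<theta> y) j = q (r *\<^sub>R y) j"
    proof (rule rot_invariant_on_open_axes[where q = "\<lambda>y. q (r *\<^sub>R y) j", OF V(1) \<open>sin t \<noteq> 0\<close> _ v y(1,2)])
      fix w x assume *: "norm w = 1" "w \<in> V" "x \<bullet> w = 0"
      then have "t \<in> rot_invariances q w" using inv Vt by blast
      then show "q (r *\<^sub>R rot w t x) j = q (r *\<^sub>R x) j"
        using * by (cases j) (simp add: rot_invariances_def flip: rot_scaleR)
    qed
    then show "q (rot v \<theta> x) j = q x j" by (simp add: y(3) rot_scaleR)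
  qed
  then show False using nontriv[OF v(1)] by blast
qed

text \<open>On the plane of any axis the rotations by 0 and pi are the identity and its negative, so
  one such angle for all axes gives one identity for all points. An axis admitting both angles would
  make pi an invariance of \<open>f\<close>.\<close>

lemma all_rot_related_imp:
  fixes f g :: "real^3 \<Rightarrow> 'i \<Rightarrow> real"
  assumes cf: "\<And>i. continuous_on UNIV (\<lambda>x. f x i)" and cg: "\<And>i. continuous_on UNIV (\<lambda>x. g x i)"
    and nosym: "\<And>w. norm w = 1 \<Longrightarrow> pi \<notin> rot_invariances f w"
    and rel: "\<And>w. norm w = 1 \<Longrightarrow> \<exists>a. 0 \<le> a \<and> a \<le> 2 * pi \<and> rot_related f g w a"
  shows "(\<forall>x i. f x i = g x i) \<or> (\<forall>x i. f (- x) i = g x i)"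
proof -
  define C where "C a = sphere 0 1 \<inter> {w. \<forall>v i. f (rot w a (cross3 w v)) i = g (cross3 w v) i}" for a
  have C: "w \<in> C a \<longleftrightarrow> norm w = 1 \<and> rot_related f g w a" for w a
    using rot_related_iff_cross[of w f g a] by (auto simp: C_def)
  have clC: "closed (C a)" for a
    unfolding C_def by (intro closed_Int closed_rot_related_axes cf cg) simp
  have "C 0 \<inter> C pi = {}"
  proof (rule ccontr)
    assume "C 0 \<inter> C pi \<noteq> {}"
    then obtain w where "norm w = 1" "rot_related f g w 0" "rot_related f g w pi" using C by auto
    then show False using nosym[of w] by (auto simp: rot_related_def rot_invariances_def)
  qed
  moreover have "sphere 0 1 \<subseteq> C 0 \<union> C pi"
  proof
    fix w :: "real^3" assume "w \<in> sphere 0 1"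
    then have w: "norm w = 1" by simp
    show "w \<in> C 0 \<union> C pi" using rot_related_0_or_pi[OF cf cg nosym rel w] C w by blast
  qed
  moreover have "connected (sphere (0::real^3) 1)" by (rule connected_sphere) simp
  ultimately have "C 0 \<inter> sphere 0 1 = {} \<or> C pi \<inter> sphere 0 1 = {}"
    using clC unfolding connected_closed by (metis inf_bot_left)
  with \<open>sphere 0 1 \<subseteq> C 0 \<union> C pi\<close> have "sphere 0 1 \<subseteq> C pi \<or> sphere 0 1 \<subseteq> C 0" by blast
  moreover have "f (rot w a x) i = g x i" if "sphere 0 1 \<subseteq> C a" "norm w = 1" "w \<bullet> x = 0" for a w x i
    using that C by (auto simp: rot_related_def inner_commute)
  ultimately show ?thesis using exists_orthogonal_unit by (metis rot_0 rot_pi)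
qed

text \<open>\<open>G\<close> stands for the axes at which the congruence is known to respect
  \<zeta>. A dense set suffices because limits of admissible angles and of admissible flip axes are
  admissible.\<close>

theorem circlewise_related_imp:
  fixes f g :: "real^3 \<Rightarrow> real \<Rightarrow> real"
  assumes cf: "\<And>s. continuous_on UNIV (\<lambda>x. f x s)" and cg: "\<And>s. continuous_on UNIV (\<lambda>x. g x s)"
    and norot: "\<And>w. norm w = 1 \<Longrightarrow> pi \<notin> rot_invariances f w"
    and noflip: "\<And>w u. norm w = 1 \<Longrightarrow> norm u = 1 \<Longrightarrow> u \<bullet> w = 0 \<Longrightarrow> \<not> flip_related f f w u"
    and dense: "sphere 0 1 \<subseteq> closure G" and G: "G \<subseteq> sphere 0 1"
    and rel: "\<And>w. w \<in> G \<Longrightarrow> (\<exists>a. 0 \<le> a \<and> a \<le> 2 * pi \<and> rot_related f g w a)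
       \<or> (\<exists>u. norm u = 1 \<and> u \<bullet> w = 0 \<and> flip_related f g w u)"
  shows "(\<forall>x s. f x s = g x s) \<or> (\<forall>x s. f (- x) s = g x s)"
proof -
  define A where "A = {w. norm w = 1 \<and> (\<exists>a. 0 \<le> a \<and> a \<le> 2 * pi \<and> rot_related f g w a)}"
  define B where "B = {w. norm w = 1 \<and> (\<exists>u. norm u = 1 \<and> u \<bullet> w = 0 \<and> flip_related f g w u)}"
  have "compact ((sphere 0 1 \<times> {0..2 * pi}) \<inter> {(w, a). \<forall>v i. f (rot w a (cross3 w v)) i = g (cross3 w v) i})"
    by (intro compact_Int_closed compact_Times closed_rot_related cf cg) auto
  then have "compact (fst ` ((sphere 0 1 \<times> {0..2 * pi}) \<inter> {(w, a). \<forall>v i. f (rot w a (cross3 w v)) i = g (cross3 w v) i}))"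
    by (intro compact_continuous_image continuous_intros)
  moreover have "fst ` ((sphere 0 1 \<times> {0..2 * pi}) \<inter> {(w, a). \<forall>v i. f (rot w a (cross3 w v)) i = g (cross3 w v) i}) = A"
    by (force simp: A_def rot_related_iff_cross)
  ultimately have clA: "closed A" by (simp add: compact_imp_closed)
  have iso: "continuous_on S (\<lambda>t. f (k t) s)" "continuous_on S (\<lambda>t. g (k t) s)"
    if "continuous_on S k" for S :: "((real^3) \<times> (real^3)) set" and k s
    using continuous_on_compose2[OF cf that] continuous_on_compose2[OF cg that] by auto
  let ?F = "{z. snd z \<bullet> fst z = 0} \<inter> {z. \<forall>v s. f (flip (snd z) (cross3 (fst z) v)) (- s) = g (cross3 (fst z) v) s}"
  have "closed ?F"
    by (intro closed_Int closed_Collect_all closed_Collect_eq iso continuous_intros)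
  then have "compact ((sphere 0 1 \<times> sphere 0 1) \<inter> ?F)"
    by (intro compact_Int_closed compact_Times) auto
  then have "compact (fst ` ((sphere 0 1 \<times> sphere 0 1) \<inter> ?F))"
    by (intro compact_continuous_image continuous_intros)
  moreover have "fst ` ((sphere 0 1 \<times> sphere 0 1) \<inter> ?F) = B"
    by (force simp: B_def flip_related_iff_cross)
  ultimately have clB: "closed B" by (simp add: compact_imp_closed)
  have "G \<subseteq> A \<union> B" using rel G by (auto simp: A_def B_def)
  then have "closure G \<subseteq> A \<union> B" using clA clB by (intro closure_minimal) auto
  then have AB: "sphere 0 1 \<subseteq> A \<union> B" using dense by simp
  have "A \<inter> B = {}"
  proof (rule ccontr)
    assume "A \<inter> B \<noteq> {}"
    then obtain w a u where w: "norm w = 1" and a: "rot_related f g w a"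
      and u: "norm u = 1" "u \<bullet> w = 0" "flip_related f g w u"
      by (auto simp: A_def B_def)
    \<comment> \<open>Undoing the rotation by \<open>a\<close> and then flipping preserves
      \<open>f\<close>; the composition is the flip with axis turned by a / 2.\<close>
    have "flip_related f f w (rot w (a / 2) u)"
      unfolding flip_related_def
    proof (intro allI impI)
      fix x s assume x: "x \<bullet> w = 0"
      have x': "rot w (- a) x \<bullet> w = 0" using rot_orthogonal x by simp
      have "f (flip (rot w (a / 2) u) x) (- s) = f (flip u (rot w (- a) x)) (- s)"
        using flip_rot_half[OF w u(1,2) x, of "- a"] by simp
      also have "\<dots> = g (rot w (- a) x) s" using u(3) x' unfolding flip_related_def by blast
      also have "\<dots> = f (rot w a (rot w (- a) x)) s" using a x' unfolding rot_related_def by metis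
      also have "\<dots> = f x s" using rot_rot[OF w x] by simp
      finally show "f (flip (rot w (a / 2) u) x) (- s) = f x s" .
    qed
    then show False using noflip w norm_rot[OF w u(2)] rot_orthogonal[OF u(2)] u(1) by metis
  qed
  moreover have "connected (sphere (0::real^3) 1)" by (rule connected_sphere) simp
  ultimately have "A \<inter> sphere 0 1 = {} \<or> B \<inter> sphere 0 1 = {}"
    using clA clB AB unfolding connected_closed by (metis inf_bot_left)
  with AB consider "sphere 0 1 \<subseteq> A" | "sphere 0 1 \<subseteq> B" by blast
  then show ?thesis
  proof cases
    case 1
    show ?thesis by (rule all_rot_related_imp[OF cf cg norot]) (use 1 in \<open>auto simp: A_def\<close>)
  next
    case 2
    have False
      by (rule not_all_flip_related[OF cf cg])
        (use 2 norot in \<open>auto simp: B_def intro!: exI[of _ pi]\<close>)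
    then show ?thesis ..
  qed
qed

section \<open>Support functions, diameters and projections\<close>

lemma norm_diff_scaleR_squared:
  assumes "norm (\<zeta>::'a::real_inner) = 1"
  shows "(norm (v - d *\<^sub>R \<zeta>))\<^sup>2 = (norm v)\<^sup>2 - 2 * d * (\<zeta> \<bullet> v) + d\<^sup>2"
  using assms unfolding power2_norm_eq_inner
  by (simp add: inner_diff_left inner_diff_right norm_eq_1 inner_commute power2_eq_square)

context
  fixes K :: "'a::euclidean_space set"
  assumes K: "compact K" "K \<noteq> {}"
begin

lemma support_fun_bdd: "bdd_above ((\<lambda>y. x \<bullet> y) ` K)"
  using K(1) by (intro bounded_imp_bdd_above compact_imp_bounded compact_continuous_image continuous_intros)

lemma support_fun_ge: "y \<in> K \<Longrightarrow> x \<bullet> y \<le> support_fun K x"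
  unfolding support_fun_def by (rule cSUP_upper[OF _ support_fun_bdd])

lemma support_fun_le: "(\<And>y. y \<in> K \<Longrightarrow> x \<bullet> y \<le> c) \<Longrightarrow> support_fun K x \<le> c"
  unfolding support_fun_def using K(2) by (rule cSUP_least)

lemma support_fun_attained: obtains y where "y \<in> K" "support_fun K x = x \<bullet> y"
proof -
  have "continuous_on K (\<lambda>y. x \<bullet> y)" by (intro continuous_intros)
  then obtain y where "y \<in> K" "\<forall>z\<in>K. x \<bullet> z \<le> x \<bullet> y"
    using continuous_attains_sup[OF K] by metis
  then show ?thesis using that[of y] support_fun_ge[of y x] support_fun_le[of x "x \<bullet> y"] by force
qed

lemma continuous_on_support_fun: "continuous_on S (support_fun K)"
proof -
  obtain B where B: "\<And>y. y \<in> K \<Longrightarrow> norm y \<le> B" "B > 0"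
    using compact_imp_bounded[OF K(1)] bounded_pos by metis
  have le: "support_fun K x \<le> support_fun K z + B * norm (x - z)" for x z
  proof (rule support_fun_le)
    fix y assume y: "y \<in> K"
    have "x \<bullet> y = z \<bullet> y + (x - z) \<bullet> y" by (simp add: inner_diff_left)
    also have "(x - z) \<bullet> y \<le> norm (x - z) * norm y" by (rule norm_cauchy_schwarz)
    also have "\<dots> \<le> norm (x - z) * B" using B(1)[OF y] by (intro mult_left_mono) auto
    finally show "x \<bullet> y \<le> support_fun K z + B * norm (x - z)"
      using support_fun_ge[OF y, of z] by (simp add: mult.commute)
  qed
  have "B-lipschitz_on S (support_fun K)"
  proof (rule lipschitz_onI)
    fix x y assume "x \<in> S" "y \<in> S"
    show "dist (support_fun K x) (support_fun K y) \<le> B * dist x y"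
      using le[of x y] le[of y x] by (simp add: dist_norm norm_minus_commute abs_le_iff)
  qed (use B(2) in simp)
  then show ?thesis by (rule lipschitz_on_continuous_on)
qed

lemma width_fun_le_max: "norm \<theta> = 1 \<Longrightarrow> width_fun K \<theta> \<le> max_width K"
proof -
  assume n: "norm \<theta> = 1"
  have "continuous_on (sphere 0 1) (width_fun K)"
    unfolding width_fun_def[abs_def]
    by (intro continuous_intros continuous_on_support_fun continuous_on_compose2[OF continuous_on_support_fun]) auto
  then have "bdd_above (width_fun K ` sphere 0 1)"
    by (intro bounded_imp_bdd_above compact_imp_bounded compact_continuous_image) auto
  then show ?thesis unfolding max_width_def using n by (intro cSUP_upper) auto
qed

lemma max_width_eqI:
  assumes "\<And>\<theta>. norm \<theta> = 1 \<Longrightarrow> width_fun K \<theta> \<le> width_fun K \<xi>" "norm \<xi> = 1"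
  shows "max_width K = width_fun K \<xi>"
proof (rule antisym)
  show "max_width K \<le> width_fun K \<xi>"
    unfolding max_width_def by (rule cSUP_least) (use assms in auto)
qed (rule width_fun_le_max[OF assms(2)])

lemma width_fun_ge: "x \<in> K \<Longrightarrow> y \<in> K \<Longrightarrow> \<theta> \<bullet> (x - y) \<le> width_fun K \<theta>"
  using support_fun_ge[of x \<theta>] support_fun_ge[of y "- \<theta>"] by (simp add: width_fun_def inner_diff_right)

lemma dist_le_max_width:
  assumes "x \<in> K" "y \<in> K"
  shows "norm (x - y) \<le> max_width K"
proof (cases "x = y")
  \<comment> \<open>Here \<open>x - y\<close> supplies no direction; that the maximal width is
    nonnegative is read off from an arbitrary one.\<close>
  case True
  define b :: 'a where "b = (SOME i. i \<in> Basis)"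
  have b: "b \<in> Basis" unfolding b_def by (rule SOME_Basis)
  have "0 \<le> width_fun K b" using width_fun_ge[OF assms(1) assms(1), of b] by simp
  then show ?thesis using width_fun_le_max[of b] b True by simp
next
  case False
  define \<theta> where "\<theta> = (x - y) /\<^sub>R norm (x - y)"
  have "norm (x - y) = \<theta> \<bullet> (x - y)"
    using False by (simp add: \<theta>_def power2_norm_eq_inner[symmetric] power2_eq_square)
  also have "\<dots> \<le> width_fun K \<theta>" by (rule width_fun_ge[OF assms])
  also have "\<dots> \<le> max_width K" using False by (intro width_fun_le_max) (simp add: \<theta>_def)
  finally show ?thesis .
qed

text \<open>Points \<open>x\<close>, \<open>y\<close> attaining the support function at \<zeta> and
  - \<zeta> have difference with component D along \<zeta> and length at most D, so x - y = D
  \<zeta> as in the equality case of Cauchy-Schwarz. The centre \<open>c\<close> is their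
  midpoint.\<close>

lemma diameter_of_max_width:
  assumes \<zeta>: "norm \<zeta> = 1" and w: "width_fun K \<zeta> = max_width K"
  obtains c where "c + (max_width K / 2) *\<^sub>R \<zeta> \<in> K" "c - (max_width K / 2) *\<^sub>R \<zeta> \<in> K"
proof -
  let ?D = "max_width K"
  obtain x where x: "x \<in> K" "support_fun K \<zeta> = \<zeta> \<bullet> x" using support_fun_attained .
  obtain y where y: "y \<in> K" "support_fun K (- \<zeta>) = - \<zeta> \<bullet> y" using support_fun_attained .
  have D: "\<zeta> \<bullet> (x - y) = ?D" using w x y by (simp add: width_fun_def inner_diff_right)
  have le: "norm (x - y) \<le> ?D" using dist_le_max_width x y by blast
  have "norm (x - y - ?D *\<^sub>R \<zeta>) ^ 2 = norm (x - y) ^ 2 - ?D ^ 2"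
    unfolding norm_diff_scaleR_squared[OF \<zeta>] D by (simp add: power2_eq_square)
  also have "\<dots> \<le> 0" using le by (simp add: power_mono)
  finally have "x - y = ?D *\<^sub>R \<zeta>" by simp
  then have "(?D / 2) *\<^sub>R \<zeta> = (1/2) *\<^sub>R (x - y)" by simp
  moreover have "(1/2) *\<^sub>R (x + y) + (1/2) *\<^sub>R (x - y) = (1/2) *\<^sub>R (x + x)"
    "(1/2) *\<^sub>R (x + y) - (1/2) *\<^sub>R (x - y) = (1/2) *\<^sub>R (y + y)"
    by (simp_all only: scaleR_add_right[symmetric] scaleR_diff_right[symmetric]) simp_all
  ultimately have "x = (1/2) *\<^sub>R (x + y) + (?D / 2) *\<^sub>R \<zeta>" "y = (1/2) *\<^sub>R (x + y) - (?D / 2) *\<^sub>R \<zeta>"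
    by simp_all
  then show ?thesis using that[of "(1/2) *\<^sub>R (x + y)"] x(1) y(1) by simp
qed

text \<open>Two parallel diameters displaced by \<open>d\<close> span a parallelogram whose
  diagonals d + D \<zeta> and d - D \<zeta> have length at most D; the parallelogram law forces d =
  0.\<close>

lemma diameter_unique:
  assumes c: "c + (max_width K / 2) *\<^sub>R \<zeta> \<in> K" "c - (max_width K / 2) *\<^sub>R \<zeta> \<in> K"
    and l: "l \<in> K" "l' \<in> K" "l - l' = max_width K *\<^sub>R \<zeta>" and \<zeta>: "norm \<zeta> = 1"
  shows "l + l' = 2 *\<^sub>R c"
proof -
  let ?D = "max_width K"
  define d where "d = l - (c + (?D / 2) *\<^sub>R \<zeta>)"
  have d2: "(?D / 2) *\<^sub>R \<zeta> + (?D / 2) *\<^sub>R \<zeta> = ?D *\<^sub>R \<zeta>" by (simp flip: scaleR_add_left)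
  have d': "l' - (c - (?D / 2) *\<^sub>R \<zeta>) = d" 
    using l(3) d2 by (simp add: d_def algebra_simps)
  have e1: "l - (c - (?D / 2) *\<^sub>R \<zeta>) = d + ?D *\<^sub>R \<zeta>" and e2: "l' - (c + (?D / 2) *\<^sub>R \<zeta>) = d - ?D *\<^sub>R \<zeta>"
    using d2 d' by (simp_all add: d_def algebra_simps)
  have D: "?D \<ge> 0" using dist_le_max_width[OF l(1) l(1)] by simp
  have "norm (d + ?D *\<^sub>R \<zeta>) \<le> ?D" "norm (d - ?D *\<^sub>R \<zeta>) \<le> ?D"
    unfolding e1[symmetric] e2[symmetric] using dist_le_max_width c l by blast+
  then have "norm (d + ?D *\<^sub>R \<zeta>) ^ 2 \<le> ?D ^ 2" "norm (d - ?D *\<^sub>R \<zeta>) ^ 2 \<le> ?D ^ 2"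
    by (simp_all add: power_mono)
  moreover have "norm (d + ?D *\<^sub>R \<zeta>) ^ 2 + norm (d - ?D *\<^sub>R \<zeta>) ^ 2 = 2 * norm d ^ 2 + 2 * ?D ^ 2"
    using norm_diff_scaleR_squared[OF \<zeta>, of d ?D] norm_diff_scaleR_squared[OF \<zeta>, of d "- ?D"] by simp
  ultimately have "norm d ^ 2 \<le> 0" by linarith
  then have "d = 0" by simp
  then have "l = c + (?D / 2) *\<^sub>R \<zeta>" "l' = c - (?D / 2) *\<^sub>R \<zeta>" using d' by (simp_all add: d_def)
  then show ?thesis by (simp add: scaleR_2)
qed

lemma width_of_diameter_parallel:
  assumes "has_diameter_parallel K \<zeta>" and \<zeta>: "norm \<zeta> = 1"
  shows "width_fun K \<zeta> = max_width K"
proof -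
  obtain z y t where zy: "closed_segment z y \<subseteq> K" "norm (z - y) = max_width K" "z - y = t *\<^sub>R \<zeta>"
    using assms(1) by (auto simp: has_diameter_parallel_def diameter_segment_def)
  have K: "z \<in> K" "y \<in> K" using zy(1) by auto
  have "\<bar>t\<bar> = max_width K" using zy(2,3) \<zeta> by simp
  moreover have "t \<le> width_fun K \<zeta>" "- t \<le> width_fun K \<zeta>"
  proof -
    have "\<zeta> \<bullet> (z - y) = t" using zy(3) \<zeta> by (simp add: norm_eq_1)
    moreover from this have "\<zeta> \<bullet> (y - z) = - t" by (simp add: inner_diff_right)
    ultimately show "t \<le> width_fun K \<zeta>" "- t \<le> width_fun K \<zeta>"
      using width_fun_ge[OF K, of \<zeta>] width_fun_ge[OF K(2,1), of \<zeta>] by simp_all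
  qed
  ultimately show ?thesis using width_fun_le_max[OF \<zeta>] by linarith
qed

end

lemma support_fun_subset:
  fixes A B :: "'a::euclidean_space set"
  assumes A: "compact A" "A \<noteq> {}" and B: "compact B" "B \<noteq> {}" "convex B"
    and le: "\<And>x. support_fun A x \<le> support_fun B x"
  shows "A \<subseteq> B"
proof
  fix z assume z: "z \<in> A"
  show "z \<in> B"
  proof (rule ccontr)
    assume "z \<notin> B"
    then obtain a b where ab: "a \<bullet> z < b" "\<forall>x\<in>B. a \<bullet> x > b"
      using separating_hyperplane_closed_point[OF B(3) compact_imp_closed[OF B(1)]] by metis
    have "support_fun B (- a) \<le> - b" using ab(2) by (intro support_fun_le[OF B(1,2)]) (auto simp: less_imp_le)
    moreover have "- a \<bullet> z \<le> support_fun A (- a)" by (rule support_fun_ge[OF A z])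
    ultimately show False using le[of "- a"] ab(1) by simp
  qed
qed

lemma support_fun_eqD:
  fixes A B :: "'a::euclidean_space set"
  assumes "compact A" "A \<noteq> {}" "convex A" "compact B" "B \<noteq> {}" "convex B"
    and "\<And>x. support_fun A x = support_fun B x"
  shows "A = B"
  using support_fun_subset[of A B] support_fun_subset[of B A] assms by auto

lemma support_fun_translate:
  fixes A :: "'a::euclidean_space set"
  assumes "compact A" "A \<noteq> {}"
  shows "support_fun ((\<lambda>x. x + a) ` A) y = support_fun A y + y \<bullet> a"
proof -
  have c: "compact ((\<lambda>x. x + a) ` A)" "(\<lambda>x. x + a) ` A \<noteq> {}"
    using assms by (auto intro!: compact_continuous_image continuous_intros)
  have "support_fun ((\<lambda>x. x + a) ` A) y \<le> support_fun A y + y \<bullet> a"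
    by (rule support_fun_le[OF c]) (auto simp: inner_add_right support_fun_ge[OF assms])
  moreover have "support_fun A y \<le> support_fun ((\<lambda>x. x + a) ` A) y - y \<bullet> a"
  proof (rule support_fun_le[OF assms])
    fix x assume "x \<in> A"
    then have "y \<bullet> (x + a) \<le> support_fun ((\<lambda>x. x + a) ` A) y" by (intro support_fun_ge[OF c]) auto
    then show "y \<bullet> x \<le> support_fun ((\<lambda>x. x + a) ` A) y - y \<bullet> a" by (simp add: inner_add_right)
  qed
  ultimately show ?thesis by simp
qed

lemma support_fun_linear_image:
  fixes A :: "'a::euclidean_space set" and \<phi> \<psi> :: "'a \<Rightarrow> 'a"
  assumes A: "compact A" "A \<noteq> {}" and l: "linear \<phi>" and adj: "\<And>x y. y \<bullet> \<phi> x = \<psi> y \<bullet> x"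
  shows "support_fun (\<phi> ` A) y = support_fun A (\<psi> y)"
proof -
  have c: "compact (\<phi> ` A)" "\<phi> ` A \<noteq> {}"
    using A l by (auto intro!: compact_continuous_image linear_continuous_on simp: linear_conv_bounded_linear)
  have "support_fun (\<phi> ` A) y \<le> support_fun A (\<psi> y)"
    by (rule support_fun_le[OF c]) (auto simp: adj support_fun_ge[OF A])
  moreover have "support_fun A (\<psi> y) \<le> support_fun (\<phi> ` A) y"
    by (rule support_fun_le[OF A]) (auto simp: support_fun_ge[OF c] simp flip: adj)
  ultimately show ?thesis by simp
qed

section \<open>Projections onto hyperplanes and their congruences\<close>

lemma mem_orthogonal_comp_singleton: "x \<in> {w}\<^sup>\<bottom> \<longleftrightarrow> w \<bullet> x = 0"
  by (simp add: orthogonal_comp_def orthogonal_def)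

lemma mem_orthogonal_comp2_singleton:
  assumes "norm w = 1"
  shows "x \<in> {w}\<^sup>\<bottom>\<^sup>\<bottom> \<longleftrightarrow> x = (w \<bullet> x) *\<^sub>R w"
proof
  assume x: "x \<in> {w}\<^sup>\<bottom>\<^sup>\<bottom>"
  let ?p = "x - (w \<bullet> x) *\<^sub>R w"
  have "?p \<in> {w}\<^sup>\<bottom>" using assms by (simp add: mem_orthogonal_comp_singleton inner_diff_right norm_eq_1)
  moreover from this have "?p \<bullet> w = 0" by (simp add: mem_orthogonal_comp_singleton inner_commute)
  ultimately have "?p \<bullet> ?p = 0"
    using x by (simp add: orthogonal_comp_def orthogonal_def inner_diff_right)
  then show "x = (w \<bullet> x) *\<^sub>R w" by simp
next
  assume "x = (w \<bullet> x) *\<^sub>R w"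
  then have "y \<bullet> x = 0" if "w \<bullet> y = 0" for y
    by (metis inner_scaleR_right inner_commute mult_zero_right that)
  then show "x \<in> {w}\<^sup>\<bottom>\<^sup>\<bottom>" by (auto simp: orthogonal_comp_def orthogonal_def)
qed

text \<open>For a unit vector \<open>w\<close> the image is the hyperplane orthogonal to
  \<open>w\<close>. The map is linear and self-adjoint, so it drops out of inner products with
  vectors of the hyperplane.\<close>

definition along_proj :: "'a::euclidean_space \<Rightarrow> 'a \<Rightarrow> 'a" where
  "along_proj w x = x - (w \<bullet> x) *\<^sub>R w"

lemma linear_along_proj: "linear (along_proj w)"
  by (auto intro!: linearI simp: along_proj_def inner_add_right algebra_simps)

lemma along_proj_adj: "y \<bullet> along_proj w x = along_proj w y \<bullet> x"
  by (simp add: along_proj_def inner_diff_right inner_diff_left inner_commute)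

lemma along_proj_orthogonal: "norm w = 1 \<Longrightarrow> w \<bullet> along_proj w x = 0"
  by (simp add: along_proj_def inner_diff_right norm_eq_1)

lemma along_proj_id: "w \<bullet> x = 0 \<Longrightarrow> along_proj w x = x"
  by (simp add: along_proj_def)

lemma along_proj_inner: "w \<bullet> y = 0 \<Longrightarrow> y \<bullet> along_proj w x = y \<bullet> x" "w \<bullet> y = 0 \<Longrightarrow> along_proj w x \<bullet> y = x \<bullet> y"
  by (simp_all add: along_proj_def inner_diff_right inner_diff_left inner_commute)

lemma orth_projection_eq_image:
  assumes w: "norm w = 1"
  shows "orth_projection ({w}\<^sup>\<bottom>) K = along_proj w ` K"
proof (intro equalityI subsetI)
  fix p assume "p \<in> orth_projection ({w}\<^sup>\<bottom>) K"
  then obtain x where x: "w \<bullet> p = 0" "x \<in> K" "x - p \<in> {w}\<^sup>\<bottom>\<^sup>\<bottom>"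
    by (auto simp: orth_projection_def mem_orthogonal_comp_singleton)
  then have "x - p = (w \<bullet> x) *\<^sub>R w"
    using mem_orthogonal_comp2_singleton[OF w, of "x - p"] by (simp add: inner_diff_right)
  then have "p = along_proj w x" by (simp add: along_proj_def algebra_simps)
  then show "p \<in> along_proj w ` K" using x(2) by blast
next
  fix p assume "p \<in> along_proj w ` K"
  then obtain x where x: "x \<in> K" "p = along_proj w x" by auto
  have "x - p \<in> {w}\<^sup>\<bottom>\<^sup>\<bottom>"
    using w by (simp add: mem_orthogonal_comp2_singleton x(2) along_proj_def norm_eq_1)
  then show "p \<in> orth_projection ({w}\<^sup>\<bottom>) K"
    using x w along_proj_orthogonal by (auto simp: orth_projection_def mem_orthogonal_comp_singleton)
qed

text \<open>The complement of the hyperplane is the line of \<open>w\<close>, so fixing it pointwise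
  means fixing \<open>w\<close>; the hyperplane is then preserved because inner products
  are.\<close>

lemma orthogonal_group_on_hyperplane:
  assumes w: "norm w = 1"
  shows "\<phi> \<in> orthogonal_group_on ({w}\<^sup>\<bottom>) \<longleftrightarrow> orthogonal_transformation \<phi> \<and> \<phi> w = w"
proof
  assume "\<phi> \<in> orthogonal_group_on ({w}\<^sup>\<bottom>)"
  then show "orthogonal_transformation \<phi> \<and> \<phi> w = w"
    using w by (auto simp: orthogonal_group_on_def mem_orthogonal_comp2_singleton norm_eq_1)
next
  assume \<phi>: "orthogonal_transformation \<phi> \<and> \<phi> w = w"
  then have inn: "\<phi> x \<bullet> \<phi> y = x \<bullet> y" for x y by (simp add: orthogonal_transformation_def)
  have fixed: "\<phi> x = x" if "x = (w \<bullet> x) *\<^sub>R w" for x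
    using that \<phi> by (metis orthogonal_transformation_scaleR)
  have "\<phi> ` ({w}\<^sup>\<bottom>) = {w}\<^sup>\<bottom>"
  proof (intro equalityI subsetI)
    fix y assume "y \<in> \<phi> ` ({w}\<^sup>\<bottom>)"
    then show "y \<in> {w}\<^sup>\<bottom>" using inn[of w] \<phi> by (auto simp: mem_orthogonal_comp_singleton)
  next
    fix y assume y: "y \<in> {w}\<^sup>\<bottom>"
    obtain x where "y = \<phi> x" using \<phi> orthogonal_transformation_surj by (metis surjD)
    then show "y \<in> \<phi> ` ({w}\<^sup>\<bottom>)" using y inn[of w x] \<phi> by (auto simp: mem_orthogonal_comp_singleton)
  qed
  then show "\<phi> \<in> orthogonal_group_on ({w}\<^sup>\<bottom>)"
    using \<phi> fixed w by (simp add: orthogonal_group_on_def mem_orthogonal_comp2_singleton)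
qed

text \<open>For \<open>y\<close> orthogonal to \<open>w\<close> a body and its projection have the
  same support value, so the congruence becomes an identity of support functions. The pointwise form
  is kept as well, for lifting diameters.\<close>

lemma directly_congruent_hyperplane:
  fixes K L :: "(real^'n) set"
  assumes w: "norm w = 1" and K: "compact K" "K \<noteq> {}" and L: "compact L" "L \<noteq> {}"
    and dc: "directly_congruent_on ({w}\<^sup>\<bottom>) (orth_projection ({w}\<^sup>\<bottom>) K) (orth_projection ({w}\<^sup>\<bottom>) L)"
  obtains \<phi> a where "orthogonal_transformation \<phi>" "\<phi> w = w" "det (matrix \<phi>) = 1" "w \<bullet> a = 0"
    "\<And>k. k \<in> K \<Longrightarrow> \<exists>l\<in>L. \<phi> (along_proj w k) = along_proj w l + a"
    "\<And>y. w \<bullet> y = 0 \<Longrightarrow> support_fun K y = support_fun L (\<phi> y) + a \<bullet> \<phi> y"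
proof -
  obtain \<phi> a where \<phi>: "orthogonal_transformation \<phi>" "\<phi> w = w" "det (matrix \<phi>) = 1" and a: "w \<bullet> a = 0"
    and im: "\<phi> ` along_proj w ` K = (\<lambda>x. x + a) ` along_proj w ` L"
    using dc w orthogonal_group_on_hyperplane[OF w]
    by (auto simp: directly_congruent_on_def special_orthogonal_group_on_def orth_projection_eq_image
        mem_orthogonal_comp_singleton)
  have inn: "\<phi> x \<bullet> \<phi> y = x \<bullet> y" for x y using \<phi>(1) by (simp add: orthogonal_transformation_def)
  have KL: "\<exists>l\<in>L. \<phi> (along_proj w k) = along_proj w l + a" if "k \<in> K" for k using im that by blast
  have LK: "\<exists>k\<in>K. \<phi> (along_proj w k) = along_proj w l + a" if "l \<in> L" for l
  proof -
    have "along_proj w l + a \<in> \<phi> ` along_proj w ` K" unfolding im using that by blast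
    then show ?thesis by auto
  qed
  have "support_fun K y = support_fun L (\<phi> y) + a \<bullet> \<phi> y" if y: "w \<bullet> y = 0" for y
  proof (rule antisym)
    have \<phi>y: "w \<bullet> \<phi> y = 0" using inn[of w y] y \<phi>(2) by simp
    have eq: "y \<bullet> k = \<phi> y \<bullet> l + a \<bullet> \<phi> y" if "\<phi> (along_proj w k) = along_proj w l + a" for k l
    proof -
      have "y \<bullet> k = \<phi> y \<bullet> \<phi> (along_proj w k)" using y by (simp add: inn along_proj_inner)
      also have "\<dots> = \<phi> y \<bullet> l + a \<bullet> \<phi> y" unfolding that using \<phi>y by (simp add: inner_add_right along_proj_inner inner_commute)
      finally show ?thesis .
    qed
    show "support_fun K y \<le> support_fun L (\<phi> y) + a \<bullet> \<phi> y"
    proof (rule support_fun_le[OF K])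
      fix k assume "k \<in> K"
      then obtain l where "l \<in> L" "y \<bullet> k = \<phi> y \<bullet> l + a \<bullet> \<phi> y" using KL eq by metis
      then show "y \<bullet> k \<le> support_fun L (\<phi> y) + a \<bullet> \<phi> y" using support_fun_ge[OF L] by simp
    qed
    have "support_fun L (\<phi> y) \<le> support_fun K y - a \<bullet> \<phi> y"
    proof (rule support_fun_le[OF L])
      fix l assume "l \<in> L"
      then obtain k where "k \<in> K" "y \<bullet> k = \<phi> y \<bullet> l + a \<bullet> \<phi> y" using LK eq by metis
      then show "\<phi> y \<bullet> l \<le> support_fun K y - a \<bullet> \<phi> y" using support_fun_ge[OF K, of k y] by simp
    qed
    then show "support_fun L (\<phi> y) + a \<bullet> \<phi> y \<le> support_fun K y" by simp
  qed
  then show ?thesis using that \<phi> a KL by blast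
qed

lemma exists_unit_orthogonal_pair:
  fixes x y :: "real^4"
  obtains w where "norm w = 1" "w \<bullet> x = 0" "w \<bullet> y = 0"
proof -
  have "dim {x, y} \<le> card {x, y}" by (rule dim_le_card') simp
  also have "\<dots> \<le> 2" by (simp add: card_insert_if)
  finally have "dim {x, y} < DIM(real^4)" by simp
  then obtain v where v: "v \<noteq> 0" "\<And>z. z \<in> span {x, y} \<Longrightarrow> orthogonal v z"
    using orthogonal_to_subspace_exists by metis
  then have "v \<bullet> x = 0" "v \<bullet> y = 0" by (auto simp: orthogonal_def span_base)
  then show ?thesis using that[of "v /\<^sub>R norm v"] v(1) by simp
qed

text \<open>In dimension 4 every direction shares with \<zeta> a hyperplane orthogonal to some
  \<open>w\<close>; there each width of \<open>L\<close> is a width of \<open>K\<close>, and the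
  maximum of \<open>K\<close>, taken at \<zeta>, occurs for \<open>L\<close> too.\<close>

lemma max_width_transfer:
  fixes K L :: "(real^4) set"
  assumes K: "compact K" "K \<noteq> {}" and L: "compact L" "L \<noteq> {}"
    and \<zeta>: "norm \<zeta> = 1" and max: "width_fun K \<zeta> = max_width K"
    and rel: "\<And>w. norm w = 1 \<Longrightarrow> w \<bullet> \<zeta> = 0 \<Longrightarrow> \<exists>\<phi>. orthogonal_transformation \<phi> \<and> \<phi> w = w \<and>
       (\<forall>y. w \<bullet> y = 0 \<longrightarrow> width_fun K y = width_fun L (\<phi> y))"
  shows "max_width L = max_width K"
proof -
  obtain w0 where w0: "norm w0 = 1" "w0 \<bullet> \<zeta> = 0" using exists_unit_orthogonal_pair by metis
  obtain \<phi>0 where \<phi>0: "orthogonal_transformation \<phi>0" "\<And>y. w0 \<bullet> y = 0 \<Longrightarrow> width_fun K y = width_fun L (\<phi>0 y)"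
    using rel[OF w0] by blast
  have e: "width_fun L (\<phi>0 \<zeta>) = max_width K" using \<phi>0(2) w0 max by simp
  have "max_width L = width_fun L (\<phi>0 \<zeta>)"
  proof (rule max_width_eqI[OF L])
    show "norm (\<phi>0 \<zeta>) = 1" using \<phi>0(1) \<zeta> by (simp add: orthogonal_transformation_norm)
    fix \<theta> :: "real^4" assume \<theta>: "norm \<theta> = 1"
    obtain w where w: "norm w = 1" "w \<bullet> \<zeta> = 0" "w \<bullet> \<theta> = 0" using exists_unit_orthogonal_pair by metis
    obtain \<phi> where \<phi>: "orthogonal_transformation \<phi>" "\<phi> w = w" "\<And>y. w \<bullet> y = 0 \<Longrightarrow> width_fun K y = width_fun L (\<phi> y)"
      using rel[OF w(1,2)] by blast
    obtain y where y: "\<theta> = \<phi> y" using orthogonal_transformation_surj[OF \<phi>(1)] by (metis surjD)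
    have "w \<bullet> y = \<phi> w \<bullet> \<phi> y" using \<phi>(1) by (simp add: orthogonal_transformation_def)
    then have "w \<bullet> y = 0" using y w(3) \<phi>(2) by simp
    then have "width_fun L \<theta> = width_fun K y" using \<phi>(3) y by simp
    also have "\<dots> \<le> max_width K"
      using \<theta> y orthogonal_transformation_norm[OF \<phi>(1)] by (intro width_fun_le_max[OF K]) simp
    finally show "width_fun L \<theta> \<le> width_fun L (\<phi>0 \<zeta>)" by (simp add: e)
  qed
  then show ?thesis using e by simp
qed

text \<open>The images of the \<open>\<zeta>\<close>-diameter of \<open>K\<close> lift to a diameter of \<open>L\<close> parallel to \<open>\<zeta>\<close>, which is unique;
  this pins down the translation \<open>a\<close>.\<close>

lemma centered_support_transfer:
  fixes K L :: "'a::euclidean_space set"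
  assumes L: "compact L" "L \<noteq> {}" and w: "norm w = 1" and \<zeta>: "norm \<zeta> = 1" "w \<bullet> \<zeta> = 0"
    and \<phi>: "orthogonal_transformation \<phi>" "\<phi> w = w" "\<phi> \<zeta> = \<zeta> \<or> \<phi> \<zeta> = - \<zeta>" and a: "w \<bullet> a = 0"
    and KL: "\<And>k. k \<in> K \<Longrightarrow> \<exists>l\<in>L. \<phi> (along_proj w k) = along_proj w l + a"
    and supp: "\<And>y. w \<bullet> y = 0 \<Longrightarrow> support_fun K y = support_fun L (\<phi> y) + a \<bullet> \<phi> y"
    and cK: "cK + (max_width L / 2) *\<^sub>R \<zeta> \<in> K" "cK - (max_width L / 2) *\<^sub>R \<zeta> \<in> K"
    and cL: "cL + (max_width L / 2) *\<^sub>R \<zeta> \<in> L" "cL - (max_width L / 2) *\<^sub>R \<zeta> \<in> L"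
    and y: "w \<bullet> y = 0"
  shows "support_fun K y - cK \<bullet> y = support_fun L (\<phi> y) - cL \<bullet> \<phi> y"
proof -
  let ?D = "max_width L" and ?P = "along_proj w"
  have inn: "\<phi> x \<bullet> \<phi> y = x \<bullet> y" and lin: "linear \<phi>" for x y using \<phi>(1) by (simp_all add: orthogonal_transformation_def)
  note simps = linear_add[OF lin] linear_diff[OF lin] linear_scale[OF lin]
    linear_add[OF linear_along_proj] linear_diff[OF linear_along_proj] linear_scale[OF linear_along_proj]
  have P\<zeta>: "?P \<zeta> = \<zeta>" using \<zeta>(2) by (rule along_proj_id)
  obtain l where l: "l \<in> L" "\<phi> (?P (cK + (?D / 2) *\<^sub>R \<zeta>)) = ?P l + a" using KL[OF cK(1)] by blast
  obtain l' where l': "l' \<in> L" "\<phi> (?P (cK - (?D / 2) *\<^sub>R \<zeta>)) = ?P l' + a" using KL[OF cK(2)] by blast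
  have "?P (l - l') = \<phi> (?P (cK + (?D / 2) *\<^sub>R \<zeta>)) - \<phi> (?P (cK - (?D / 2) *\<^sub>R \<zeta>))"
    unfolding l(2) l'(2) by (simp add: simps)
  also have "\<dots> = ?D *\<^sub>R \<phi> \<zeta>" by (simp add: simps P\<zeta> flip: scaleR_add_left)
  finally have d: "?P (l - l') = ?D *\<^sub>R \<phi> \<zeta>" .
  have sum: "2 *\<^sub>R \<phi> (?P cK) = ?P (l + l') + 2 *\<^sub>R a"
  proof -
    have "?P (l + l') + 2 *\<^sub>R a = \<phi> (?P (cK + (?D / 2) *\<^sub>R \<zeta>)) + \<phi> (?P (cK - (?D / 2) *\<^sub>R \<zeta>))"
      unfolding l(2) l'(2) by (simp add: simps scaleR_2)
    also have "\<dots> = 2 *\<^sub>R \<phi> (?P cK)" by (simp add: simps scaleR_2)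
    finally show ?thesis ..
  qed
  have n\<phi>: "norm (\<phi> \<zeta>) = 1" using \<phi>(1) \<zeta>(1) by (simp add: orthogonal_transformation_norm)
  \<comment> \<open>The projection of \<open>l - l'\<close> already has length \<open>?D\<close>,
    and no two points of \<open>L\<close> are further apart; so \<open>l - l'\<close> has no
    component along \<open>w\<close>.\<close>
  have "norm (l - l') \<le> ?D" using dist_le_max_width[OF L l(1) l'(1)] .
  then have le: "(norm (l - l'))\<^sup>2 \<le> ?D\<^sup>2" by (simp add: power_mono)
  have "(norm (?P (l - l')))\<^sup>2 = (norm (l - l'))\<^sup>2 - (w \<bullet> (l - l'))\<^sup>2"
    unfolding along_proj_def norm_diff_scaleR_squared[OF w] by (simp add: power2_eq_square)
  moreover have "(norm (?P (l - l')))\<^sup>2 = ?D\<^sup>2" unfolding d using n\<phi> by (simp add: power_mult_distrib)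
  ultimately have "(w \<bullet> (l - l'))\<^sup>2 \<le> 0" using le by simp
  then have "w \<bullet> (l - l') = 0" by simp
  then have ll: "l - l' = ?D *\<^sub>R \<phi> \<zeta>" using d by (simp add: along_proj_id)
  have "l + l' = 2 *\<^sub>R cL"
  proof (cases "\<phi> \<zeta> = \<zeta>")
    case True
    then show ?thesis using diameter_unique[OF L cL l(1) l'(1) _ \<zeta>(1)] ll by simp
  next
    case False
    then have "l' - l = ?D *\<^sub>R \<zeta>" using ll \<phi>(3) by (metis minus_diff_eq scaleR_minus_right minus_minus)
    then show ?thesis using diameter_unique[OF L cL l'(1) l(1) _ \<zeta>(1)] by (simp add: add.commute)
  qed
  then have "2 *\<^sub>R \<phi> (?P cK) = 2 *\<^sub>R (?P cL + a)" using sum by (simp add: simps scaleR_add_right)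
  then have a_eq: "a = \<phi> (?P cK) - ?P cL" by simp
  have \<phi>y: "w \<bullet> \<phi> y = 0" using inn[of w y] y \<phi>(2) by simp
  have "a \<bullet> \<phi> y = cK \<bullet> y - cL \<bullet> \<phi> y"
    unfolding a_eq using y \<phi>y by (simp add: inner_diff_left inn along_proj_inner)
  then show ?thesis using supp[OF y] by simp
qed

section \<open>Determinants and coordinates\<close>

lemma det_4:
  "det (A::'a::comm_ring_1^4^4) =
    A$1$1 * (A$2$2 * (A$3$3 * A$4$4 - A$3$4 * A$4$3) - A$2$3 * (A$3$2 * A$4$4 - A$3$4 * A$4$2) + A$2$4 * (A$3$2 * A$4$3 - A$3$3 * A$4$2))
  - A$1$2 * (A$2$1 * (A$3$3 * A$4$4 - A$3$4 * A$4$3) - A$2$3 * (A$3$1 * A$4$4 - A$3$4 * A$4$1) + A$2$4 * (A$3$1 * A$4$3 - A$3$3 * A$4$1))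
  + A$1$3 * (A$2$1 * (A$3$2 * A$4$4 - A$3$4 * A$4$2) - A$2$2 * (A$3$1 * A$4$4 - A$3$4 * A$4$1) + A$2$4 * (A$3$1 * A$4$2 - A$3$2 * A$4$1))
  - A$1$4 * (A$2$1 * (A$3$2 * A$4$3 - A$3$3 * A$4$2) - A$2$2 * (A$3$1 * A$4$3 - A$3$3 * A$4$1) + A$2$3 * (A$3$1 * A$4$2 - A$3$2 * A$4$1))"
proof -
  have f1234: "finite {2::4, 3, 4}" "1 \<notin> {2::4, 3, 4}" by auto
  have f234: "finite {3::4, 4}" "2 \<notin> {3::4, 4}" by auto
  have f34: "finite {4::4}" "3 \<notin> {4::4}" by auto
  show ?thesis
    unfolding det_def UNIV_4
    unfolding sum_over_permutations_insert[OF f1234]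
    unfolding sum_over_permutations_insert[OF f234]
    unfolding sum_over_permutations_insert[OF f34]
    unfolding permutes_sing
    by (simp add: sign_swap_id permutation_swap_id permutation_compose sign_compose sign_id swap_id_eq algebra_simps)
qed

text \<open>For a unit vector \<open>p\<close>, the reflection in the hyperplane orthogonal to
  \<open>p\<close>; with \<open>p\<close> = \<zeta> its negative is the transformation \<O> of the
  theorem.\<close>

definition reflect :: "'a::real_inner \<Rightarrow> 'a \<Rightarrow> 'a" where
  "reflect p y = y - (2 * (p \<bullet> y)) *\<^sub>R p"

lemma orthogonal_transformation_reflect:
  assumes "norm p = 1"
  shows "orthogonal_transformation (reflect p)"
  unfolding orthogonal_transformation_def
proof (intro conjI allI)
  show "linear (reflect p)" by (auto intro!: linearI simp: reflect_def inner_add_right algebra_simps)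
  show "reflect p v \<bullet> reflect p w = v \<bullet> w" for v w
    using assms by (simp add: reflect_def inner_diff_left inner_diff_right norm_eq_1 inner_commute)
qed

text \<open>An orthogonal map taking a coordinate vector to \<open>p\<close> conjugates the
  reflection to one with a diagonal matrix.\<close>

lemma det_reflect:
  fixes p :: "real^'n"
  assumes p: "norm p = 1"
  shows "det (matrix (reflect p)) = - 1"
proof -
  fix k :: 'n
  let ?e = "axis k 1 :: real^'n"
  obtain U where U: "orthogonal_transformation U" "U ?e = p"
    using orthogonal_transformation_exists_1[of ?e p] p by auto
  have lin: "linear U" "linear (reflect p)" "linear (reflect ?e)"
    using U(1) orthogonal_transformation_reflect[of p] orthogonal_transformation_reflect[of ?e] p
    by (auto intro: orthogonal_transformation_linear)
  have "reflect p \<circ> U = U \<circ> reflect ?e"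
  proof
    fix x
    have "p \<bullet> U x = ?e \<bullet> x" using U by (metis orthogonal_transformation_def)
    then show "(reflect p \<circ> U) x = (U \<circ> reflect ?e) x"
      using U(2) by (simp add: reflect_def linear_diff[OF lin(1)] linear_scale[OF lin(1)])
  qed
  then have "det (matrix (reflect p)) * det (matrix U) = det (matrix U) * det (matrix (reflect ?e))"
    using matrix_compose[OF lin(1,2)] matrix_compose[OF lin(3,1)] by (metis det_mul)
  moreover have "det (matrix U) \<noteq> 0"
    using orthogonal_transformation_det[OF U(1)] by auto
  moreover have "det (matrix (reflect ?e)) = - 1"
  proof -
    have m: "matrix (reflect ?e) $ i $ j = (if i = j then (if i = k then - 1 else 1) else 0)" for i j
      by (simp add: matrix_def reflect_def inner_axis_axis) (simp add: axis_def)
    then have "det (matrix (reflect ?e)) = (\<Prod>i\<in>UNIV. if i = k then - 1 else 1)"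
      by (subst det_diagonal) auto
    then show ?thesis by simp
  qed
  ultimately show ?thesis by (metis mult.commute mult_minus1 mult_right_cancel)
qed

lemma det_negation: "det (matrix (\<lambda>x::real^4. - x)) = 1"
proof -
  have m: "matrix (\<lambda>x::real^4. - x) $ i $ j = (if i = j then - 1 else 0)" for i j
    by (auto simp: matrix_def axis_def)
  then have "det (matrix (\<lambda>x::real^4. - x)) = (\<Prod>i\<in>(UNIV::4 set). - 1)"
    by (subst det_diagonal) auto
  then show ?thesis by simp
qed

text \<open>\<open>T\<close> identifies R^3 with the hyperplane orthogonal to \<zeta>. The last
  clause links the determinant on R^4, by which rotations are recognised, to the determinant of the
  map induced on R^3.\<close>

lemma hyperplane_coordinates:
  fixes \<zeta> :: "real^4"
  assumes \<zeta>: "norm \<zeta> = 1"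
  obtains T :: "real^3 \<Rightarrow> real^4" where "linear T" "\<And>x y. T x \<bullet> T y = x \<bullet> y" "\<And>x. T x \<bullet> \<zeta> = 0"
    "\<And>y. \<exists>x. y = T x + (\<zeta> \<bullet> y) *\<^sub>R \<zeta>"
    "\<And>\<phi> N \<epsilon>. orthogonal_transformation \<phi> \<Longrightarrow> \<phi> \<zeta> = \<epsilon> *\<^sub>R \<zeta> \<Longrightarrow> (\<And>x. \<phi> (T x) = T (N x))
        \<Longrightarrow> det (matrix \<phi>) = \<epsilon> * det (matrix N)"
proof -
  let ?e = "axis 4 1 :: real^4"
  obtain Q where Q: "orthogonal_transformation Q" "Q ?e = \<zeta>"
    using orthogonal_transformation_exists_1[of ?e \<zeta>] \<zeta> by auto
  have Qi: "Q x \<bullet> Q y = x \<bullet> y" and Ql: "linear Q" for x y using Q(1) by (simp_all add: orthogonal_transformation_def)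
  have Qinj: "inj Q" and Qsurj: "surj Q" using Q(1) orthogonal_transformation_inj orthogonal_transformation_surj by auto
  define J :: "real^3 \<Rightarrow> real^4" where
    "J x = (\<chi> i. if i = 1 then x$1 else if i = 2 then x$2 else if i = 3 then x$3 else 0)" for x
  have J: "J x $ 1 = x $ 1" "J x $ 2 = x $ 2" "J x $ 3 = x $ 3" "J x $ 4 = 0" for x
    by (simp_all add: J_def)
  have Jl: "linear J" by (rule linearI) (simp_all add: vec_eq_iff forall_4 J)
  have Ji: "J x \<bullet> J y = x \<bullet> y" "J x \<bullet> ?e = 0" for x y
    by (simp_all add: inner_vec_def sum_4 sum_3 J axis_def)
  define T where "T x = Q (J x)" for x
  show ?thesis
  proof (rule that[of T])
    show "linear T" using linear_compose[OF Jl Ql] by (simp add: T_def[abs_def] o_def)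
    show "T x \<bullet> T y = x \<bullet> y" for x y by (simp add: T_def Qi Ji)
    show "T x \<bullet> \<zeta> = 0" for x by (simp add: T_def Q(2)[symmetric] Qi Ji)
    show "\<exists>x. y = T x + (\<zeta> \<bullet> y) *\<^sub>R \<zeta>" for y
    proof -
      obtain z where z: "y = Q z" using Qsurj by (metis surjD)
      define x :: "real^3" where "x = (\<chi> i. if i = 1 then z$1 else if i = 2 then z$2 else z$3)"
      have "z = J x + (z $ 4) *\<^sub>R ?e" by (simp add: vec_eq_iff forall_4 J x_def axis_def)
      moreover have "\<zeta> \<bullet> y = z $ 4" by (simp add: z Q(2)[symmetric] Qi inner_axis inner_commute)
      ultimately have "y = T x + (\<zeta> \<bullet> y) *\<^sub>R \<zeta>"
        using z Q(2) by (metis T_def linear_add[OF Ql] linear_scale[OF Ql])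
      then show ?thesis ..
    qed
    fix \<phi> N \<epsilon>
    assume \<phi>: "orthogonal_transformation \<phi>" "\<phi> \<zeta> = \<epsilon> *\<^sub>R \<zeta>" "\<And>x. \<phi> (T x) = T (N x)"
    \<comment> \<open>Conjugation by \<open>Q\<close> moves \<zeta> to the fourth coordinate vector
      and keeps the determinant; the matrix becomes block diagonal with blocks \<open>N\<close> and
      \<epsilon>.\<close>
    define \<psi> where "\<psi> = inv Q \<circ> \<phi> \<circ> Q"
    have \<phi>l: "linear \<phi>" using \<phi>(1) by (rule orthogonal_transformation_linear)
    have Qil: "linear (inv Q)" using orthogonal_transformation_inv[OF Q(1)] by (rule orthogonal_transformation_linear)
    have inv: "inv Q (Q x) = x" for x using Qinj by simp
    have "det (matrix (inv Q)) * det (matrix Q) = 1"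
    proof -
      have "inv Q \<circ> Q = id" using Qinj by simp
      then have "matrix (inv Q) ** matrix Q = mat 1" using matrix_compose[OF Ql Qil] by (metis matrix_id_mat_1)
      then show ?thesis by (metis det_I det_mul)
    qed
    moreover have "det (matrix \<psi>) = det (matrix (inv Q)) * det (matrix \<phi>) * det (matrix Q)"
      unfolding \<psi>_def using Ql \<phi>l Qil by (simp add: matrix_compose linear_compose det_mul)
    ultimately have d: "det (matrix \<psi>) = det (matrix \<phi>)" by simp
    have \<psi>J: "\<psi> (J x) = J (N x)" for x using \<phi>(3)[of x] inv by (simp add: \<psi>_def T_def)
    have \<psi>e: "\<psi> ?e = \<epsilon> *\<^sub>R ?e" using \<phi>(2) inv by (simp add: \<psi>_def Q(2)[symmetric] linear_scale[OF Qil])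
    have ax: "axis 1 1 = J (axis 1 1)" "axis 2 1 = J (axis 2 1)" "axis 3 1 = J (axis 3 1)"
      by (simp_all add: vec_eq_iff forall_4 J axis_def)
    have m4: "matrix \<psi> $ i $ j = \<psi> (axis j 1) $ i" for i j by (simp add: matrix_def)
    have m3: "matrix N $ i $ j = N (axis j 1) $ i" for i j by (simp add: matrix_def)
    have c: "\<psi> ?e $ i = (if i = 4 then \<epsilon> else 0)" for i unfolding \<psi>e by (simp add: axis_def)
    have "det (matrix \<psi>) = \<epsilon> * det (matrix N)"
      unfolding det_4 det_3 m4 m3 c ax \<psi>J J by (simp add: algebra_simps)
    then show "det (matrix \<phi>) = \<epsilon> * det (matrix N)" by (simp add: d)
  qed
qed

section \<open>Symmetries and generic projections\<close>

text \<open>For orthonormal \<open>p\<close>, \<open>q\<close> this is the identity on their span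
  and minus the identity on its complement: the rotation by pi about \<open>q\<close> inside the
  hyperplane orthogonal to \<open>p\<close>.\<close>

definition half_turn :: "real^4 \<Rightarrow> real^4 \<Rightarrow> real^4 \<Rightarrow> real^4" where
  "half_turn p q y = (2 * (p \<bullet> y)) *\<^sub>R p + (2 * (q \<bullet> y)) *\<^sub>R q - y"

lemma half_turn_reflect: "p \<bullet> q = 0 \<Longrightarrow> half_turn p q = (\<lambda>x. - x) \<circ> (reflect p \<circ> reflect q)"
  by (auto simp: half_turn_def reflect_def inner_diff_right algebra_simps)

lemma orthogonal_transformation_half_turn:
  assumes "norm p = 1" "norm q = 1" "p \<bullet> q = 0"
  shows "orthogonal_transformation (half_turn p q)" "det (matrix (half_turn p q)) = 1"
proof -
  have o: "orthogonal_transformation (reflect p)" "orthogonal_transformation (reflect q)"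
    "orthogonal_transformation (\<lambda>x::real^4. - x)"
    using orthogonal_transformation_reflect assms by (simp_all add: orthogonal_transformation_neg)
  then show "orthogonal_transformation (half_turn p q)"
    unfolding half_turn_reflect[OF assms(3)] by (intro orthogonal_transformation_compose)
  show "det (matrix (half_turn p q)) = 1"
    unfolding half_turn_reflect[OF assms(3)] using o assms(1,2)
    by (simp add: matrix_compose linear_compose orthogonal_transformation_linear det_mul det_reflect det_negation)
qed

text \<open>Support functions determine compact convex sets, so an invariance of the support
  function recentred at \<open>c\<close> becomes a symmetry of the projection; \<open>c\<close>
  reappears in the translation \<open>a\<close>.\<close>

lemma half_turn_symmetry:
  fixes L :: "(real^4) set"
  assumes L: "compact L" "L \<noteq> {}" "convex L" and pq: "norm p = 1" "norm q = 1" "p \<bullet> q = 0"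
    and inv: "\<And>y. p \<bullet> y = 0 \<Longrightarrow>
      support_fun L (half_turn p q y) - c \<bullet> half_turn p q y = support_fun L y - c \<bullet> y"
  shows "pi_symmetric_on ({p}\<^sup>\<bottom>) q (orth_projection ({p}\<^sup>\<bottom>) L)"
proof -
  let ?R = "half_turn p q" and ?P = "along_proj p"
  note R = orthogonal_transformation_half_turn[OF pq]
  have lR: "linear ?R" using R(1) by (rule orthogonal_transformation_linear)
  have sym: "y \<bullet> ?R x = ?R y \<bullet> x" for x y
    by (simp add: half_turn_def inner_add_right inner_diff_right inner_add_left inner_diff_left inner_commute)
  have Rp: "?R p = p" "?R q = q" using pq by (simp_all add: half_turn_def norm_eq_1 scaleR_2 inner_commute)
  have RP: "?R (?P x) = ?P (?R x)" for x
    unfolding along_proj_def linear_diff[OF lR] linear_scale[OF lR] Rp sym[of p x] ..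
  have PP: "p \<bullet> ?P y = 0" for y using along_proj_orthogonal[OF pq(1)] .
  define a where "a = ?R (?P c) - ?P c"
  have pa: "p \<bullet> a = 0" unfolding a_def RP by (simp add: inner_diff_right PP)
  have cP: "compact (?P ` L)" "?P ` L \<noteq> {}" "convex (?P ` L)"
    using L linear_along_proj[of p]
    by (auto intro!: compact_continuous_image linear_continuous_on convex_linear_image simp: linear_conv_bounded_linear)
  have "?R ` ?P ` L = (\<lambda>x. x + a) ` ?P ` L"
  proof (rule support_fun_eqD)
    show "compact (?R ` ?P ` L)" "convex (?R ` ?P ` L)" "?R ` ?P ` L \<noteq> {}"
      using cP lR by (auto intro!: compact_continuous_image linear_continuous_on convex_linear_image simp: linear_conv_bounded_linear)
    show "compact ((\<lambda>x. x + a) ` ?P ` L)" "(\<lambda>x. x + a) ` ?P ` L \<noteq> {}" "convex ((\<lambda>x. x + a) ` ?P ` L)"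
      using cP convex_translation[of "?P ` L" a]
      by (auto intro!: compact_continuous_image continuous_intros simp: add.commute)
    fix y
    have "support_fun (?R ` ?P ` L) y = support_fun L (?P (?R y))"
      using support_fun_linear_image[OF cP(1,2) lR sym] support_fun_linear_image[OF L(1,2) linear_along_proj along_proj_adj] by simp
    also have "\<dots> = support_fun L (?R (?P y))" by (simp add: RP)
    also have "\<dots> = support_fun L (?P y) - c \<bullet> ?P y + c \<bullet> ?R (?P y)" using inv[OF PP[of y]] by simp
    also have "c \<bullet> ?R (?P y) = ?R (?P c) \<bullet> y" by (simp only: sym RP along_proj_adj)
    also have "c \<bullet> ?P y = ?P c \<bullet> y" by (rule along_proj_adj)
    also have "support_fun L (?P y) - ?P c \<bullet> y + ?R (?P c) \<bullet> y = support_fun ((\<lambda>x. x + a) ` ?P ` L) y"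
      unfolding support_fun_translate[OF cP(1,2)] support_fun_linear_image[OF L(1,2) linear_along_proj along_proj_adj]
      by (simp add: a_def inner_diff_right inner_commute)
    finally show "support_fun (?R ` ?P ` L) y = support_fun ((\<lambda>x. x + a) ` ?P ` L) y" .
  qed
  moreover have "?R \<in> special_orthogonal_group_on ({p}\<^sup>\<bottom>)"
    using R Rp(1) by (simp add: special_orthogonal_group_on_def orthogonal_group_on_hyperplane[OF pq(1)])
  moreover have "?R x = - x" if "x \<in> {p}\<^sup>\<bottom> \<inter> {q}\<^sup>\<bottom>" for x
    using that by (simp add: mem_orthogonal_comp_singleton half_turn_def)
  moreover have "a \<in> {p}\<^sup>\<bottom>" using pa by (simp add: mem_orthogonal_comp_singleton)
  ultimately show ?thesis
    using Rp(2) unfolding pi_symmetric_on_def orth_projection_eq_image[OF pq(1)] by blast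
qed

text \<open>\<open>N\<close> commutes with the quarter turn \<open>cross3 v\<close> up to the sign
  \<open>det (matrix N)\<close>, so the image of one unit vector \<open>e\<close> decides its action
  on the plane.\<close>

lemma orthogonal_transformation_fixing_axis:
  fixes N :: "real^3 \<Rightarrow> real^3"
  assumes N: "orthogonal_transformation N" "N v = v" and v: "norm v = 1"
  shows "det (matrix N) = 1 \<Longrightarrow> \<exists>a. 0 \<le> a \<and> a \<le> 2 * pi \<and> (\<forall>x. x \<bullet> v = 0 \<longrightarrow> N x = rot v a x)"
    and "det (matrix N) = - 1 \<Longrightarrow> \<exists>u. norm u = 1 \<and> u \<bullet> v = 0 \<and> (\<forall>x. x \<bullet> v = 0 \<longrightarrow> N x = flip u x)"
proof -
  have l: "linear N" using N(1) by (rule orthogonal_transformation_linear)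
  have cr: "N (cross3 v x) = det (matrix N) *\<^sub>R cross3 v (N x)" if "det (matrix N) = 1 \<or> det (matrix N) = - 1" for x
  proof -
    have "cross3 v (N x) = det (matrix N) *\<^sub>R N (cross3 v x)"
      using cross_orthogonal_transformation[OF N(1), of v x] N(2) by simp
    then show ?thesis using that by auto
  qed
  obtain e where e: "norm e = 1" "e \<bullet> v = 0" using exists_orthogonal_unit .
  have "N e \<bullet> N v = 0" using N(1) e(2) by (simp add: orthogonal_transformation_def)
  then have Ne: "N e \<bullet> v = 0" "norm e = norm (N e)"
    using N e by (simp_all add: orthogonal_transformation_norm)
  obtain a where a: "0 \<le> a" "a < 2 * pi" "N e = rot v a e" using rot_transitive[OF v e(2) Ne] .
  note simps = linear_add[OF l] linear_scale[OF l]
  have ext: "\<forall>x. x \<bullet> v = 0 \<longrightarrow> N x = M x"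
    if "\<And>b. N (rot v b e) = M (rot v b e)" "\<And>c x. M (c *\<^sub>R x) = c *\<^sub>R M x" for M
    using that plane_polar[OF v e] by (metis linear_scale[OF l])
  {
    assume d: "det (matrix N) = 1"
    have "N (rot v b e) = rot v a (rot v b e)" for b
    proof -
      have "N (rot v b e) = rot v b (N e)" using cr d by (simp add: rot_def simps)
      then show ?thesis by (simp add: a(3) rot_rot[OF v e(2)] add.commute)
    qed
    then have "\<forall>x. x \<bullet> v = 0 \<longrightarrow> N x = rot v a x" by (intro ext) (simp_all add: rot_scaleR)
    then show "\<exists>a. 0 \<le> a \<and> a \<le> 2 * pi \<and> (\<forall>x. x \<bullet> v = 0 \<longrightarrow> N x = rot v a x)" using a by (intro exI[of _ a]) auto
  next
    assume d: "det (matrix N) = - 1"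
    \<comment> \<open>The polar angle \<open>b\<close> goes to \<open>a - b\<close>, so the axis of
      the reflection lies at a / 2.\<close>
    have "N (rot v b e) = flip (rot v (a / 2) e) (rot v b e)" for b
    proof -
      have "N (rot v b e) = rot v (- b) (N e)" using cr d by (simp add: rot_def simps)
      then show ?thesis by (simp add: a(3) rot_rot[OF v e(2)] flip_rot[OF v e])
    qed
    then have "\<forall>x. x \<bullet> v = 0 \<longrightarrow> N x = flip (rot v (a / 2) e) x" by (intro ext) (simp_all add: flip_scaleR)
    then show "\<exists>u. norm u = 1 \<and> u \<bullet> v = 0 \<and> (\<forall>x. x \<bullet> v = 0 \<longrightarrow> N x = flip u x)"
      using norm_rot[OF v e(2)] rot_orthogonal[OF e(2)] e(1) by (intro exI[of _ "rot v (a / 2) e"]) auto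
  }
qed

text \<open>The curve \<open>c\<close> through \<open>v\<close> has linearly independent
  coefficients, so it meets each plane with normal in \<open>S\<close> at finitely many parameters
  only; countably many planes leave arbitrarily small parameters free.\<close>

lemma dense_off_countable_great_circles:
  fixes S :: "(real^3) set"
  assumes S: "countable S" "0 \<notin> S"
  shows "sphere 0 1 \<subseteq> closure {v. norm v = 1 \<and> (\<forall>n\<in>S. v \<bullet> n \<noteq> 0)}"
proof
  fix v :: "real^3" assume "v \<in> sphere 0 1"
  then have v: "norm v = 1" by simp
  obtain a where a: "norm a = 1" "a \<bullet> v = 0" using exists_orthogonal_unit .
  define c where "c t = v + t *\<^sub>R a + t\<^sup>2 *\<^sub>R cross3 v a" for t
  let ?G = "{v. norm v = 1 \<and> (\<forall>n\<in>S. v \<bullet> n \<noteq> 0)}"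
  have fin: "finite {t. c t \<bullet> n = 0}" if "n \<in> S" for n
  proof -
    have "[:v \<bullet> n, a \<bullet> n, cross3 v a \<bullet> n:] \<noteq> 0"
    proof
      assume "[:v \<bullet> n, a \<bullet> n, cross3 v a \<bullet> n:] = 0"
      then have "n \<bullet> v = 0" "n \<bullet> a = 0" "n \<bullet> cross3 v a = 0" by (simp_all add: inner_commute)
      then have "n = 0" using plane_expand[OF v a] by (metis scaleR_zero_left add.right_neutral)
      then show False using S(2) that by simp
    qed
    then have "finite {t. poly [:v \<bullet> n, a \<bullet> n, cross3 v a \<bullet> n:] t = 0}" by (rule poly_roots_finite)
    moreover have "poly [:v \<bullet> n, a \<bullet> n, cross3 v a \<bullet> n:] t = c t \<bullet> n" for t
      by (simp add: c_def inner_add_left power2_eq_square algebra_simps)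
    ultimately show ?thesis by simp
  qed
  have "\<exists>t. 0 < t \<and> t < inverse (real (Suc m)) \<and> (\<forall>n\<in>S. c t \<bullet> n \<noteq> 0)" for m
  proof -
    have "countable (\<Union>n\<in>S. {t. c t \<bullet> n = 0})"
      by (rule countable_UN[OF S(1)]) (rule countable_finite[OF fin])
    moreover have "uncountable {0<..<inverse (real (Suc m))}" by (simp add: uncountable_open_interval)
    ultimately have "\<not> {0<..<inverse (real (Suc m))} \<subseteq> (\<Union>n\<in>S. {t. c t \<bullet> n = 0})"
      using countable_subset by blast
    then show ?thesis by auto
  qed
  then obtain t where t: "\<And>m. 0 < t m" "\<And>m. t m < inverse (real (Suc m))" "\<And>m n. n \<in> S \<Longrightarrow> c (t m) \<bullet> n \<noteq> 0"
    by metis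
  have "t \<longlonglongrightarrow> 0"
  proof (rule tendsto_sandwich[OF _ _ tendsto_const LIMSEQ_inverse_real_of_nat])
    show "\<forall>\<^sub>F m in sequentially. 0 \<le> t m"
      by (intro always_eventually allI less_imp_le t(1))
    show "\<forall>\<^sub>F m in sequentially. t m \<le> inverse (real (Suc m))"
      by (intro always_eventually allI less_imp_le t(2))
  qed
  then have "(\<lambda>m. c (t m)) \<longlonglongrightarrow> v + 0 *\<^sub>R a + 0\<^sup>2 *\<^sub>R cross3 v a"
    unfolding c_def by (intro tendsto_intros)
  then have "(\<lambda>m. c (t m)) \<longlonglongrightarrow> v" by simp
  then have lim: "(\<lambda>m. c (t m) /\<^sub>R norm (c (t m))) \<longlonglongrightarrow> v /\<^sub>R norm v"
    using v by (intro tendsto_intros) auto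
  have nz: "c s \<noteq> 0" for s
  proof
    assume "c s = 0"
    moreover have "c s \<bullet> v = 1" using a v by (simp add: c_def inner_add_left norm_eq_1)
    ultimately show False by simp
  qed
  have "c (t m) /\<^sub>R norm (c (t m)) \<in> ?G" for m
    using nz[of "t m"] t(3) by auto
  then show "v \<in> closure ?G" using lim v unfolding closure_sequential
    by (intro exI[of _ "\<lambda>m. c (t m) /\<^sub>R norm (c (t m))"]) auto
qed

section \<open>Reduction of the geometric problem to functions on great circles\<close>

lemma unit_not_parallel:
  assumes "norm \<zeta> = 1" "norm \<theta> = 1" "\<theta> = t *\<^sub>R \<zeta>"
  shows "\<theta> = \<zeta> \<or> \<theta> = - \<zeta>"
proof -
  have "\<bar>t\<bar> = 1" using assms by simp
  then have "t = 1 \<or> t = - 1" by linarith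
  then show ?thesis using assms(3) by auto
qed

proposition support_fun_dichotomy:
  fixes K L :: "(real^4) set"
  assumes K: "compact K" "K \<noteq> {}" "convex K" and L: "compact L" "L \<noteq> {}" "convex L"
    and count: "countably_many_diameters K" "countably_many_diameters L"
    and \<zeta>: "norm \<zeta> = 1" and diam: "has_diameter_parallel K \<zeta>"
    and cong: "\<And>w. norm w = 1 \<Longrightarrow> w \<bullet> \<zeta> = 0 \<Longrightarrow>
      directly_congruent_on ({w}\<^sup>\<bottom>) (orth_projection ({w}\<^sup>\<bottom>) K) (orth_projection ({w}\<^sup>\<bottom>) L)"
    and nosym\<zeta>: "\<And>w. norm w = 1 \<Longrightarrow> w \<bullet> \<zeta> = 0 \<Longrightarrow> \<not> pi_symmetric_on ({w}\<^sup>\<bottom>) \<zeta> (orth_projection ({w}\<^sup>\<bottom>) L)"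
    and nosym: "\<And>w u. norm w = 1 \<Longrightarrow> w \<bullet> \<zeta> = 0 \<Longrightarrow> norm u = 1 \<Longrightarrow> u \<bullet> \<zeta> = 0 \<Longrightarrow> u \<bullet> w = 0 \<Longrightarrow>
      \<not> pi_symmetric_on ({w}\<^sup>\<bottom>) u (orth_projection ({w}\<^sup>\<bottom>) L)"
  obtains cK cL where
    "(\<forall>y. support_fun L y - cL \<bullet> y = support_fun K y - cK \<bullet> y) \<or>
     (\<forall>y. support_fun L (- reflect \<zeta> y) - cL \<bullet> (- reflect \<zeta> y) = support_fun K y - cK \<bullet> y)"
proof -
  have max: "width_fun K \<zeta> = max_width K" using width_of_diameter_parallel[OF K(1,2) diam \<zeta>] .
  have cong': "\<exists>\<phi> a. orthogonal_transformation \<phi> \<and> \<phi> w = w \<and> det (matrix \<phi>) = 1 \<and> w \<bullet> a = 0 \<and>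
      (\<forall>k\<in>K. \<exists>l\<in>L. \<phi> (along_proj w k) = along_proj w l + a) \<and>
      (\<forall>y. w \<bullet> y = 0 \<longrightarrow> support_fun K y = support_fun L (\<phi> y) + a \<bullet> \<phi> y)"
    if "norm w = 1" "w \<bullet> \<zeta> = 0" for w
    using directly_congruent_hyperplane[OF that(1) K(1,2) L(1,2) cong[OF that]] by metis
  have width: "width_fun K y = width_fun L (\<phi> y)"
    if "orthogonal_transformation \<phi>" "\<And>y. w \<bullet> y = 0 \<Longrightarrow> support_fun K y = support_fun L (\<phi> y) + a \<bullet> \<phi> y" "w \<bullet> y = 0"
    for \<phi> a w y
    using that(2)[of y] that(2)[of "- y"] that(3) linear_neg[OF orthogonal_transformation_linear[OF that(1)]]
    by (simp add: width_fun_def)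
  have D: "max_width L = max_width K"
    by (rule max_width_transfer[OF K(1,2) L(1,2) \<zeta> max]) (use cong' width in metis)
  \<comment> \<open>The diameter directions of \<open>K\<close> and \<open>L\<close> other than
    \<zeta> and - \<zeta>, which a generic hyperplane has to avoid.\<close>
  define C where "C = ({\<theta> \<in> sphere 0 1. width_fun K \<theta> = max_width K} \<union> {\<theta> \<in> sphere 0 1. width_fun L \<theta> = max_width L}) - {\<zeta>, - \<zeta>}"
  have Ccount: "countable C"
    using count by (simp add: C_def countably_many_diameters_def)
  obtain T :: "real^3 \<Rightarrow> real^4" where T: "linear T" "\<And>x y. T x \<bullet> T y = x \<bullet> y" "\<And>x. T x \<bullet> \<zeta> = 0"
    "\<And>y. \<exists>x. y = T x + (\<zeta> \<bullet> y) *\<^sub>R \<zeta>"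
    and Tdet: "\<And>\<phi> N \<epsilon>. orthogonal_transformation \<phi> \<Longrightarrow> \<phi> \<zeta> = \<epsilon> *\<^sub>R \<zeta> \<Longrightarrow> (\<And>x. \<phi> (T x) = T (N x))
        \<Longrightarrow> det (matrix \<phi>) = \<epsilon> * det (matrix N)"
    using hyperplane_coordinates[OF \<zeta>] by metis
  have T': "\<zeta> \<bullet> T x = 0" for x using T(3) by (simp add: inner_commute)
  have Tn: "norm (T x) = norm x" for x using T(2) by (simp add: norm_eq_sqrt_inner)
  have Tinj: "x = y" if "T x = T y" for x y
  proof -
    have "norm (x - y) = norm (T x - T y)" by (metis Tn linear_diff[OF T(1)])
    then show ?thesis using that by simp
  qed
  have coord: "\<exists>x. y = T x + s *\<^sub>R \<zeta>" if "\<zeta> \<bullet> y = s" for y s using T(4) that by blast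
  \<comment> \<open>The component of \<theta> orthogonal to \<zeta>, in coordinates: \<theta> is
    orthogonal to \<open>T v\<close> exactly if \<open>v \<bullet> n \<theta> = 0\<close>, so each
    direction in \<open>C\<close> rules out one great circle.\<close>
  define n where "n \<theta> = (SOME x. \<theta> = T x + (\<zeta> \<bullet> \<theta>) *\<^sub>R \<zeta>)" for \<theta>
  have n: "\<theta> = T (n \<theta>) + (\<zeta> \<bullet> \<theta>) *\<^sub>R \<zeta>" for \<theta> unfolding n_def by (rule someI_ex[OF T(4)])
  define G where "G = {v. norm v = 1 \<and> (\<forall>x\<in>n ` C. v \<bullet> x \<noteq> 0)}"
  have dense: "sphere 0 1 \<subseteq> closure G"
    unfolding G_def
  proof (rule dense_off_countable_great_circles)
    show "countable (n ` C)" using Ccount by simp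
    show "0 \<notin> n ` C"
    proof
      assume "0 \<in> n ` C"
      then obtain \<theta> where \<theta>: "\<theta> \<in> C" "n \<theta> = 0" by force
      then have "\<theta> = (\<zeta> \<bullet> \<theta>) *\<^sub>R \<zeta>" using n[of \<theta>] linear_0[OF T(1)] by simp
      then have "\<theta> = \<zeta> \<or> \<theta> = - \<zeta>" using \<zeta> \<theta>(1) by (intro unit_not_parallel) (auto simp: C_def)
      then show False using \<theta>(1) by (auto simp: C_def)
    qed
  qed
  have generic: "\<theta> = \<zeta> \<or> \<theta> = - \<zeta>" if v: "v \<in> G" and \<theta>: "norm \<theta> = 1" "width_fun L \<theta> = max_width L" "T v \<bullet> \<theta> = 0" for v \<theta>
  proof (rule ccontr)
    assume "\<not> ?thesis"
    then have "\<theta> \<in> C" using \<theta> by (simp add: C_def)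
    then have "v \<bullet> n \<theta> \<noteq> 0" using v by (auto simp: G_def)
    moreover have "T v \<bullet> \<theta> = v \<bullet> n \<theta>" by (subst n) (simp add: inner_add_right T)
    ultimately show False using \<theta>(3) by simp
  qed
  have \<phi>\<zeta>: "(\<phi> \<zeta> = \<zeta> \<or> \<phi> \<zeta> = - \<zeta>) \<and> width_fun L (\<phi> \<zeta>) = max_width L"
    if "v \<in> G" "orthogonal_transformation \<phi>" "\<phi> (T v) = T v"
      "\<And>y. T v \<bullet> y = 0 \<Longrightarrow> support_fun K y = support_fun L (\<phi> y) + a \<bullet> \<phi> y" for v \<phi> a
  proof -
    have "width_fun L (\<phi> \<zeta>) = max_width L" using width[where w = "T v" and y = \<zeta>, OF that(2,4)] T(3) max D by simp
    moreover have "T v \<bullet> \<phi> \<zeta> = 0" using that(2,3) T(3) by (metis orthogonal_transformation_def)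
    ultimately show ?thesis using generic[OF that(1), of "\<phi> \<zeta>"] \<zeta> orthogonal_transformation_norm[OF that(2)] by simp
  qed
  have "G \<noteq> {}"
  proof
    assume "G = {}"
    then have "sphere (0::real^3) 1 = {}" using dense by simp
    then show False by simp
  qed
  then obtain v0 where v0: "v0 \<in> G" by blast
  then have "norm (T v0) = 1" by (simp add: Tn G_def)
  then obtain \<phi>0 a0 where \<phi>0: "orthogonal_transformation \<phi>0" "\<phi>0 (T v0) = T v0"
      "\<And>y. T v0 \<bullet> y = 0 \<Longrightarrow> support_fun K y = support_fun L (\<phi>0 y) + a0 \<bullet> \<phi>0 y"
    using cong'[of "T v0"] T(3) by blast
  \<comment> \<open>The width is even, so with either sign of \<open>\<phi>0 \<zeta>\<close> the
    body \<open>L\<close> has maximal width along \<zeta> too.\<close>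
  have maxL: "width_fun L \<zeta> = max_width L"
    using \<phi>\<zeta>[OF v0 \<phi>0] by (auto simp: width_fun_def)
  obtain cK where cK: "cK + (max_width L / 2) *\<^sub>R \<zeta> \<in> K" "cK - (max_width L / 2) *\<^sub>R \<zeta> \<in> K"
    using diameter_of_max_width[OF K(1,2) \<zeta> max] unfolding D by blast
  obtain cL where cL: "cL + (max_width L / 2) *\<^sub>R \<zeta> \<in> L" "cL - (max_width L / 2) *\<^sub>R \<zeta> \<in> L"
    using diameter_of_max_width[OF L(1,2) \<zeta> maxL] .
  define F where "F y = support_fun L y - cL \<bullet> y" for y
  define H where "H y = support_fun K y - cK \<bullet> y" for y
  \<comment> \<open>\<open>f\<close> belongs to \<open>L\<close> and \<open>g\<close> to
    \<open>K\<close>, because the congruence takes \<open>K\<close> to \<open>L\<close> and gives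
    \<open>H y = F (\<phi> y)\<close>. Accordingly the symmetries to be excluded are those of
    projections of \<open>L\<close>.\<close>
  define f where "f x s = F (T x + s *\<^sub>R \<zeta>)" for x s
  define g where "g x s = H (T x + s *\<^sub>R \<zeta>)" for x s
  have cT: "continuous_on UNIV (\<lambda>x. T x + s *\<^sub>R \<zeta>)" for s
    using T(1) by (intro continuous_intros linear_continuous_on) (simp add: linear_conv_bounded_linear)
  have cF: "continuous_on UNIV F" "continuous_on UNIV H"
    unfolding F_def H_def by (intro continuous_intros continuous_on_support_fun K L)+
  have "(\<forall>x s. f x s = g x s) \<or> (\<forall>x s. f (- x) s = g x s)"
  proof (rule circlewise_related_imp[OF _ _ _ _ dense])
    show "continuous_on UNIV (\<lambda>x. f x s)" "continuous_on UNIV (\<lambda>x. g x s)" for s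
      unfolding f_def g_def using continuous_on_compose2[OF cF(1) cT] continuous_on_compose2[OF cF(2) cT] by auto
    show "G \<subseteq> sphere 0 1" by (auto simp: G_def)
    show "pi \<notin> rot_invariances f v" if v: "norm v = 1" for v
    proof
      assume inv: "pi \<in> rot_invariances f v"
      have w: "norm (T v) = 1" "T v \<bullet> \<zeta> = 0" using v Tn T(3) by auto
      have "pi_symmetric_on ({T v}\<^sup>\<bottom>) \<zeta> (orth_projection ({T v}\<^sup>\<bottom>) L)"
      proof (rule half_turn_symmetry[OF L w(1) \<zeta> w(2)])
        fix y assume y: "T v \<bullet> y = 0"
        obtain x where x: "y = T x + (\<zeta> \<bullet> y) *\<^sub>R \<zeta>" using T(4) by blast
        define s where "s = \<zeta> \<bullet> y"
        have "T v \<bullet> y = v \<bullet> x" by (subst x) (simp add: inner_add_right T)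
        then have "x \<bullet> v = 0" using y by (simp add: inner_commute)
        then have "f (- x) s = f x s" using inv by (auto simp: rot_invariances_def)
        moreover have "half_turn (T v) \<zeta> y = T (- x) + s *\<^sub>R \<zeta>"
          using y x unfolding s_def[symmetric] half_turn_def by (simp add: linear_neg[OF T(1)] scaleR_2 flip: scaleR_scaleR)
        ultimately show "support_fun L (half_turn (T v) \<zeta> y) - cL \<bullet> half_turn (T v) \<zeta> y = support_fun L y - cL \<bullet> y"
          using x unfolding s_def[symmetric] by (simp add: f_def F_def)
      qed
      then show False using nosym\<zeta>[OF w] by blast
    qed
    show "\<not> flip_related f f v u" if v: "norm v = 1" and u: "norm u = 1" "u \<bullet> v = 0" for v u
    proof
      assume fl: "flip_related f f v u"
      have w: "norm (T v) = 1" "T v \<bullet> \<zeta> = 0" "norm (T u) = 1" "T u \<bullet> \<zeta> = 0" "T u \<bullet> T v = 0" "T v \<bullet> T u = 0"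
        using v u Tn T(2,3) by (auto simp: inner_commute)
      have "pi_symmetric_on ({T v}\<^sup>\<bottom>) (T u) (orth_projection ({T v}\<^sup>\<bottom>) L)"
      proof (rule half_turn_symmetry[OF L w(1,3,6)])
        fix y assume y: "T v \<bullet> y = 0"
        obtain x where x: "y = T x + (\<zeta> \<bullet> y) *\<^sub>R \<zeta>" using T(4) by blast
        define s where "s = \<zeta> \<bullet> y"
        have "T v \<bullet> y = v \<bullet> x" "T u \<bullet> y = u \<bullet> x" by (subst x, simp add: inner_add_right T)+
        then have xv: "x \<bullet> v = 0" and ux: "T u \<bullet> y = u \<bullet> x" using y by (simp_all add: inner_commute)
        then have "f (flip u x) (- s) = f x s" using fl by (auto simp: flip_related_def)
        moreover have "half_turn (T v) (T u) y = T (flip u x) + (- s) *\<^sub>R \<zeta>"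
          unfolding half_turn_def y ux using x unfolding s_def[symmetric]
          by (simp add: flip_def linear_diff[OF T(1)] linear_scale[OF T(1)])
        ultimately show "support_fun L (half_turn (T v) (T u) y) - cL \<bullet> half_turn (T v) (T u) y = support_fun L y - cL \<bullet> y"
          using x unfolding s_def[symmetric] by (simp add: f_def F_def)
      qed
      then show False using nosym[OF w(1,2,3,4,5)] by blast
    qed
    show "(\<exists>a. 0 \<le> a \<and> a \<le> 2 * pi \<and> rot_related f g v a) \<or> (\<exists>u. norm u = 1 \<and> u \<bullet> v = 0 \<and> flip_related f g v u)"
      if vG: "v \<in> G" for v
    proof -
      have v: "norm v = 1" using vG by (simp add: G_def)
      have w: "norm (T v) = 1" "T v \<bullet> \<zeta> = 0" using v Tn T(3) by auto
      obtain \<phi> a where \<phi>: "orthogonal_transformation \<phi>" "\<phi> (T v) = T v" "det (matrix \<phi>) = 1"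
          and a: "T v \<bullet> a = 0" "\<And>k. k \<in> K \<Longrightarrow> \<exists>l\<in>L. \<phi> (along_proj (T v) k) = along_proj (T v) l + a"
          "\<And>y. T v \<bullet> y = 0 \<Longrightarrow> support_fun K y = support_fun L (\<phi> y) + a \<bullet> \<phi> y"
        using cong'[OF w] by blast
      have pm: "\<phi> \<zeta> = \<zeta> \<or> \<phi> \<zeta> = - \<zeta>" using \<phi>\<zeta>[OF vG \<phi>(1,2) a(3)] by blast
      have HF: "H y = F (\<phi> y)" if "T v \<bullet> y = 0" for y
        unfolding H_def F_def
        by (rule centered_support_transfer[OF L(1,2) w(1) \<zeta> w(2) \<phi>(1,2) pm a cK cL that])
      have l\<phi>: "linear \<phi>" using \<phi>(1) by (rule orthogonal_transformation_linear)
      obtain \<epsilon> :: real where \<epsilon>: "\<phi> \<zeta> = \<epsilon> *\<^sub>R \<zeta>" "\<epsilon> = 1 \<or> \<epsilon> = - 1"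
        using pm by (metis scaleR_one scaleR_minus1_left)
      have "\<exists>z. \<phi> (T x) = T z" for x
      proof -
        have "\<phi> \<zeta> \<bullet> \<phi> (T x) = 0" using \<phi>(1) T' by (simp add: orthogonal_transformation_def)
        then have "\<zeta> \<bullet> \<phi> (T x) = 0" using \<epsilon> by auto
        then show ?thesis using coord[of "\<phi> (T x)" 0] by simp
      qed
      then obtain N where N: "\<And>x. \<phi> (T x) = T (N x)" by metis
      have "orthogonal_transformation N"
        unfolding orthogonal_transformation
      proof (intro conjI allI)
        show "linear N"
          by (intro linearI Tinj) (simp_all add: N[symmetric] linear_add[OF T(1)] linear_scale[OF T(1)] linear_add[OF l\<phi>] linear_scale[OF l\<phi>])
        show "norm (N x) = norm x" for x
          by (metis N Tn orthogonal_transformation_norm[OF \<phi>(1)])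
      qed
      moreover have "N v = v" using \<phi>(2) N Tinj by metis
      \<comment> \<open>If \<epsilon> = 1, the determinant 1 of \<open>N\<close> makes it a rotation
        of the plane; if \<epsilon> = - 1, the determinant - 1 makes it a flip.\<close>
      moreover have dN: "\<epsilon> * det (matrix N) = 1" using Tdet[OF \<phi>(1) \<epsilon>(1) N] \<phi>(3) by simp
      ultimately have rot: "det (matrix N) = 1 \<Longrightarrow> \<exists>a. 0 \<le> a \<and> a \<le> 2 * pi \<and> (\<forall>x. x \<bullet> v = 0 \<longrightarrow> N x = rot v a x)"
        and fl: "det (matrix N) = - 1 \<Longrightarrow> \<exists>u. norm u = 1 \<and> u \<bullet> v = 0 \<and> (\<forall>x. x \<bullet> v = 0 \<longrightarrow> N x = flip u x)"
        using orthogonal_transformation_fixing_axis v by blast+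
      have fg: "f (N x) (\<epsilon> * s) = g x s" if "x \<bullet> v = 0" for x s
      proof -
        have "T v \<bullet> (T x + s *\<^sub>R \<zeta>) = 0" using that T by (simp add: inner_add_right inner_commute)
        then have "g x s = F (\<phi> (T x + s *\<^sub>R \<zeta>))" using HF by (simp add: g_def)
        also have "\<phi> (T x + s *\<^sub>R \<zeta>) = T (N x) + (\<epsilon> * s) *\<^sub>R \<zeta>"
          by (simp add: linear_add[OF l\<phi>] linear_scale[OF l\<phi>] N \<epsilon>(1) mult.commute)
        finally show ?thesis by (simp add: f_def)
      qed
      show ?thesis
        using \<epsilon>(2)
      proof
        assume "\<epsilon> = 1"
        then obtain b where "0 \<le> b" "b \<le> 2 * pi" "\<And>x. x \<bullet> v = 0 \<Longrightarrow> N x = rot v b x"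
          using rot dN by auto
        moreover from this have "rot_related f g v b"
          using fg \<open>\<epsilon> = 1\<close> by (simp add: rot_related_def)
        ultimately show ?thesis by blast
      next
        assume "\<epsilon> = - 1"
        then obtain u where "norm u = 1" "u \<bullet> v = 0" "\<And>x. x \<bullet> v = 0 \<Longrightarrow> N x = flip u x"
          using fl dN by auto
        moreover from this have "flip_related f g v u"
          using fg \<open>\<epsilon> = - 1\<close> by (simp add: flip_related_def)
        ultimately show ?thesis by blast
      qed
    qed
  qed
  then have "(\<forall>y. F y = H y) \<or> (\<forall>y. F (- reflect \<zeta> y) = H y)"
  proof
    assume fg: "\<forall>x s. f x s = g x s"
    have "F y = H y" for y
      using fg T(4)[of y] unfolding f_def g_def by metis
    then show ?thesis by blast
  next
    assume fg: "\<forall>x s. f (- x) s = g x s"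
    \<comment> \<open>\<open>- reflect \<zeta>\<close> negates the part of \<open>y\<close>
      orthogonal to \<zeta> and keeps the part along it.\<close>
    have "F (- reflect \<zeta> y) = H y" for y
    proof -
      obtain x where x: "y = T x + (\<zeta> \<bullet> y) *\<^sub>R \<zeta>" using T(4) by blast
      define s where "s = \<zeta> \<bullet> y"
      have "- reflect \<zeta> y = T (- x) + s *\<^sub>R \<zeta>"
        unfolding reflect_def s_def[symmetric] using x[folded s_def]
        by (simp add: linear_neg[OF T(1)] scaleR_2 flip: scaleR_scaleR)
      then show ?thesis using fg x[folded s_def] unfolding f_def g_def by metis
    qed
    then show ?thesis by blast
  qed
  then show ?thesis using that unfolding F_def H_def by blast
qed

lemma orthogonal_transformation_axial:
  fixes \<zeta> :: "real^4"
  assumes "norm \<zeta> = 1"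
  shows "orthogonal_transformation (\<lambda>y. - reflect \<zeta> y)" "det (matrix (\<lambda>y. - reflect \<zeta> y)) = - 1"
proof -
  note o = orthogonal_transformation_reflect[OF assms]
  show "orthogonal_transformation (\<lambda>y. - reflect \<zeta> y)" using o by (simp add: orthogonal_transformation_neg)
  have "(\<lambda>y. - reflect \<zeta> y) = (\<lambda>x. - x) \<circ> reflect \<zeta>" by auto
  then show "det (matrix (\<lambda>y. - reflect \<zeta> y)) = - 1"
    using o assms orthogonal_transformation_neg[of "\<lambda>x::real^4. x"]
    by (simp add: matrix_compose orthogonal_transformation_linear det_mul det_reflect det_negation)
qed

text \<open>If \<open>K\<close> is a translate of the image of \<open>L\<close> under \<open>\<O>\<close>, then \<open>K|\<zeta>\<^sup>\<bottom>\<close> is a translate of \<open>- L|\<zeta>\<^sup>\<bottom>\<close>,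
  so \<open>- \<phi>\<close> is a symmetry of \<open>K|\<zeta>\<^sup>\<bottom>\<close>; it has determinant \<open>- 1\<close>, hence differs from the identity.\<close>

lemma rigid_motion_symmetric_of_axial:
  fixes K L :: "(real^4) set"
  assumes \<zeta>: "norm \<zeta> = 1" and KL: "K = (\<lambda>x. x + b) ` (\<lambda>y. - reflect \<zeta> y) ` L"
    and dc: "directly_congruent_on ({\<zeta>}\<^sup>\<bottom>) (orth_projection ({\<zeta>}\<^sup>\<bottom>) K) (orth_projection ({\<zeta>}\<^sup>\<bottom>) L)"
  shows "rigid_motion_symmetric_on ({\<zeta>}\<^sup>\<bottom>) (orth_projection ({\<zeta>}\<^sup>\<bottom>) K)"
proof -
  let ?P = "along_proj \<zeta>" and ?O = "\<lambda>y. - reflect \<zeta> y"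
  note lP = linear_add[OF linear_along_proj[of \<zeta>]]
  have O: "?O \<zeta> = \<zeta>" "\<And>x. \<zeta> \<bullet> x = 0 \<Longrightarrow> ?O x = - x" using \<zeta> by (simp_all add: reflect_def norm_eq_1 scaleR_2)
  note Oo = orthogonal_transformation_axial[OF \<zeta>]
  have P0: "\<zeta> \<bullet> ?P x = 0" for x using along_proj_orthogonal[OF \<zeta>] .
  have PO: "?P (?O x) = - ?P x" for x
    using \<zeta> by (simp add: along_proj_def reflect_def inner_diff_right norm_eq_1 algebra_simps) (simp add: scaleR_2 flip: scaleR_scaleR)
  obtain \<phi> a where \<phi>: "orthogonal_transformation \<phi>" "\<phi> \<zeta> = \<zeta>" "det (matrix \<phi>) = 1" "\<zeta> \<bullet> a = 0"
    and im: "\<phi> ` ?P ` K = (\<lambda>x. x + a) ` ?P ` L"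
    using dc by (auto simp: directly_congruent_on_def special_orthogonal_group_on_def
       orthogonal_group_on_hyperplane[OF \<zeta>] orth_projection_eq_image[OF \<zeta>] mem_orthogonal_comp_singleton)
  \<comment> \<open>\<open>?O\<close> is minus the identity on the hyperplane but fixes \<zeta>, as
    the representation of \<open>orthogonal_group_on\<close> by maps of the whole space
    requires.\<close>
  define \<rho> where "\<rho> = ?O \<circ> \<phi>"
  have \<rho>: "orthogonal_transformation \<rho>" "\<rho> \<zeta> = \<zeta>"
    unfolding \<rho>_def using Oo(1) \<phi>(1,2) O(1) by (auto intro: orthogonal_transformation_compose)
  have l\<rho>: "linear \<rho>" using \<rho>(1) by (rule orthogonal_transformation_linear)
  have "\<rho> ` ?P ` K = ?O ` (\<lambda>x. x + a) ` ?P ` L" unfolding \<rho>_def image_comp[symmetric] im ..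
  also have "\<dots> = (\<lambda>x. x + (- ?P b - a)) ` ?P ` K"
  proof -
    have "?O (?P l + a) = ?P (?O l + b) + (- ?P b - a)" for l
    proof -
      have "?O (?P l + a) = - (?P l + a)" using P0[of l] \<phi>(4) by (intro O(2)) (simp add: inner_add_right)
      then show ?thesis unfolding lP PO by simp
    qed
    then show ?thesis unfolding KL image_image by simp
  qed
  finally have sym: "\<rho> ` ?P ` K = (\<lambda>x. x + (- ?P b - a)) ` ?P ` K" .
  have "\<exists>x\<in>{\<zeta>}\<^sup>\<bottom>. \<rho> x \<noteq> x"
  proof (rule ccontr)
    assume "\<not> ?thesis"
    then have id: "\<rho> x = x" if "\<zeta> \<bullet> x = 0" for x using that by (auto simp: mem_orthogonal_comp_singleton)
    have "\<rho> x = x" for x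
    proof -
      have "x = ?P x + (\<zeta> \<bullet> x) *\<^sub>R \<zeta>" by (simp add: along_proj_def)
      moreover have "\<rho> (?P x + (\<zeta> \<bullet> x) *\<^sub>R \<zeta>) = ?P x + (\<zeta> \<bullet> x) *\<^sub>R \<zeta>"
        using id[OF P0[of x]] \<rho>(2) l\<rho> by (simp add: linear_add linear_scale)
      ultimately show ?thesis by simp
    qed
    then have "\<rho> = id" by auto
    then have "det (matrix \<rho>) = 1" by simp
    moreover have "det (matrix \<rho>) = - 1"
      unfolding \<rho>_def using Oo \<phi>(1,3) by (simp add: matrix_compose orthogonal_transformation_linear det_mul)
    ultimately show False by simp
  qed
  moreover have "- ?P b - a \<in> {\<zeta>}\<^sup>\<bottom>" using P0[of b] \<phi>(4) by (simp add: mem_orthogonal_comp_singleton inner_diff_right)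
  ultimately show ?thesis
    using sym \<rho> unfolding rigid_motion_symmetric_on_def orth_projection_eq_image[OF \<zeta>]
    by (metis orthogonal_group_on_hyperplane[OF \<zeta>])
qed

lemma translate_of_support_fun:
  fixes A B :: "'a::euclidean_space set"
  assumes A: "compact A" "A \<noteq> {}" "convex A" and B: "compact B" "B \<noteq> {}" "convex B"
    and eq: "\<And>y. support_fun A y = support_fun B y + b \<bullet> y"
  shows "A = (\<lambda>x. x + b) ` B"
proof (rule support_fun_eqD[OF A])
  show "compact ((\<lambda>x. x + b) ` B)" "(\<lambda>x. x + b) ` B \<noteq> {}" "convex ((\<lambda>x. x + b) ` B)"
    using B convex_translation[of B b] by (auto intro!: compact_continuous_image continuous_intros simp: add.commute)
qed (simp add: support_fun_translate[OF B(1,2)] eq inner_commute)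

theorem theorem1:
  fixes K L :: "(real^4) set" and \<zeta> :: "real^4"
  assumes "convex_body K" and "convex_body L"
    and "countably_many_diameters K" and "countably_many_diameters L"
    and "\<zeta> \<in> sphere 0 1"
    and "has_diameter_parallel K \<zeta>"
    and "\<And>w. w \<in> sphere 0 1 \<Longrightarrow> \<zeta> \<in> {w}\<^sup>\<bottom> \<Longrightarrow>
           directly_congruent_on ({w}\<^sup>\<bottom>) (orth_projection ({w}\<^sup>\<bottom>) K) (orth_projection ({w}\<^sup>\<bottom>) L)"
    and "\<And>w M. w \<in> sphere 0 1 \<Longrightarrow> \<zeta> \<in> {w}\<^sup>\<bottom> \<Longrightarrow> M \<in> {K, L} \<Longrightarrow>
           \<not> pi_symmetric_on ({w}\<^sup>\<bottom>) \<zeta> (orth_projection ({w}\<^sup>\<bottom>) M)"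
    and "\<And>w u M. w \<in> sphere 0 1 \<Longrightarrow> \<zeta> \<in> {w}\<^sup>\<bottom> \<Longrightarrow> M \<in> {K, L} \<Longrightarrow>
           u \<in> {\<zeta>}\<^sup>\<bottom> \<inter> {w}\<^sup>\<bottom> \<inter> sphere 0 1 \<Longrightarrow>
           \<not> pi_symmetric_on ({w}\<^sup>\<bottom>) u (orth_projection ({w}\<^sup>\<bottom>) M)"
  shows "(\<exists>\<O> b. orthogonal_transformation \<O> \<and> (\<forall>x\<in>{\<zeta>}\<^sup>\<bottom>. \<O> x = - x) \<and> \<O> \<zeta> = \<zeta> \<and>
            (K = (\<lambda>x. x + b) ` L \<or> K = (\<lambda>x. x + b) ` (\<O> ` L))) \<and>
         (directly_congruent_on ({\<zeta>}\<^sup>\<bottom>) (orth_projection ({\<zeta>}\<^sup>\<bottom>) K) (orth_projection ({\<zeta>}\<^sup>\<bottom>) L) \<and>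
          \<not> rigid_motion_symmetric_on ({\<zeta>}\<^sup>\<bottom>) (orth_projection ({\<zeta>}\<^sup>\<bottom>) K) \<and>
          \<not> rigid_motion_symmetric_on ({\<zeta>}\<^sup>\<bottom>) (orth_projection ({\<zeta>}\<^sup>\<bottom>) L)
          \<longrightarrow> (\<exists>b. K = (\<lambda>x. x + b) ` L))"
proof -
  have K: "compact K" "K \<noteq> {}" "convex K" and L: "compact L" "L \<noteq> {}" "convex L"
    using assms(1,2) interior_subset by (fastforce simp: convex_body_def)+
  have \<zeta>: "norm \<zeta> = 1" using assms(5) by simp
  let ?O = "\<lambda>y. - reflect \<zeta> y"
  note O = orthogonal_transformation_axial(1)[OF \<zeta>]
  have lO: "linear ?O" using O by (rule orthogonal_transformation_linear)
  \<comment> \<open>\<open>?O\<close> is its own adjoint, so composing the support function of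
    \<open>L\<close> with it gives that of the image of \<open>L\<close>.\<close>
  have adj: "y \<bullet> ?O x = ?O y \<bullet> x" for x y
    by (simp add: reflect_def inner_diff_right inner_diff_left inner_commute)
  have O_fix: "?O \<zeta> = \<zeta>" "\<forall>x\<in>{\<zeta>}\<^sup>\<bottom>. ?O x = - x"
    using \<zeta> by (simp_all add: reflect_def norm_eq_1 scaleR_2 mem_orthogonal_comp_singleton)
  have OL: "compact (?O ` L)" "?O ` L \<noteq> {}" "convex (?O ` L)"
    using L lO by (auto intro!: compact_continuous_image linear_continuous_on convex_linear_image
        simp: linear_conv_bounded_linear)
  obtain cK cL where dich:
    "(\<forall>y. support_fun L y - cL \<bullet> y = support_fun K y - cK \<bullet> y) \<or>
     (\<forall>y. support_fun L (?O y) - cL \<bullet> ?O y = support_fun K y - cK \<bullet> y)"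
  proof (rule support_fun_dichotomy[OF K L assms(3,4) \<zeta> assms(6)])
    fix w assume w: "norm w = 1" "w \<bullet> \<zeta> = 0"
    show "directly_congruent_on ({w}\<^sup>\<bottom>) (orth_projection ({w}\<^sup>\<bottom>) K) (orth_projection ({w}\<^sup>\<bottom>) L)"
      using w by (intro assms(7)) (auto simp: mem_orthogonal_comp_singleton)
    show "\<not> pi_symmetric_on ({w}\<^sup>\<bottom>) \<zeta> (orth_projection ({w}\<^sup>\<bottom>) L)"
      using w by (intro assms(8)) (auto simp: mem_orthogonal_comp_singleton)
    fix u assume "norm u = 1" "u \<bullet> \<zeta> = 0" "u \<bullet> w = 0"
    then show "\<not> pi_symmetric_on ({w}\<^sup>\<bottom>) u (orth_projection ({w}\<^sup>\<bottom>) L)"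
      using w by (intro assms(9)) (auto simp: mem_orthogonal_comp_singleton inner_commute)
  qed blast
  have cases: "(\<exists>b. K = (\<lambda>x. x + b) ` L) \<or> (\<exists>b. K = (\<lambda>x. x + b) ` ?O ` L)"
    using dich
  proof
    assume eq: "\<forall>y. support_fun L y - cL \<bullet> y = support_fun K y - cK \<bullet> y"
    have "support_fun K y = support_fun L y + (cK - cL) \<bullet> y" for y
      using eq[rule_format, of y] by (simp add: inner_diff_left)
    then show ?thesis using translate_of_support_fun[OF K L] by blast
  next
    assume eq: "\<forall>y. support_fun L (?O y) - cL \<bullet> ?O y = support_fun K y - cK \<bullet> y"
    have "support_fun K y = support_fun (?O ` L) y + (cK - ?O cL) \<bullet> y" for y
    proof -
      have "support_fun (?O ` L) y = support_fun L (?O y)"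
        by (rule support_fun_linear_image[OF L(1,2) lO adj])
      then show ?thesis using eq[rule_format, of y] adj[of cL y] by (simp only: inner_diff_left)
    qed
    then show ?thesis using translate_of_support_fun[OF K OL] by blast
  qed
  show ?thesis
  proof (intro conjI impI)
    show "\<exists>\<O> b. orthogonal_transformation \<O> \<and> (\<forall>x\<in>{\<zeta>}\<^sup>\<bottom>. \<O> x = - x) \<and> \<O> \<zeta> = \<zeta> \<and>
            (K = (\<lambda>x. x + b) ` L \<or> K = (\<lambda>x. x + b) ` (\<O> ` L))"
      using cases O O_fix by (intro exI[of _ ?O]) blast
  next
    assume H: "directly_congruent_on ({\<zeta>}\<^sup>\<bottom>) (orth_projection ({\<zeta>}\<^sup>\<bottom>) K) (orth_projection ({\<zeta>}\<^sup>\<bottom>) L) \<and>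
          \<not> rigid_motion_symmetric_on ({\<zeta>}\<^sup>\<bottom>) (orth_projection ({\<zeta>}\<^sup>\<bottom>) K) \<and>
          \<not> rigid_motion_symmetric_on ({\<zeta>}\<^sup>\<bottom>) (orth_projection ({\<zeta>}\<^sup>\<bottom>) L)"
    then show "\<exists>b. K = (\<lambda>x. x + b) ` L"
      using cases rigid_motion_symmetric_of_axial[OF \<zeta>] by blast
  qed
qed

end
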